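(* Let $\mathcal{M}$ be a $\mathbf{Cat}$-enriched multicategory. There is a pseudo symmetric $\mathbf{Cat}$-multifunctor $\eta_{\mathcal{M}}\colon \mathcal{M}\to \mathcal{M}\times E\Sigma_*$ such that for every $\mathbf{Cat}$-enriched multicategory $\mathcal{N}$ and every pseudo symmetric $\mathbf{Cat}$-multifunctor $F\colon \mathcal{M}\to\mathcal{N}$ there exists a unique symmetric $\mathbf{Cat}$-multifunctor $\phi(F)\colon \mathcal{M}\times E\Sigma_*\to\mathcal{N}$ with $F=\phi(F)\circ\eta_{\mathcal{M}}$ as pseudo symmetric $\mathbf{Cat}$-multifunctors (where $\phi(F)$ is regarded as a pseudo symmetric $\mathbf{Cat}$-multifunctor with identity symmetry isomorphisms).
   Context: **Permutations.** $\Sigma_n$ is the symmetric group, with $\sigma\tau=\sigma\circ\tau$. For a sequence $\langle a\rangle=\langle a_1,\dots,a_n\rangle$ put $\langle a\rangle\sigma=\langle a_{\sigma(1)},\dots,a_{\sigma(n)}\rangle$. For $\sigma\in\Sigma_n$ and $\tau_i\in\Sigma_{k_i}$, $\sigma\langle\tau_1,\dots,\tau_n\rangle\in\Sigma_{k_1+\cdots+k_n}$ permutes the $n$ blocks of lengths $k_1,\dots,k_n$ according to $\sigma$ and each block according to $\tau_i$: it sends the $p$-th element of the $i$-th block (block lengths $k_1,\dots,k_n$) to the $\tau_i(p)$-th element of the $\sigma(i)$-th block (block lengths $k_{\sigma^{-1}(1)},\dots,k_{\sigma^{-1}(n)}$). **$\mathbf{Cat}$-multicategories** ($\mathbf{Cat}$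 has the monoidal structure given by products). A $\mathbf{Cat}$-multicategory $\mathcal{M}$ has: a class of objects $\mathrm{Ob}(\mathcal{M})$; for all $n\ge 0$, $\langle a\rangle\in \mathrm{Ob}(\mathcal{M})^n$, $b\in\mathrm{Ob}(\mathcal{M})$ a category $\mathcal{M}(\langle a\rangle;b)$, whose objects $f\colon\langle a\rangle\to b$ are called ($n$-ary) 1-cells and whose morphisms are called ($n$-ary) 2-cells; for $\sigma\in\Sigma_n$ an isomorphism of categories $\mathcal{M}(\langle a\rangle;b)\to\mathcal{M}(\langle a\rangle\sigma;b)$, $f\mapsto f\sigma$ (and similarly on 2-cells); units $1_a\in\mathcal{M}(a;a)$; and composition functors $\gamma\colon\mathcal{M}(\langle b\rangle;c)\times\prod_{j=1}^n\mathcal{M}(\langle a_j\rangle;b_j)\to\mathcal{M}(\langle a_1\rangle,\dots,\langle a_n\rangle;c)$, where $\langle a_j\rangle$ has length $k_j\ge 0$ and the inputs are concatenated. These satisfy: $(f\sigma)\tau=f(\sigma\tau)$ and $f\,\mathrm{id}_n=f$; $\gamma$ is associative and unital; top equivariance $\gamma(f\sigma;\langle g_{\sigma(j)}\rangle)=\gamma(f;\langle g_j\rangle)\,\sigma\langle\mathrm{id}_{k_{\sigma(1)}},\dots,\mathrm{id}_{k_{\sigma(n)}}\rangle$; bottom equivariance $\gamma(f;\langle g_j\tau_j\rangle)=\gamma(f;\langle g_j\rangle)\,\mathrm{id}_n\langle\tau_1,\dots,\tau_n\rangle$ for $\tau_j\in\Sigma_{k_j}$ (all axioms on both 1-cells and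 2-cells). A $\mathbf{Cat}$-operad is a $\mathbf{Cat}$-multicategory with one object $*$. **Symmetric $\mathbf{Cat}$-multifunctors.** A symmetric $\mathbf{Cat}$-multifunctor $F\colon\mathcal{M}\to\mathcal{N}$ is a function on objects together with functors $F\colon\mathcal{M}(\langle a\rangle;b)\to\mathcal{N}(\langle Fa\rangle;Fb)$ strictly preserving units, $\gamma$ and the symmetric group action. **Pseudo symmetric $\mathbf{Cat}$-multifunctors.** A pseudo symmetric $\mathbf{Cat}$-multifunctor $F\colon\mathcal{M}\to\mathcal{N}$ is a function on objects together with functors $F\colon\mathcal{M}(\langle a\rangle;b)\to\mathcal{N}(\langle Fa\rangle;Fb)$ strictly preserving units and $\gamma$, and, for each $\sigma\in\Sigma_n$, $\langle a\rangle\in\mathrm{Ob}(\mathcal{M})^n$, $b\in\mathrm{Ob}(\mathcal{M})$, a natural isomorphism with components $F_{\sigma;f}\colon F(f\sigma)\to F(f)\sigma$ for $f\colon\langle a\rangle\to b$, such that: (1) $F_{\mathrm{id}_n;f}=1_{Ff}$; (2) $F_{\sigma\tau;f}=(F_{\sigma;f})\tau\circ F_{\tau;f\sigma}$; (3) $F_{\sigma\langle\mathrm{id}_{k_{\sigma(1)}},\dots,\mathrm{id}_{k_{\sigma(n)}}\rangle;\,\gamma(f;\langle g_j\rangle)}=\gamma(F_{\sigma;f};\langle 1_{Fg_{\sigma(j)}}\rangle_{j=1}^n)$ for $f\colon\langle b\rangle\to c$, $g_j\colon\langle a_j\rangle\to b_j$, where $k_j$ is the length of $\langle a_j\rangle$;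 (4) $F_{\mathrm{id}_n\langle\tau_1,\dots,\tau_n\rangle;\,\gamma(f;\langle g_j\rangle)}=\gamma(1_{Ff};\langle F_{\tau_j;g_j}\rangle)$ for $\tau_j\in\Sigma_{k_j}$. The composite $GF$ of pseudo symmetric $\mathbf{Cat}$-multifunctors is given by composition on objects and component functors, with $(GF)_{\sigma;f}=G_{\sigma;Ff}\circ G(F_{\sigma;f})$. A symmetric $\mathbf{Cat}$-multifunctor is regarded as pseudo symmetric with identity isomorphisms $F_{\sigma;f}$. Two pseudo symmetric $\mathbf{Cat}$-multifunctors are equal if they agree on objects, component functors, and symmetry isomorphisms. **$E\Sigma_*$ and $\mathcal{M}\times E\Sigma_*$.** $E\Sigma_*$ (the Barratt–Eccles operad) is the $\mathbf{Cat}$-operad whose $n$-th category $E\Sigma_n$ has object set $\Sigma_n$ and exactly one morphism between any two objects; on objects the right $\Sigma_n$-action is right multiplication, $\gamma(\sigma;\langle\rho_i\rangle)=\sigma\langle\rho_1,\dots,\rho_n\rangle$, and the unit is $\mathrm{id}_1$ (this determines everything on morphisms). $\mathcal{M}\times E\Sigma_*$ is the product $\mathbf{Cat}$-multicategory: objects $(a,* )$ with $a\in\mathrm{Ob}(\mathcal{M})$, hom categories $\mathcal{M}(\langle a\rangle;b)\times E\Sigma_n$ for $\langle a\rangle$ of length $n$, and units, symmetric group action and $\gamma$ defined componentwise. *)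

theory Defs
  imports "HOL-Combinatorics.Permutations"
begin

section \<open>Block permutations\<close>

text \<open>
  The symmetric group on \<open>n\<close> letters is the set of functions \<open>\<sigma>\<close> with
  \<^term>\<open>\<sigma> permutes {..<n}\<close>, so positions are counted from \<open>0\<close>. The sequence
  \<open>\<langle>a\<rangle>\<sigma>\<close> is \<^term>\<open>permute_list \<sigma> as\<close>, whose \<open>i\<close>-th entry is \<^term>\<open>as ! \<sigma> i\<close>.
\<close>

text \<open>\<open>locate ks m = (i, p)\<close>: position \<open>m\<close> is the \<open>p\<close>-th element of the \<open>i\<close>-th of
  consecutive blocks of lengths \<open>ks\<close>.\<close>

fun locate :: "nat list \<Rightarrow> nat \<Rightarrow> nat \<times> nat" where
  "locate [] m = (0, m)"
| "locate (k # ks) m =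
     (if m < k then (0, m) else (let (i, p) = locate ks (m - k) in (Suc i, p)))"

text \<open>\<open>block_perm \<sigma> ks \<tau>s\<close> is \<open>\<sigma>\<langle>\<tau>\<^sub>1,\<dots>,\<tau>\<^sub>n\<rangle>\<close>, with \<open>\<tau>\<^sub>i\<close> a permutation of \<open>k\<^sub>i\<close> letters. The
  lengths \<open>ks\<close> are an argument because a function \<open>\<tau>\<close> does not determine the \<open>k\<close> for which
  it is regarded as a permutation of \<open>k\<close> letters.\<close>

definition block_perm :: "(nat \<Rightarrow> nat) \<Rightarrow> nat list \<Rightarrow> (nat \<Rightarrow> nat) list \<Rightarrow> nat \<Rightarrow> nat" where
  "block_perm \<sigma> ks \<tau>s m =
     (if m < sum_list ks
      then (let (i, p) = locate ks m
            in sum_list (take (\<sigma> i) (permute_list (inv \<sigma>) ks)) + (\<tau>s ! i) p)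
      else m)"

lemma locate_block:
  "i < length ks \<Longrightarrow> p < ks ! i \<Longrightarrow> locate ks (sum_list (take i ks) + p) = (i, p)"
  by (induction ks arbitrary: i) (auto simp: nth_Cons split: nat.splits)

lemma block_less_sum_list:
  "i < length ks \<Longrightarrow> p < ks ! i \<Longrightarrow> sum_list (take i ks) + p < sum_list (ks :: nat list)"
proof (induction ks arbitrary: i)
  case (Cons k ks)
  then show ?case by (cases i) (auto simp: add.assoc)
qed simp

lemma block_perm_block:
  assumes "i < length ks" "p < ks ! i"
  shows "block_perm \<sigma> ks \<tau>s (sum_list (take i ks) + p) =
    sum_list (take (\<sigma> i) (permute_list (inv \<sigma>) ks)) + (\<tau>s ! i) p"
  using assms by (simp add: block_perm_def locate_block block_less_sum_list)


section \<open>Categories\<close>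

record ('c, 'd) cat =
  Obj :: "'c set"
  Arr :: "'d set"
  Dom :: "'d \<Rightarrow> 'c"
  Cod :: "'d \<Rightarrow> 'c"
  Ident :: "'c \<Rightarrow> 'd"
  Comp :: "'d \<Rightarrow> 'd \<Rightarrow> 'd"  \<comment> \<open>\<open>Comp C g f\<close> is \<open>g \<circ> f\<close>\<close>

definition category :: "('c, 'd) cat \<Rightarrow> bool" where
  "category C \<longleftrightarrow>
    (\<forall>f\<in>Arr C. Dom C f \<in> Obj C \<and> Cod C f \<in> Obj C) \<and>
    (\<forall>x\<in>Obj C. Ident C x \<in> Arr C \<and> Dom C (Ident C x) = x \<and> Cod C (Ident C x) = x) \<and>
    (\<forall>f\<in>Arr C. \<forall>g\<in>Arr C. Dom C g = Cod C f \<longrightarrow>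
      Comp C g f \<in> Arr C \<and> Dom C (Comp C g f) = Dom C f \<and> Cod C (Comp C g f) = Cod C g) \<and>
    (\<forall>f\<in>Arr C. Comp C (Ident C (Cod C f)) f = f \<and> Comp C f (Ident C (Dom C f)) = f) \<and>
    (\<forall>f\<in>Arr C. \<forall>g\<in>Arr C. \<forall>h\<in>Arr C. Dom C g = Cod C f \<longrightarrow> Dom C h = Cod C g \<longrightarrow>
      Comp C (Comp C h g) f = Comp C h (Comp C g f))"

text \<open>A functor is given by its object map \<open>F\<close> and its arrow map \<open>F'\<close>.\<close>

definition cat_functor ::
  "('c, 'd) cat \<Rightarrow> ('e, 'g) cat \<Rightarrow> ('c \<Rightarrow> 'e) \<Rightarrow> ('d \<Rightarrow> 'g) \<Rightarrow> bool" where
  "cat_functor C D F F' \<longleftrightarrow>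
    (\<forall>x\<in>Obj C. F x \<in> Obj D) \<and>
    (\<forall>f\<in>Arr C. F' f \<in> Arr D \<and> Dom D (F' f) = F (Dom C f) \<and> Cod D (F' f) = F (Cod C f)) \<and>
    (\<forall>x\<in>Obj C. F' (Ident C x) = Ident D (F x)) \<and>
    (\<forall>f\<in>Arr C. \<forall>g\<in>Arr C. Dom C g = Cod C f \<longrightarrow> F' (Comp C g f) = Comp D (F' g) (F' f))"

definition cat_isomorphism ::
  "('c, 'd) cat \<Rightarrow> ('e, 'g) cat \<Rightarrow> ('c \<Rightarrow> 'e) \<Rightarrow> ('d \<Rightarrow> 'g) \<Rightarrow> bool" where
  "cat_isomorphism C D F F' \<longleftrightarrow>
    cat_functor C D F F' \<and> bij_betw F (Obj C) (Obj D) \<and> bij_betw F' (Arr C) (Arr D)"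

definition iso_arr :: "('c, 'd) cat \<Rightarrow> 'd \<Rightarrow> bool" where
  "iso_arr C f \<longleftrightarrow> f \<in> Arr C \<and>
    (\<exists>g\<in>Arr C. Dom C g = Cod C f \<and> Cod C g = Dom C f \<and>
      Comp C g f = Ident C (Dom C f) \<and> Comp C f g = Ident C (Cod C f))"

definition natural_iso ::
  "('c, 'd) cat \<Rightarrow> ('e, 'g) cat \<Rightarrow> ('c \<Rightarrow> 'e) \<Rightarrow> ('d \<Rightarrow> 'g) \<Rightarrow> ('c \<Rightarrow> 'e) \<Rightarrow> ('d \<Rightarrow> 'g)
    \<Rightarrow> ('c \<Rightarrow> 'g) \<Rightarrow> bool" where
  "natural_iso C D F F' G G' \<theta> \<longleftrightarrow>
    (\<forall>x\<in>Obj C. iso_arr D (\<theta> x) \<and> Dom D (\<theta> x) = F x \<and> Cod D (\<theta> x) = G x) \<and>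
    (\<forall>f\<in>Arr C. Comp D (G' f) (\<theta> (Dom C f)) = Comp D (\<theta> (Cod C f)) (F' f))"

definition prod_cat :: "('c, 'd) cat \<Rightarrow> ('e, 'g) cat \<Rightarrow> ('c \<times> 'e, 'd \<times> 'g) cat" where
  "prod_cat C D = \<lparr>
     Obj = Obj C \<times> Obj D,
     Arr = Arr C \<times> Arr D,
     Dom = map_prod (Dom C) (Dom D),
     Cod = map_prod (Cod C) (Cod D),
     Ident = map_prod (Ident C) (Ident D),
     Comp = (\<lambda>(g, g') (f, f'). (Comp C g f, Comp D g' f'))\<rparr>"

definition prod_list_cat :: "('c, 'd) cat list \<Rightarrow> ('c list, 'd list) cat" where
  "prod_list_cat Cs = \<lparr>
     Obj = {xs. list_all2 (\<lambda>C x. x \<in> Obj C) Cs xs},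
     Arr = {fs. list_all2 (\<lambda>C f. f \<in> Arr C) Cs fs},
     Dom = map2 Dom Cs,
     Cod = map2 Cod Cs,
     Ident = map2 Ident Cs,
     Comp = (\<lambda>gs fs. map2 (\<lambda>C (g, f). Comp C g f) Cs (zip gs fs))\<rparr>"


section \<open>Cat-multicategories\<close>

text \<open>
  Every 1-cell knows its inputs \<open>src\<close> and its output \<open>tgt\<close>, and every 2-cell knows its
  domain and codomain 1-cells, so that the hom categories are disjoint. The category
  \<open>\<M>(\<langle>a\<rangle>;b)\<close> is \<open>hom_cat M as b\<close> below. The suffixes 1 and 2 refer to 1-cells and 2-cells:
  \<open>act1 M f \<sigma>\<close> is \<open>f\<sigma>\<close> and \<open>gamma1 M f [g\<^sub>1,\<dots>,g\<^sub>n]\<close> is \<open>\<gamma>(f;\<langle>g\<^sub>1,\<dots>,g\<^sub>n\<rangle>)\<close>.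
\<close>

record ('o, 'c, 'd) multicat =
  Ob :: "'o set"
  Cell1 :: "'c set"
  src :: "'c \<Rightarrow> 'o list"
  tgt :: "'c \<Rightarrow> 'o"
  Cell2 :: "'d set"
  dom2 :: "'d \<Rightarrow> 'c"
  cod2 :: "'d \<Rightarrow> 'c"
  ident2 :: "'c \<Rightarrow> 'd"
  vcomp :: "'d \<Rightarrow> 'd \<Rightarrow> 'd"
  act1 :: "'c \<Rightarrow> (nat \<Rightarrow> nat) \<Rightarrow> 'c"
  act2 :: "'d \<Rightarrow> (nat \<Rightarrow> nat) \<Rightarrow> 'd"
  unit1 :: "'o \<Rightarrow> 'c"
  gamma1 :: "'c \<Rightarrow> 'c list \<Rightarrow> 'c"
  gamma2 :: "'d \<Rightarrow> 'd list \<Rightarrow> 'd"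

definition hom_cat :: "('o, 'c, 'd) multicat \<Rightarrow> 'o list \<Rightarrow> 'o \<Rightarrow> ('c, 'd) cat" where
  "hom_cat M as b = \<lparr>
     Obj = {f \<in> Cell1 M. src M f = as \<and> tgt M f = b},
     Arr = {\<alpha> \<in> Cell2 M. src M (dom2 M \<alpha>) = as \<and> tgt M (dom2 M \<alpha>) = b},
     Dom = dom2 M,
     Cod = cod2 M,
     Ident = ident2 M,
     Comp = vcomp M\<rparr>"

text \<open>The input sequence and its length (the arity) of a 2-cell are those of its domain,
  which by axiom \<open>parallel\<close> below are also those of its codomain.\<close>

abbreviation arity1 :: "('o, 'c, 'd) multicat \<Rightarrow> 'c \<Rightarrow> nat" where
  "arity1 M f \<equiv> length (src M f)"

abbreviation arity2 :: "('o, 'c, 'd) multicat \<Rightarrow> 'd \<Rightarrow> nat" where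
  "arity2 M \<alpha> \<equiv> arity1 M (dom2 M \<alpha>)"

definition composable1 :: "('o, 'c, 'd) multicat \<Rightarrow> 'c \<Rightarrow> 'c list \<Rightarrow> bool" where
  "composable1 M f gs \<longleftrightarrow> f \<in> Cell1 M \<and> set gs \<subseteq> Cell1 M \<and> src M f = map (tgt M) gs"

definition composable2 :: "('o, 'c, 'd) multicat \<Rightarrow> 'd \<Rightarrow> 'd list \<Rightarrow> bool" where
  "composable2 M \<alpha> \<beta>s \<longleftrightarrow> \<alpha> \<in> Cell2 M \<and> set \<beta>s \<subseteq> Cell2 M \<and>
     src M (dom2 M \<alpha>) = map (\<lambda>\<beta>. tgt M (dom2 M \<beta>)) \<beta>s"

text \<open>\<open>top_perm \<sigma> [k\<^sub>1,\<dots>,k\<^sub>n]\<close> is \<open>\<sigma>\<langle>id,\<dots>,id\<rangle>\<close> with identities on \<open>k\<^bsub>\<sigma>(1)\<^esub>,\<dots>,k\<^bsub>\<sigma>(n)\<^esub>\<close> letters, and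
  \<open>bottom_perm [k\<^sub>1,\<dots>,k\<^sub>n] [\<tau>\<^sub>1,\<dots>,\<tau>\<^sub>n]\<close> is \<open>id\<langle>\<tau>\<^sub>1,\<dots>,\<tau>\<^sub>n\<rangle>\<close>.\<close>

definition top_perm :: "(nat \<Rightarrow> nat) \<Rightarrow> nat list \<Rightarrow> nat \<Rightarrow> nat" where
  "top_perm \<sigma> ks = block_perm \<sigma> (permute_list \<sigma> ks) (replicate (length ks) id)"

definition bottom_perm :: "nat list \<Rightarrow> (nat \<Rightarrow> nat) list \<Rightarrow> nat \<Rightarrow> nat" where
  "bottom_perm ks \<tau>s = block_perm id ks \<tau>s"

definition perms_of :: "nat list \<Rightarrow> (nat \<Rightarrow> nat) list \<Rightarrow> bool" where
  "perms_of ks \<tau>s \<longleftrightarrow> list_all2 (\<lambda>k \<tau>. \<tau> permutes {..<k}) ks \<tau>s"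

locale cat_multicategory =
  fixes M :: "('o, 'c, 'd) multicat"
  assumes cell1_typed: "f \<in> Cell1 M \<Longrightarrow> set (src M f) \<subseteq> Ob M \<and> tgt M f \<in> Ob M"
    and cell2_typed: "\<alpha> \<in> Cell2 M \<Longrightarrow> dom2 M \<alpha> \<in> Cell1 M \<and> cod2 M \<alpha> \<in> Cell1 M"
    and parallel: "\<alpha> \<in> Cell2 M \<Longrightarrow>
      src M (cod2 M \<alpha>) = src M (dom2 M \<alpha>) \<and> tgt M (cod2 M \<alpha>) = tgt M (dom2 M \<alpha>)"
    and hom_category: "category (hom_cat M as b)"
    and act_isomorphism: "\<sigma> permutes {..<length as} \<Longrightarrow>
      cat_isomorphism (hom_cat M as b) (hom_cat M (permute_list \<sigma> as) b)
        (\<lambda>f. act1 M f \<sigma>) (\<lambda>\<alpha>. act2 M \<alpha> \<sigma>)"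
    and unit_typed: "a \<in> Ob M \<Longrightarrow> unit1 M a \<in> Obj (hom_cat M [a] a)"
    and gamma_functor: "length ass = length bs \<Longrightarrow>
      cat_functor (prod_cat (hom_cat M bs c) (prod_list_cat (map2 (hom_cat M) ass bs)))
        (hom_cat M (concat ass) c)
        (\<lambda>(f, gs). gamma1 M f gs) (\<lambda>(\<alpha>, \<beta>s). gamma2 M \<alpha> \<beta>s)"
    and act1_act1: "\<lbrakk>f \<in> Cell1 M; \<sigma> permutes {..<arity1 M f}; \<tau> permutes {..<arity1 M f}\<rbrakk> \<Longrightarrow>
      act1 M (act1 M f \<sigma>) \<tau> = act1 M f (\<sigma> \<circ> \<tau>)"
    and act2_act2: "\<lbrakk>\<alpha> \<in> Cell2 M; \<sigma> permutes {..<arity2 M \<alpha>}; \<tau> permutes {..<arity2 M \<alpha>}\<rbrakk> \<Longrightarrow>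
      act2 M (act2 M \<alpha> \<sigma>) \<tau> = act2 M \<alpha> (\<sigma> \<circ> \<tau>)"
    and act1_id: "f \<in> Cell1 M \<Longrightarrow> act1 M f id = f"
    and act2_id: "\<alpha> \<in> Cell2 M \<Longrightarrow> act2 M \<alpha> id = \<alpha>"
    and gamma1_assoc: "\<lbrakk>composable1 M f gs; list_all2 (composable1 M) gs hss\<rbrakk> \<Longrightarrow>
      gamma1 M (gamma1 M f gs) (concat hss) = gamma1 M f (map2 (gamma1 M) gs hss)"
    and gamma2_assoc: "\<lbrakk>composable2 M \<alpha> \<beta>s; list_all2 (composable2 M) \<beta>s \<delta>ss\<rbrakk> \<Longrightarrow>
      gamma2 M (gamma2 M \<alpha> \<beta>s) (concat \<delta>ss) = gamma2 M \<alpha> (map2 (gamma2 M) \<beta>s \<delta>ss)"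
    and gamma1_unit_left: "f \<in> Cell1 M \<Longrightarrow> gamma1 M (unit1 M (tgt M f)) [f] = f"
    and gamma2_unit_left: "\<alpha> \<in> Cell2 M \<Longrightarrow>
      gamma2 M (ident2 M (unit1 M (tgt M (dom2 M \<alpha>)))) [\<alpha>] = \<alpha>"
    and gamma1_unit_right: "f \<in> Cell1 M \<Longrightarrow> gamma1 M f (map (unit1 M) (src M f)) = f"
    and gamma2_unit_right: "\<alpha> \<in> Cell2 M \<Longrightarrow>
      gamma2 M \<alpha> (map (\<lambda>a. ident2 M (unit1 M a)) (src M (dom2 M \<alpha>))) = \<alpha>"
    and top_equivariance1: "\<lbrakk>composable1 M f gs; \<sigma> permutes {..<arity1 M f}\<rbrakk> \<Longrightarrow>
      gamma1 M (act1 M f \<sigma>) (permute_list \<sigma> gs) =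
      act1 M (gamma1 M f gs) (top_perm \<sigma> (map (arity1 M) gs))"
    and top_equivariance2: "\<lbrakk>composable2 M \<alpha> \<beta>s; \<sigma> permutes {..<arity2 M \<alpha>}\<rbrakk> \<Longrightarrow>
      gamma2 M (act2 M \<alpha> \<sigma>) (permute_list \<sigma> \<beta>s) =
      act2 M (gamma2 M \<alpha> \<beta>s) (top_perm \<sigma> (map (arity2 M) \<beta>s))"
    and bottom_equivariance1: "\<lbrakk>composable1 M f gs; perms_of (map (arity1 M) gs) \<tau>s\<rbrakk> \<Longrightarrow>
      gamma1 M f (map2 (act1 M) gs \<tau>s) =
      act1 M (gamma1 M f gs) (bottom_perm (map (arity1 M) gs) \<tau>s)"
    and bottom_equivariance2: "\<lbrakk>composable2 M \<alpha> \<beta>s; perms_of (map (arity2 M) \<beta>s) \<tau>s\<rbrakk> \<Longrightarrow>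
      gamma2 M \<alpha> (map2 (act2 M) \<beta>s \<tau>s) =
      act2 M (gamma2 M \<alpha> \<beta>s) (bottom_perm (map (arity2 M) \<beta>s) \<tau>s)"


section \<open>Symmetric and pseudo symmetric multifunctors\<close>

record ('o, 'c, 'd, 'p, 'e, 'g) multifunctor =
  fun0 :: "'o \<Rightarrow> 'p"
  fun1 :: "'c \<Rightarrow> 'e"
  fun2 :: "'d \<Rightarrow> 'g"

text \<open>\<open>sym_iso F \<sigma> f\<close> is the 2-cell \<open>F\<^bsub>\<sigma>;f\<^esub>: F(f\<sigma>) \<rightarrow> F(f)\<sigma>\<close>.\<close>

record ('o, 'c, 'd, 'p, 'e, 'g) pseudo_multifunctor =
  "('o, 'c, 'd, 'p, 'e, 'g) multifunctor" +
  sym_iso :: "(nat \<Rightarrow> nat) \<Rightarrow> 'c \<Rightarrow> 'g"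

locale cat_multifunctor = M: cat_multicategory M + N: cat_multicategory N
  for M :: "('o, 'c, 'd) multicat" and N :: "('p, 'e, 'g) multicat" +
  fixes F :: "('o, 'c, 'd, 'p, 'e, 'g, 'z) multifunctor_scheme"
  assumes fun0_typed: "a \<in> Ob M \<Longrightarrow> fun0 F a \<in> Ob N"
    and hom_functor: "cat_functor (hom_cat M as b) (hom_cat N (map (fun0 F) as) (fun0 F b))
      (fun1 F) (fun2 F)"
    and preserves_unit: "a \<in> Ob M \<Longrightarrow> fun1 F (unit1 M a) = unit1 N (fun0 F a)"
    and preserves_gamma1: "composable1 M f gs \<Longrightarrow>
      fun1 F (gamma1 M f gs) = gamma1 N (fun1 F f) (map (fun1 F) gs)"
    and preserves_gamma2: "composable2 M \<alpha> \<beta>s \<Longrightarrow>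
      fun2 F (gamma2 M \<alpha> \<beta>s) = gamma2 N (fun2 F \<alpha>) (map (fun2 F) \<beta>s)"

locale symmetric_multifunctor = cat_multifunctor M N F
  for M :: "('o, 'c, 'd) multicat" and N :: "('p, 'e, 'g) multicat"
    and F :: "('o, 'c, 'd, 'p, 'e, 'g) multifunctor" +
  assumes preserves_act1: "\<lbrakk>f \<in> Cell1 M; \<sigma> permutes {..<arity1 M f}\<rbrakk> \<Longrightarrow>
      fun1 F (act1 M f \<sigma>) = act1 N (fun1 F f) \<sigma>"
    and preserves_act2: "\<lbrakk>\<alpha> \<in> Cell2 M; \<sigma> permutes {..<arity2 M \<alpha>}\<rbrakk> \<Longrightarrow>
      fun2 F (act2 M \<alpha> \<sigma>) = act2 N (fun2 F \<alpha>) \<sigma>"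

locale pseudo_symmetric_multifunctor = cat_multifunctor M N F
  for M :: "('o, 'c, 'd) multicat" and N :: "('p, 'e, 'g) multicat"
    and F :: "('o, 'c, 'd, 'p, 'e, 'g) pseudo_multifunctor" +
  assumes sym_natural_iso: "\<sigma> permutes {..<length as} \<Longrightarrow>
      natural_iso (hom_cat M as b) (hom_cat N (permute_list \<sigma> (map (fun0 F) as)) (fun0 F b))
        (\<lambda>f. fun1 F (act1 M f \<sigma>)) (\<lambda>\<alpha>. fun2 F (act2 M \<alpha> \<sigma>))
        (\<lambda>f. act1 N (fun1 F f) \<sigma>) (\<lambda>\<alpha>. act2 N (fun2 F \<alpha>) \<sigma>)
        (sym_iso F \<sigma>)"
    and sym_id: "f \<in> Cell1 M \<Longrightarrow> sym_iso F id f = ident2 N (fun1 F f)"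
    and sym_comp: "\<lbrakk>f \<in> Cell1 M; \<sigma> permutes {..<arity1 M f}; \<tau> permutes {..<arity1 M f}\<rbrakk> \<Longrightarrow>
      sym_iso F (\<sigma> \<circ> \<tau>) f =
      vcomp N (act2 N (sym_iso F \<sigma> f) \<tau>) (sym_iso F \<tau> (act1 M f \<sigma>))"
    and sym_top: "\<lbrakk>composable1 M f gs; \<sigma> permutes {..<arity1 M f}\<rbrakk> \<Longrightarrow>
      sym_iso F (top_perm \<sigma> (map (arity1 M) gs)) (gamma1 M f gs) =
      gamma2 N (sym_iso F \<sigma> f) (permute_list \<sigma> (map (\<lambda>g. ident2 N (fun1 F g)) gs))"
    and sym_bottom: "\<lbrakk>composable1 M f gs; perms_of (map (arity1 M) gs) \<tau>s\<rbrakk> \<Longrightarrow>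
      sym_iso F (bottom_perm (map (arity1 M) gs) \<tau>s) (gamma1 M f gs) =
      gamma2 N (ident2 N (fun1 F f)) (map2 (sym_iso F) \<tau>s gs)"

text \<open>Equality of multifunctors is agreement on the cells of the source: the values of the
  underlying HOL functions elsewhere are irrelevant.\<close>

definition multifunctor_eq :: "('o, 'c, 'd) multicat \<Rightarrow>
    ('o, 'c, 'd, 'p, 'e, 'g, 'y) multifunctor_scheme \<Rightarrow>
    ('o, 'c, 'd, 'p, 'e, 'g, 'z) multifunctor_scheme \<Rightarrow> bool" where
  "multifunctor_eq M F G \<longleftrightarrow>
    (\<forall>a\<in>Ob M. fun0 F a = fun0 G a) \<and>
    (\<forall>f\<in>Cell1 M. fun1 F f = fun1 G f) \<and>
    (\<forall>\<alpha>\<in>Cell2 M. fun2 F \<alpha> = fun2 G \<alpha>)"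

definition pseudo_multifunctor_eq :: "('o, 'c, 'd) multicat \<Rightarrow>
    ('o, 'c, 'd, 'p, 'e, 'g) pseudo_multifunctor \<Rightarrow>
    ('o, 'c, 'd, 'p, 'e, 'g) pseudo_multifunctor \<Rightarrow> bool" where
  "pseudo_multifunctor_eq M F G \<longleftrightarrow>
    multifunctor_eq M F G \<and>
    (\<forall>f\<in>Cell1 M. \<forall>\<sigma>. \<sigma> permutes {..<arity1 M f} \<longrightarrow> sym_iso F \<sigma> f = sym_iso G \<sigma> f)"

definition symmetric_as_pseudo :: "('o, 'c, 'd) multicat \<Rightarrow> ('p, 'e, 'g) multicat \<Rightarrow>
    ('o, 'c, 'd, 'p, 'e, 'g) multifunctor \<Rightarrow> ('o, 'c, 'd, 'p, 'e, 'g) pseudo_multifunctor" where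
  "symmetric_as_pseudo M N F = \<lparr>
     fun0 = fun0 F, fun1 = fun1 F, fun2 = fun2 F,
     sym_iso = (\<lambda>\<sigma> f. ident2 N (fun1 F (act1 M f \<sigma>)))\<rparr>"

text \<open>\<open>pseudo_comp P G F\<close> is the composite \<open>GF\<close>, with \<open>P\<close> the target of \<open>G\<close>.\<close>

definition pseudo_comp :: "('q, 'h, 'k) multicat \<Rightarrow>
    ('p, 'e, 'g, 'q, 'h, 'k) pseudo_multifunctor \<Rightarrow>
    ('o, 'c, 'd, 'p, 'e, 'g) pseudo_multifunctor \<Rightarrow>
    ('o, 'c, 'd, 'q, 'h, 'k) pseudo_multifunctor" where
  "pseudo_comp P G F = \<lparr>
     fun0 = fun0 G \<circ> fun0 F, fun1 = fun1 G \<circ> fun1 F, fun2 = fun2 G \<circ> fun2 F,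
     sym_iso = (\<lambda>\<sigma> f. vcomp P (sym_iso G \<sigma> (fun1 F f)) (fun2 G (sym_iso F \<sigma> f)))\<rparr>"


section \<open>The Barratt--Eccles operad and products\<close>

text \<open>
  A 1-cell of arity \<open>n\<close> is a pair \<open>(n, \<sigma>)\<close> with \<open>\<sigma>\<close> in the \<open>n\<close>-th symmetric group, and
  the only 2-cell from \<open>x\<close> to \<open>y\<close> is the pair \<open>(x, y)\<close>. The single object is \<open>()\<close>.
\<close>

type_synonym be_cell = "nat \<times> (nat \<Rightarrow> nat)"

definition be_act :: "be_cell \<Rightarrow> (nat \<Rightarrow> nat) \<Rightarrow> be_cell" where
  "be_act x \<tau> = (fst x, snd x \<circ> \<tau>)"

definition be_gamma :: "be_cell \<Rightarrow> be_cell list \<Rightarrow> be_cell" where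
  "be_gamma x ys = (sum_list (map fst ys), block_perm (snd x) (map fst ys) (map snd ys))"

definition barratt_eccles :: "(unit, be_cell, be_cell \<times> be_cell) multicat" where
  "barratt_eccles = \<lparr>
     Ob = {()},
     Cell1 = {(n, \<sigma>). \<sigma> permutes {..<n}},
     src = (\<lambda>(n, \<sigma>). replicate n ()),
     tgt = (\<lambda>_. ()),
     Cell2 = {((m, \<sigma>), (n, \<tau>)). m = n \<and> \<sigma> permutes {..<m} \<and> \<tau> permutes {..<n}},
     dom2 = fst,
     cod2 = snd,
     ident2 = (\<lambda>x. (x, x)),
     vcomp = (\<lambda>\<beta> \<alpha>. (fst \<alpha>, snd \<beta>)),
     act1 = be_act,
     act2 = (\<lambda>(x, y) \<tau>. (be_act x \<tau>, be_act y \<tau>)),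
     unit1 = (\<lambda>_. (1, id)),
     gamma1 = be_gamma,
     gamma2 = (\<lambda>(x, y) \<beta>s. (be_gamma x (map fst \<beta>s), be_gamma y (map snd \<beta>s)))\<rparr>"

text \<open>A 1-cell of the product is a pair of 1-cells of equal arity; its inputs are the
  pairs of corresponding inputs.\<close>

definition multicat_prod :: "('o, 'c, 'd) multicat \<Rightarrow> ('p, 'e, 'g) multicat \<Rightarrow>
    ('o \<times> 'p, 'c \<times> 'e, 'd \<times> 'g) multicat" where
  "multicat_prod M N = \<lparr>
     Ob = Ob M \<times> Ob N,
     Cell1 = {(f, g). f \<in> Cell1 M \<and> g \<in> Cell1 N \<and> arity1 M f = arity1 N g},
     src = (\<lambda>(f, g). zip (src M f) (src N g)),
     tgt = map_prod (tgt M) (tgt N),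
     Cell2 = {(\<alpha>, \<beta>). \<alpha> \<in> Cell2 M \<and> \<beta> \<in> Cell2 N \<and> arity2 M \<alpha> = arity2 N \<beta>},
     dom2 = map_prod (dom2 M) (dom2 N),
     cod2 = map_prod (cod2 M) (cod2 N),
     ident2 = map_prod (ident2 M) (ident2 N),
     vcomp = (\<lambda>(\<beta>, \<beta>') (\<alpha>, \<alpha>'). (vcomp M \<beta> \<alpha>, vcomp N \<beta>' \<alpha>')),
     act1 = (\<lambda>(f, g) \<sigma>. (act1 M f \<sigma>, act1 N g \<sigma>)),
     act2 = (\<lambda>(\<alpha>, \<beta>) \<sigma>. (act2 M \<alpha> \<sigma>, act2 N \<beta> \<sigma>)),
     unit1 = map_prod (unit1 M) (unit1 N),
     gamma1 = (\<lambda>(f, g) hs. (gamma1 M f (map fst hs), gamma1 N g (map snd hs))),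
     gamma2 = (\<lambda>(\<alpha>, \<beta>) \<delta>s. (gamma2 M \<alpha> (map fst \<delta>s), gamma2 N \<beta> (map snd \<delta>s)))\<rparr>"

abbreviation times_be ::
  "('o, 'c, 'd) multicat \<Rightarrow> ('o \<times> unit, 'c \<times> be_cell, 'd \<times> (be_cell \<times> be_cell)) multicat" where
  "times_be M \<equiv> multicat_prod M barratt_eccles"

text \<open>
  The multifunctor \<open>\<eta>\<^bsub>\<M>\<^esub>: \<M> \<rightarrow> \<M> \<times> E\<Sigma>\<^sub>*\<close> sends \<open>f\<close> to \<open>(f, id)\<close>; its symmetry isomorphism at
  \<open>\<sigma>\<close> and \<open>f\<close> is \<open>(1, id \<rightarrow> \<sigma>): (f\<sigma>, id) \<rightarrow> (f\<sigma>, \<sigma>)\<close>. It is named because HOL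
  cannot quantify over types inside an existential statement: only a closed definition makes
  \<open>\<eta>\<^bsub>\<M>\<^esub>\<close> independent of the types of the cells of the target \<open>\<N>\<close> in its universal property.
\<close>

definition eta :: "('o, 'c, 'd) multicat \<Rightarrow>
    ('o, 'c, 'd, 'o \<times> unit, 'c \<times> be_cell, 'd \<times> (be_cell \<times> be_cell)) pseudo_multifunctor" where
  "eta M = \<lparr>
     fun0 = (\<lambda>a. (a, ())),
     fun1 = (\<lambda>f. (f, (arity1 M f, id))),
     fun2 = (\<lambda>\<alpha>. (\<alpha>, ((arity2 M \<alpha>, id), (arity2 M \<alpha>, id)))),
     sym_iso = (\<lambda>\<sigma> f. (ident2 M (act1 M f \<sigma>), ((arity1 M f, id), (arity1 M f, \<sigma>))))\<rparr>"

end

theory Submission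
  imports Defs
begin

text \<open>
  Every 1-cell \<open>(f, \<sigma>)\<close> of \<open>\<M> \<times> E\<Sigma>\<^sub>*\<close> is \<open>\<eta>(f\<sigma>\<^sup>-\<^sup>1)\<sigma>\<close>, and every 2-cell \<open>(\<alpha>, \<sigma> \<rightarrow> \<tau>)\<close> with
  \<open>\<alpha>: f \<rightarrow> g\<close> is \<open>(\<eta>\<^bsub>\<kappa>;h\<^esub> \<circ> \<eta>(\<alpha>\<sigma>\<^sup>-\<^sup>1))\<sigma>\<close> with \<open>\<kappa> = \<tau>\<sigma>\<^sup>-\<^sup>1\<close> and \<open>h = g\<tau>\<^sup>-\<^sup>1\<close>. A symmetric
  multifunctor that restricts to \<open>F\<close> along \<open>\<eta>\<close> must therefore send \<open>(f, \<sigma>)\<close> to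
  \<open>F(f\<sigma>\<^sup>-\<^sup>1)\<sigma>\<close> and \<open>(\<alpha>, \<sigma> \<rightarrow> \<tau>)\<close> to \<open>(F\<^bsub>\<kappa>;h\<^esub> \<circ> F(\<alpha>\<sigma>\<^sup>-\<^sup>1))\<sigma>\<close>. Conversely these formulas
  are functorial by naturality of \<open>F\<^sub>\<kappa>\<close> and axiom (2). Compatibility with \<open>\<gamma>\<close> rests on
  \<open>\<sigma>\<langle>\<tau>\<^sub>1,\<dots>,\<tau>\<^sub>n\<rangle> = \<sigma>\<langle>id,\<dots>,id\<rangle> \<circ> id\<langle>\<tau>\<^sub>1,\<dots>,\<tau>\<^sub>n\<rangle>\<close>, which merges top and bottom equivariance
  into one law, and axioms (3) and (4) into a formula for \<open>F\<close> at a block permutation.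
\<close>

section \<open>Block permutations\<close>

text \<open>A multifunctor F that is only pseudo symmetric does not commute with the action, so
  \<phi>(F) can apply F only after a permutation has been moved outside. A 2-cell carries two
  permutations, \<sigma> at its domain and \<tau> at its codomain, and only one of them can be
  pulled out. The domain permutation is chosen, and the discrepancy at the codomain is absorbed by
  one symmetry isomorphism. The values on 2-cells that join distinct permutations are forced because
  \<phi>(F) has identity symmetry isomorphisms: comparing the symmetry isomorphisms of F and of the
  composite with \<eta> shows that \<phi>(F) sends each symmetry isomorphism of \<eta> to the
  corresponding one of F. A separate burden is that the product with E\<Sigma> has to be a
  multicategory, which rests on identities between block permutations. A block permutation also
  permutes the block lengths, so whatever is composed on its left must be indexed in the target
  order. This is the origin of the many lists \<open>permute_list (inv \<sigma>) xs\<close>.\<close>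

definition block_pos :: "nat list \<Rightarrow> nat \<Rightarrow> nat \<Rightarrow> nat" where
  "block_pos ks i p = sum_list (take i ks) + p"

lemma block_pos_less: "i < length ks \<Longrightarrow> p < ks ! i \<Longrightarrow> block_pos ks i p < sum_list ks"
  unfolding block_pos_def by (rule block_less_sum_list)

lemma block_pos_exhaust:
  assumes "m < sum_list ks"
  obtains i p where "i < length ks" "p < ks ! i" "m = block_pos ks i p"
  using assms
proof (induction ks arbitrary: m thesis)
  case (Cons k ks)
  show ?case
  proof (cases "m < k")
    case True
    then show ?thesis using Cons.prems(1)[of 0 m] by (simp add: block_pos_def)
  next
    case False
    then have "m - k < sum_list ks" using Cons.prems(2) by simp
    then obtain i p where "i < length ks" "p < ks ! i" "m - k = block_pos ks i p"
      using Cons.IH by blast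
    then show ?thesis using Cons.prems(1)[of "Suc i" p] False by (simp add: block_pos_def)
  qed
qed simp

lemma block_perm_pos:
  assumes "i < length ks" "p < ks ! i"
  shows "block_perm \<sigma> ks \<tau>s (block_pos ks i p) =
    block_pos (permute_list (inv \<sigma>) ks) (\<sigma> i) ((\<tau>s ! i) p)"
  using block_perm_block[OF assms] by (simp add: block_pos_def)

lemma block_perm_outside: "\<not> m < sum_list ks \<Longrightarrow> block_perm \<sigma> ks \<tau>s m = m"
  by (simp add: block_perm_def)

text \<open>Block positions exhaust the numbers below the total length and a block permutation fixes
  all others, so a function is recognised by its values at addresses (i, p).\<close>

lemma block_perm_eqI:
  assumes "\<And>i p. i < length ks \<Longrightarrow> p < ks ! i \<Longrightarrow>
      f (block_pos ks i p) = block_pos (permute_list (inv \<sigma>) ks) (\<sigma> i) ((\<tau>s ! i) p)"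
    and "\<And>m. \<not> m < sum_list ks \<Longrightarrow> f m = m"
  shows "f = block_perm \<sigma> ks \<tau>s"
proof
  fix m
  show "f m = block_perm \<sigma> ks \<tau>s m"
  proof (cases "m < sum_list ks")
    case True
    then show ?thesis by (elim block_pos_exhaust) (simp add: assms(1) block_perm_pos)
  qed (simp add: assms(2) block_perm_outside)
qed

section \<open>Permutations acting on lists\<close>

lemma sum_list_permute_list:
  fixes ks :: "nat list"
  assumes "\<sigma> permutes {..<length ks}"
  shows "sum_list (permute_list \<sigma> ks) = sum_list ks"
  using mset_permute_list[OF assms] by (metis sum_mset_sum_list)

lemma permute_list_inv_cancel:
  assumes "\<sigma> permutes {..<length xs}"
  shows "permute_list (inv \<sigma>) (permute_list \<sigma> xs) = xs"
    "permute_list \<sigma> (permute_list (inv \<sigma>) xs) = xs"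
  using permute_list_compose[OF assms, of "inv \<sigma>"]
    permute_list_compose[OF permutes_inv[OF assms], of \<sigma>]
  by (simp_all add: permutes_inv_o[OF assms])

text \<open>Acting by \<open>inv \<sigma>\<close> carries the i-th entry to position
  \<open>\<sigma> i\<close>. This is why the block lengths on the target side of
  \<open>block_perm\<close> are \<open>permute_list (inv \<sigma>) ks\<close>.\<close>

lemma permute_list_inv_nth:
  assumes "\<sigma> permutes {..<length xs}" "i < length xs"
  shows "permute_list (inv \<sigma>) xs ! \<sigma> i = xs ! i" 
proof -
  have "\<sigma> i < length xs"
    using assms permutes_in_image[OF assms(1), of i] by simp
  then show ?thesis
    using assms permutes_inverses(2)[OF assms(1)]
    by (simp add: permute_list_nth permutes_inv)
qed

lemma permute_list_map2:
  assumes "\<sigma> permutes {..<length xs}" "length xs = length ys"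
  shows "permute_list \<sigma> (map2 f xs ys) = map2 f (permute_list \<sigma> xs) (permute_list \<sigma> ys)"
  using assms by (simp add: permute_list_map permute_list_zip)

lemma map_permute_list_map2:
  assumes "\<sigma> permutes {..<length xs}" "length ys = length xs"
    and "\<And>i. i < length xs \<Longrightarrow> f (g (xs ! i) (ys ! i)) = h (xs ! i)"
  shows "map f (permute_list \<sigma> (map2 g xs ys)) = permute_list \<sigma> (map h xs)"
proof -
  have "map f (map2 g xs ys) = map h xs"
    using assms(2,3) by (auto intro!: nth_equalityI)
  then show ?thesis
    using assms(1,2) by (simp add: permute_list_map[symmetric])
qed

lemma permutes_cancel:
  assumes "\<sigma> permutes S"
  shows "\<tau> \<circ> inv \<sigma> \<circ> \<sigma> = \<tau>" "\<tau> \<circ> \<sigma> \<circ> inv \<sigma> = \<tau>"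
    "inv \<sigma> \<circ> (\<sigma> \<circ> \<tau>) = \<tau>" "\<sigma> \<circ> (inv \<sigma> \<circ> \<tau>) = \<tau>"
  using permutes_inv_o[OF assms] by (simp_all add: comp_assoc) (simp_all add: comp_assoc[symmetric])

lemma permutes_nat_less: "\<sigma> permutes {..<n} \<Longrightarrow> \<sigma> i < n \<longleftrightarrow> i < (n :: nat)"
  using permutes_in_image[of \<sigma> "{..<n}" i] by simp

lemma perms_of_length: "perms_of ks \<tau>s \<Longrightarrow> length \<tau>s = length ks"
  by (simp add: perms_of_def list_all2_lengthD)

lemma perms_of_nth: "perms_of ks \<tau>s \<Longrightarrow> i < length ks \<Longrightarrow> (\<tau>s ! i) permutes {..<ks ! i}"
  by (simp add: perms_of_def list_all2_conv_all_nth)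

lemma perms_of_less: "perms_of ks \<tau>s \<Longrightarrow> i < length ks \<Longrightarrow> (\<tau>s ! i) p < ks ! i \<longleftrightarrow> p < ks ! i"
  by (simp add: permutes_nat_less[OF perms_of_nth])

lemma perms_of_replicate_id [simp]: "perms_of ks (replicate (length ks) id)"
  by (simp add: perms_of_def list_all2_conv_all_nth permutes_id)

lemma perms_of_inv: "perms_of ks \<tau>s \<Longrightarrow> perms_of ks (map inv \<tau>s)"
  by (simp add: perms_of_def list_all2_conv_all_nth permutes_inv)

lemma perms_of_comp:
  "perms_of ks \<rho>s \<Longrightarrow> perms_of ks \<tau>s \<Longrightarrow> perms_of ks (map2 (\<circ>) \<rho>s \<tau>s)"
  by (auto simp: perms_of_def list_all2_conv_all_nth intro!: permutes_compose)

lemma perms_of_permute: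
  "perms_of ks \<tau>s \<Longrightarrow> \<sigma> permutes {..<length ks} \<Longrightarrow>
    perms_of (permute_list \<sigma> ks) (permute_list \<sigma> \<tau>s)"
  by (auto simp: perms_of_def list_all2_conv_all_nth permute_list_nth permutes_nat_less)

section \<open>Composition and inverses of block permutations\<close>

lemma block_perm_id: "block_perm id ks (replicate (length ks) id) = id"
  by (rule block_perm_eqI[symmetric]) simp_all

text \<open>The left factor meets block i at its new place \<open>\<sigma> i\<close>, so its lengths
  and inner permutations are listed in target order. Inverses, the factorization into top and bottom
  parts, both equivariance laws of the Barratt--Eccles operad and the codomain correction in
  \<open>twist_gamma\<close> are all instances.\<close>

lemma block_perm_comp:
  assumes \<rho>: "\<rho> permutes {..<length ks}" and \<sigma>: "\<sigma> permutes {..<length ks}"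
    and \<rho>s: "length \<rho>s = length ks" and \<tau>s: "perms_of ks \<tau>s"
  shows "block_perm \<rho> (permute_list (inv \<sigma>) ks) (permute_list (inv \<sigma>) \<rho>s) \<circ> block_perm \<sigma> ks \<tau>s
    = block_perm (\<rho> \<circ> \<sigma>) ks (map2 (\<circ>) \<rho>s \<tau>s)"
proof (rule block_perm_eqI)
  fix i p assume i: "i < length ks" and p: "p < ks ! i"
  have "\<sigma> i < length ks" using i by (simp add: permutes_nat_less[OF \<sigma>])
  \<comment> \<open>Target lengths of the composite: \<open>inv (\<rho> \<circ> \<sigma>)\<close> is
    \<open>inv \<sigma> \<circ> inv \<rho>\<close>, and the right action applies
    \<open>inv \<sigma>\<close> first.\<close>
  moreover have "permute_list (inv (\<rho> \<circ> \<sigma>)) ks = permute_list (inv \<rho>) (permute_list (inv \<sigma>) ks)"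
    using permute_list_compose[OF permutes_inv[OF \<rho>]] \<rho> \<sigma>
    by (simp add: o_inv_distrib permutes_bij)
  moreover have "permute_list (inv \<sigma>) \<rho>s ! \<sigma> i = \<rho>s ! i"
    using permute_list_inv_nth[of \<sigma> \<rho>s i] \<sigma> \<rho>s i by simp
  ultimately show "(block_perm \<rho> (permute_list (inv \<sigma>) ks) (permute_list (inv \<sigma>) \<rho>s) \<circ>
      block_perm \<sigma> ks \<tau>s) (block_pos ks i p) =
    block_pos (permute_list (inv (\<rho> \<circ> \<sigma>)) ks) ((\<rho> \<circ> \<sigma>) i) ((map2 (\<circ>) \<rho>s \<tau>s ! i) p)"
    using i p perms_of_less[OF \<tau>s] perms_of_length[OF \<tau>s] \<rho>s
    by (simp add: block_perm_pos permute_list_inv_nth[OF \<sigma>])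
qed (simp add: block_perm_outside sum_list_permute_list permutes_inv[OF \<sigma>])

lemma map2_comp_inv:
  assumes "perms_of ks \<tau>s"
  shows "map2 (\<circ>) (map inv \<tau>s) \<tau>s = replicate (length ks) id"
    "map2 (\<circ>) \<tau>s (map inv \<tau>s) = replicate (length ks) id"
  using assms
  by (auto simp: perms_of_def list_all2_conv_all_nth permutes_inv_o intro!: nth_equalityI)

text \<open>The two-sided inverse is again a block permutation: \<open>inv \<sigma>\<close> with the
  inverse inner permutations in target order. Outside the blocks nothing moves.\<close>

lemma block_perm_permutes:
  assumes \<sigma>: "\<sigma> permutes {..<length ks}" and \<tau>s: "perms_of ks \<tau>s"
  shows "block_perm \<sigma> ks \<tau>s permutes {..<sum_list ks}"
proof -
  let ?ks = "permute_list (inv \<sigma>) ks" and ?\<tau>s = "permute_list (inv \<sigma>) (map inv \<tau>s)"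
  let ?B = "block_perm \<sigma> ks \<tau>s" and ?B' = "block_perm (inv \<sigma>) ?ks ?\<tau>s"
  have len: "length \<tau>s = length ks" using \<tau>s by (rule perms_of_length)
  have "?B' \<circ> ?B = block_perm (inv \<sigma> \<circ> \<sigma>) ks (map2 (\<circ>) (map inv \<tau>s) \<tau>s)"
    using len by (intro block_perm_comp permutes_inv \<sigma> \<tau>s) simp_all
  then have "?B' \<circ> ?B = id"
    by (simp only: permutes_inv_o[OF \<sigma>] map2_comp_inv[OF \<tau>s] block_perm_id)
  moreover have "?B \<circ> ?B' = id"
  proof -
    \<comment> \<open>Source and target exchange roles here, so \<open>block_perm_comp\<close>
      presents lists moved by \<open>inv \<sigma>\<close> and then by
      \<open>inv (inv \<sigma>)\<close>; they return to \<open>ks\<close> and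
      \<open>\<tau>s\<close>.\<close>
    have "block_perm \<sigma> (permute_list (inv (inv \<sigma>)) ?ks)
        (permute_list (inv (inv \<sigma>)) (permute_list (inv \<sigma>) \<tau>s)) \<circ> ?B' =
      block_perm (\<sigma> \<circ> inv \<sigma>) ?ks (map2 (\<circ>) (permute_list (inv \<sigma>) \<tau>s) ?\<tau>s)"
      using \<sigma> len
      by (intro block_perm_comp) (simp_all add: permutes_inv perms_of_permute perms_of_inv \<tau>s)
    moreover have "permute_list (inv (inv \<sigma>)) ?ks = ks"
      "permute_list (inv (inv \<sigma>)) (permute_list (inv \<sigma>) \<tau>s) = \<tau>s"
      using \<sigma> len by (simp_all add: inv_inv_eq permutes_bij permute_list_inv_cancel)
    moreover have "map2 (\<circ>) (permute_list (inv \<sigma>) \<tau>s) ?\<tau>s = replicate (length ?ks) id"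
      using map2_comp_inv(2)[OF perms_of_permute[OF \<tau>s permutes_inv[OF \<sigma>]]] \<sigma> len
      by (simp add: permute_list_map permutes_inv)
    ultimately show ?thesis by (simp only: permutes_inv_o[OF \<sigma>] block_perm_id)
  qed
  ultimately have "bij ?B" by (rule o_bij)
  then show ?thesis
    unfolding permutes_def bij_iff by (auto intro: block_perm_outside)
qed

text \<open>\<open>top_perm\<close> permutes its length argument by \<sigma> itself. Fed with the
  lengths in target order, it therefore acts on blocks of lengths \<open>ks\<close>, which are the
  blocks that \<open>bottom_perm ks \<tau>s\<close> leaves in place.\<close>

lemma top_perm_comp_bottom_perm:
  assumes \<sigma>: "\<sigma> permutes {..<length ks}" and \<tau>s: "perms_of ks \<tau>s"
  shows "top_perm \<sigma> (permute_list (inv \<sigma>) ks) \<circ> bottom_perm ks \<tau>s = block_perm \<sigma> ks \<tau>s"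
proof -
  have "top_perm \<sigma> (permute_list (inv \<sigma>) ks) = block_perm \<sigma> ks (replicate (length ks) id)"
    using \<sigma> by (simp add: top_perm_def permute_list_inv_cancel)
  moreover have "map2 (\<circ>) (replicate (length ks) id) \<tau>s = \<tau>s"
    using perms_of_length[OF \<tau>s] by (auto intro: nth_equalityI)
  ultimately show ?thesis
    using block_perm_comp[OF \<sigma> permutes_id _ \<tau>s, of "replicate (length ks) id"]
    by (simp add: bottom_perm_def)
qed

lemma top_perm_permutes:
  assumes "\<sigma> permutes {..<length ks}"
  shows "top_perm \<sigma> ks permutes {..<sum_list ks}"
  using block_perm_permutes[of \<sigma> "permute_list \<sigma> ks" "replicate (length ks) id"] assms
    perms_of_replicate_id[of "permute_list \<sigma> ks"]
  by (simp add: top_perm_def sum_list_permute_list)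

lemma bottom_perm_permutes: "perms_of ks \<tau>s \<Longrightarrow> bottom_perm ks \<tau>s permutes {..<sum_list ks}"
  by (simp add: bottom_perm_def block_perm_permutes permutes_id)

section \<open>Nested block permutations\<close>

lemma nth_concat_block_pos:
  "i < length xss \<Longrightarrow> j < length (xss ! i) \<Longrightarrow>
    concat xss ! block_pos (map length xss) i j = xss ! i ! j"
proof (induction xss arbitrary: i)
  case (Cons xs xss)
  then show ?case by (cases i) (simp_all add: block_pos_def nth_append)
qed simp

lemma block_pos_concat:
  "i < length lss \<Longrightarrow> j < length (lss ! i) \<Longrightarrow>
    block_pos (concat lss) (block_pos (map length lss) i j) p =
    block_pos (map sum_list lss) i (block_pos (lss ! i) j p)"
proof (induction lss arbitrary: i)
  case (Cons ls lss)
  then show ?case by (cases i) (simp_all add: block_pos_def)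
qed simp

text \<open>Applied to lists of sub-block lengths, this computes the target lengths of the outer
  permutation in a nested one. The proof applies the block permutation to the claimed result and
  cancels at the end, because \<open>block_perm\<close> is known at source addresses while its
  inverse is not.\<close>

lemma concat_block_perm:
  assumes \<sigma>: "\<sigma> permutes {..<length xss}" and \<tau>s: "perms_of (map length xss) \<tau>s"
  shows "permute_list (inv (block_perm \<sigma> (map length xss) \<tau>s)) (concat xss) =
    concat (permute_list (inv \<sigma>) (map2 (\<lambda>xs \<tau>. permute_list (inv \<tau>) xs) xss \<tau>s))"
    (is "permute_list (inv ?B) _ = concat ?yss")
proof -
  let ?zss = "map2 (\<lambda>xs \<tau>. permute_list (inv \<tau>) xs) xss \<tau>s"
  have len: "length \<tau>s = length xss" using perms_of_length[OF \<tau>s] by simp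
  then have yss: "map length ?yss = permute_list (inv \<sigma>) (map length xss)"
    using len \<sigma> by (intro map_permute_list_map2) (auto simp: permutes_inv)
  have B: "?B permutes {..<length (concat xss)}"
    using block_perm_permutes[of \<sigma> "map length xss" \<tau>s] \<sigma> \<tau>s by (simp add: length_concat)
  have sum: "length (concat ?yss) = length (concat xss)"
    unfolding length_concat yss using \<sigma> by (subst sum_list_permute_list) (auto intro: permutes_inv)
  have "permute_list ?B (concat ?yss) = concat xss"
  proof (rule nth_equalityI)
    fix m assume "m < length (permute_list ?B (concat ?yss))"
    then have m: "m < sum_list (map length xss)" by (simp add: sum[unfolded length_concat] length_concat)
    then obtain i j where ij: "i < length xss" "j < length (xss ! i)"
      "m = block_pos (map length xss) i j"
      by (elim block_pos_exhaust) auto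
    have \<tau>: "(\<tau>s ! i) permutes {..<length (xss ! i)}" using perms_of_nth[OF \<tau>s, of i] ij by simp
    have "\<sigma> i < length xss" using ij by (simp add: permutes_nat_less[OF \<sigma>])
    moreover have "?yss ! \<sigma> i = permute_list (inv (\<tau>s ! i)) (xss ! i)"
      using permute_list_inv_nth[of \<sigma> ?zss i] \<sigma> ij len by simp
    moreover have "(\<tau>s ! i) j < length (xss ! i)" using ij by (simp add: permutes_nat_less[OF \<tau>])
    ultimately have "concat ?yss ! ?B m = xss ! i ! j"
      using ij \<tau> len
      by (simp add: block_perm_pos yss[symmetric] nth_concat_block_pos permute_list_inv_nth)
    then show "permute_list ?B (concat ?yss) ! m = concat xss ! m"
      using m B ij
      by (simp add: permute_list_nth sum length_concat nth_concat_block_pos sum[unfolded length_concat])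
  qed (simp add: sum)
  then show ?thesis using permute_list_inv_cancel(1)[of ?B "concat ?yss"] B sum by simp
qed

lemma sum_list_concat: "sum_list (concat lss) = sum_list (map sum_list lss)"
  by (induction lss) simp_all

text \<open>A point is addressed by an outer block i, a sub-block j and an offset p. The left side
  works with the flat list of sub-blocks, the right side with the nested one.
  \<open>block_pos_concat\<close> translates between them at the source and again at the target,
  where \<open>concat_block_perm\<close> supplies the rearranged lengths.\<close>

lemma block_perm_assoc:
  assumes \<sigma>: "\<sigma> permutes {..<length lss}" and \<tau>s: "perms_of (map length lss) \<tau>s"
    and \<rho>ss: "list_all2 perms_of lss \<rho>ss"
  shows "block_perm (block_perm \<sigma> (map length lss) \<tau>s) (concat lss) (concat \<rho>ss) =
    block_perm \<sigma> (map sum_list lss) (map2 (\<lambda>\<tau> (ls, \<rho>s). block_perm \<tau> ls \<rho>s) \<tau>s (zip lss \<rho>ss))"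
    (is "?L = _")
proof (rule block_perm_eqI)
  let ?B = "block_perm \<sigma> (map length lss) \<tau>s"
  let ?zss = "map2 (\<lambda>ls \<tau>. permute_list (inv \<tau>) ls) lss \<tau>s"
  let ?lss = "permute_list (inv \<sigma>) ?zss"
  have len: "length \<tau>s = length lss" "length \<rho>ss = length lss"
    using perms_of_length[OF \<tau>s] \<rho>ss by (auto dest: list_all2_lengthD)
  have \<rho>s: "perms_of (lss ! i) (\<rho>ss ! i)" if "i < length lss" for i
    using \<rho>ss that by (simp add: list_all2_nthD)
  have lengths: "map length ?lss = permute_list (inv \<sigma>) (map length lss)"
    using len \<sigma> by (intro map_permute_list_map2) (auto simp: permutes_inv)
  have "sum_list (permute_list (inv (\<tau>s ! i)) (lss ! i)) = sum_list (lss ! i)" if "i < length lss" for i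
    using perms_of_nth[OF \<tau>s, of i] that by (intro sum_list_permute_list) (simp add: permutes_inv)
  then have sums: "map sum_list ?lss = permute_list (inv \<sigma>) (map sum_list lss)"
    using len \<sigma> by (intro map_permute_list_map2) (auto simp: permutes_inv)
  have \<rho>lengths: "map length \<rho>ss = map length lss"
    using len perms_of_length[OF \<rho>s] by (auto intro: nth_equalityI)
  fix i q assume i: "i < length (map sum_list lss)" and "q < map sum_list lss ! i"
  then have "q < sum_list (lss ! i)" by simp
  then obtain j p where jp: "j < length (lss ! i)" "p < lss ! i ! j" "q = block_pos (lss ! i) j p"
    by (elim block_pos_exhaust)
  \<comment> \<open>The number of the j-th sub-block of block i within the flat list of all
    sub-blocks.\<close>
  let ?n = "block_pos (map length lss) i j"
  have n: "?n < length (concat lss)"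
    using i jp block_pos_less[of i "map length lss" j] by (simp add: length_concat)
  have \<tau>: "(\<tau>s ! i) permutes {..<length (lss ! i)}" using perms_of_nth[OF \<tau>s, of i] i by simp
  have \<sigma>i: "\<sigma> i < length lss" using i by (simp add: permutes_nat_less[OF \<sigma>])
  have lss_nth: "?lss ! \<sigma> i = permute_list (inv (\<tau>s ! i)) (lss ! i)"
    using permute_list_inv_nth[of \<sigma> ?zss i] \<sigma> i len by simp
  have \<tau>j: "(\<tau>s ! i) j < length (lss ! i)" using jp by (simp add: permutes_nat_less[OF \<tau>])
  have "?L (block_pos (map sum_list lss) i q) = ?L (block_pos (concat lss) ?n p)"
    using i jp by (simp add: block_pos_concat)
  also have "\<dots> = block_pos (permute_list (inv ?B) (concat lss)) (?B ?n) ((concat \<rho>ss ! ?n) p)"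
    using n i jp by (intro block_perm_pos) (simp_all add: nth_concat_block_pos)
  also have "concat \<rho>ss ! ?n = \<rho>ss ! i ! j"
    unfolding \<rho>lengths[symmetric] using i jp len perms_of_length[OF \<rho>s, of i]
    by (intro nth_concat_block_pos) auto
  also have "permute_list (inv ?B) (concat lss) = concat ?lss"
    by (rule concat_block_perm[OF \<sigma> \<tau>s])
  also have "?B ?n = block_pos (map length ?lss) (\<sigma> i) ((\<tau>s ! i) j)"
    using i jp by (simp add: block_perm_pos lengths)
  also have "block_pos (concat ?lss) \<dots> ((\<rho>ss ! i ! j) p) =
      block_pos (map sum_list ?lss) (\<sigma> i) (block_pos (?lss ! \<sigma> i) ((\<tau>s ! i) j) ((\<rho>ss ! i ! j) p))"
    using \<sigma>i \<tau>j len by (intro block_pos_concat) (auto simp: lss_nth)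
  also have "block_pos (?lss ! \<sigma> i) ((\<tau>s ! i) j) ((\<rho>ss ! i ! j) p) =
      block_perm (\<tau>s ! i) (lss ! i) (\<rho>ss ! i) q"
    using jp by (simp add: lss_nth block_perm_pos)
  finally show "?L (block_pos (map sum_list lss) i q) =
      block_pos (permute_list (inv \<sigma>) (map sum_list lss)) (\<sigma> i)
        ((map2 (\<lambda>\<tau> (ls, \<rho>s). block_perm \<tau> ls \<rho>s) \<tau>s (zip lss \<rho>ss) ! i) q)"
    using i len by (simp add: sums)
qed (simp add: block_perm_outside sum_list_concat)

section \<open>Multicategory axioms on cells\<close>

lemma hom_cat_simps [simp]:
  "x \<in> Obj (hom_cat M as b) \<longleftrightarrow> x \<in> Cell1 M \<and> src M x = as \<and> tgt M x = b"
  "y \<in> Arr (hom_cat M as b) \<longleftrightarrow> y \<in> Cell2 M \<and> src M (dom2 M y) = as \<and> tgt M (dom2 M y) = b"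
  "Dom (hom_cat M as b) = dom2 M" "Cod (hom_cat M as b) = cod2 M"
  "Ident (hom_cat M as b) = ident2 M" "Comp (hom_cat M as b) = vcomp M"
  by (simp_all add: hom_cat_def)

lemma prod_cat_simps [simp]:
  "Obj (prod_cat C D) = Obj C \<times> Obj D" "Arr (prod_cat C D) = Arr C \<times> Arr D"
  "Dom (prod_cat C D) = map_prod (Dom C) (Dom D)" "Cod (prod_cat C D) = map_prod (Cod C) (Cod D)"
  "Ident (prod_cat C D) = map_prod (Ident C) (Ident D)"
  "Comp (prod_cat C D) (g, g') (f, f') = (Comp C g f, Comp D g' f')"
  by (simp_all add: prod_cat_def)

lemma prod_list_hom_cat_simps:
  assumes "length as = length bs"
  shows "gs \<in> Obj (prod_list_cat (map2 (hom_cat M) as bs)) \<longleftrightarrow>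
      set gs \<subseteq> Cell1 M \<and> map (src M) gs = as \<and> map (tgt M) gs = bs"
    and "\<beta>s \<in> Arr (prod_list_cat (map2 (hom_cat M) as bs)) \<longleftrightarrow>
      set \<beta>s \<subseteq> Cell2 M \<and> map (\<lambda>\<beta>. src M (dom2 M \<beta>)) \<beta>s = as \<and> map (\<lambda>\<beta>. tgt M (dom2 M \<beta>)) \<beta>s = bs"
    and "length \<beta>s = length bs \<Longrightarrow>
      Dom (prod_list_cat (map2 (hom_cat M) as bs)) \<beta>s = map (dom2 M) \<beta>s"
    and "length \<beta>s = length bs \<Longrightarrow>
      Cod (prod_list_cat (map2 (hom_cat M) as bs)) \<beta>s = map (cod2 M) \<beta>s"
    and "length gs = length bs \<Longrightarrow>
      Ident (prod_list_cat (map2 (hom_cat M) as bs)) gs = map (ident2 M) gs"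
    and "\<lbrakk>length \<delta>s = length bs; length \<beta>s = length bs\<rbrakk> \<Longrightarrow>
      Comp (prod_list_cat (map2 (hom_cat M) as bs)) \<delta>s \<beta>s = map2 (vcomp M) \<delta>s \<beta>s"
  using assms
  by (auto simp: prod_list_cat_def list_all2_conv_all_nth list_eq_iff_nth_eq set_conv_nth; blast)+

text \<open>Axioms phrased through hom categories and their products become conditions on cells and
  lists of cells, a form that can be checked componentwise. Invertibility of the action is derived:
  by the two action laws, acting by \<open>inv \<sigma>\<close> undoes acting by \<sigma>.\<close>

lemma cat_multicategoryI:
  fixes M :: "('o, 'c, 'd) multicat"
  assumes cell1_typed: "\<And>f. f \<in> Cell1 M \<Longrightarrow> set (src M f) \<subseteq> Ob M \<and> tgt M f \<in> Ob M"
    and cell2_typed: "\<And>\<alpha>. \<alpha> \<in> Cell2 M \<Longrightarrow> dom2 M \<alpha> \<in> Cell1 M \<and> cod2 M \<alpha> \<in> Cell1 M"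
    and parallel: "\<And>\<alpha>. \<alpha> \<in> Cell2 M \<Longrightarrow>
      src M (cod2 M \<alpha>) = src M (dom2 M \<alpha>) \<and> tgt M (cod2 M \<alpha>) = tgt M (dom2 M \<alpha>)"
    and ident: "\<And>f. f \<in> Cell1 M \<Longrightarrow>
      ident2 M f \<in> Cell2 M \<and> dom2 M (ident2 M f) = f \<and> cod2 M (ident2 M f) = f"
    and vcomp: "\<And>\<alpha> \<beta>. \<lbrakk>\<alpha> \<in> Cell2 M; \<beta> \<in> Cell2 M; dom2 M \<beta> = cod2 M \<alpha>\<rbrakk> \<Longrightarrow>
      vcomp M \<beta> \<alpha> \<in> Cell2 M \<and> dom2 M (vcomp M \<beta> \<alpha>) = dom2 M \<alpha> \<and> cod2 M (vcomp M \<beta> \<alpha>) = cod2 M \<beta>"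
    and vcomp_ident: "\<And>\<alpha>. \<alpha> \<in> Cell2 M \<Longrightarrow>
      vcomp M (ident2 M (cod2 M \<alpha>)) \<alpha> = \<alpha> \<and> vcomp M \<alpha> (ident2 M (dom2 M \<alpha>)) = \<alpha>"
    and vcomp_assoc: "\<And>\<alpha> \<beta> \<delta>. \<lbrakk>\<alpha> \<in> Cell2 M; \<beta> \<in> Cell2 M; \<delta> \<in> Cell2 M;
        dom2 M \<beta> = cod2 M \<alpha>; dom2 M \<delta> = cod2 M \<beta>\<rbrakk> \<Longrightarrow>
      vcomp M (vcomp M \<delta> \<beta>) \<alpha> = vcomp M \<delta> (vcomp M \<beta> \<alpha>)"
    and act1: "\<And>f \<sigma>. \<lbrakk>f \<in> Cell1 M; \<sigma> permutes {..<arity1 M f}\<rbrakk> \<Longrightarrow>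
      act1 M f \<sigma> \<in> Cell1 M \<and> src M (act1 M f \<sigma>) = permute_list \<sigma> (src M f) \<and> tgt M (act1 M f \<sigma>) = tgt M f"
    and act2: "\<And>\<alpha> \<sigma>. \<lbrakk>\<alpha> \<in> Cell2 M; \<sigma> permutes {..<arity2 M \<alpha>}\<rbrakk> \<Longrightarrow>
      act2 M \<alpha> \<sigma> \<in> Cell2 M \<and> dom2 M (act2 M \<alpha> \<sigma>) = act1 M (dom2 M \<alpha>) \<sigma> \<and>
      cod2 M (act2 M \<alpha> \<sigma>) = act1 M (cod2 M \<alpha>) \<sigma>"
    and act2_ident: "\<And>f \<sigma>. \<lbrakk>f \<in> Cell1 M; \<sigma> permutes {..<arity1 M f}\<rbrakk> \<Longrightarrow>
      act2 M (ident2 M f) \<sigma> = ident2 M (act1 M f \<sigma>)"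
    and act2_vcomp: "\<And>\<alpha> \<beta> \<sigma>. \<lbrakk>\<alpha> \<in> Cell2 M; \<beta> \<in> Cell2 M; dom2 M \<beta> = cod2 M \<alpha>;
        \<sigma> permutes {..<arity2 M \<alpha>}\<rbrakk> \<Longrightarrow>
      act2 M (vcomp M \<beta> \<alpha>) \<sigma> = vcomp M (act2 M \<beta> \<sigma>) (act2 M \<alpha> \<sigma>)"
    and unit: "\<And>a. a \<in> Ob M \<Longrightarrow>
      unit1 M a \<in> Cell1 M \<and> src M (unit1 M a) = [a] \<and> tgt M (unit1 M a) = a"
    and gamma1: "\<And>f gs. composable1 M f gs \<Longrightarrow>
      gamma1 M f gs \<in> Cell1 M \<and> src M (gamma1 M f gs) = concat (map (src M) gs) \<and>
      tgt M (gamma1 M f gs) = tgt M f"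
    and gamma2: "\<And>\<alpha> \<beta>s. composable2 M \<alpha> \<beta>s \<Longrightarrow>
      gamma2 M \<alpha> \<beta>s \<in> Cell2 M \<and> dom2 M (gamma2 M \<alpha> \<beta>s) = gamma1 M (dom2 M \<alpha>) (map (dom2 M) \<beta>s) \<and>
      cod2 M (gamma2 M \<alpha> \<beta>s) = gamma1 M (cod2 M \<alpha>) (map (cod2 M) \<beta>s)"
    and gamma2_ident: "\<And>f gs. composable1 M f gs \<Longrightarrow>
      gamma2 M (ident2 M f) (map (ident2 M) gs) = ident2 M (gamma1 M f gs)"
    and gamma2_vcomp: "\<And>\<alpha> \<beta>s \<alpha>' \<beta>s'. \<lbrakk>composable2 M \<alpha> \<beta>s; composable2 M \<alpha>' \<beta>s';
        dom2 M \<alpha>' = cod2 M \<alpha>; map (dom2 M) \<beta>s' = map (cod2 M) \<beta>s\<rbrakk> \<Longrightarrow>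
      gamma2 M (vcomp M \<alpha>' \<alpha>) (map2 (vcomp M) \<beta>s' \<beta>s) = vcomp M (gamma2 M \<alpha>' \<beta>s') (gamma2 M \<alpha> \<beta>s)"
    and act1_act1: "\<And>f \<sigma> \<tau>. \<lbrakk>f \<in> Cell1 M; \<sigma> permutes {..<arity1 M f}; \<tau> permutes {..<arity1 M f}\<rbrakk> \<Longrightarrow>
      act1 M (act1 M f \<sigma>) \<tau> = act1 M f (\<sigma> \<circ> \<tau>)"
    and act2_act2: "\<And>\<alpha> \<sigma> \<tau>. \<lbrakk>\<alpha> \<in> Cell2 M; \<sigma> permutes {..<arity2 M \<alpha>}; \<tau> permutes {..<arity2 M \<alpha>}\<rbrakk> \<Longrightarrow>
      act2 M (act2 M \<alpha> \<sigma>) \<tau> = act2 M \<alpha> (\<sigma> \<circ> \<tau>)"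
    and act1_id: "\<And>f. f \<in> Cell1 M \<Longrightarrow> act1 M f id = f"
    and act2_id: "\<And>\<alpha>. \<alpha> \<in> Cell2 M \<Longrightarrow> act2 M \<alpha> id = \<alpha>"
    and rest: "\<And>f gs hss. \<lbrakk>composable1 M f gs; list_all2 (composable1 M) gs hss\<rbrakk> \<Longrightarrow>
      gamma1 M (gamma1 M f gs) (concat hss) = gamma1 M f (map2 (gamma1 M) gs hss)"
     "\<And>\<alpha> \<beta>s \<delta>ss. \<lbrakk>composable2 M \<alpha> \<beta>s; list_all2 (composable2 M) \<beta>s \<delta>ss\<rbrakk> \<Longrightarrow>
      gamma2 M (gamma2 M \<alpha> \<beta>s) (concat \<delta>ss) = gamma2 M \<alpha> (map2 (gamma2 M) \<beta>s \<delta>ss)"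
     "\<And>f. f \<in> Cell1 M \<Longrightarrow> gamma1 M (unit1 M (tgt M f)) [f] = f"
     "\<And>\<alpha>. \<alpha> \<in> Cell2 M \<Longrightarrow>
      gamma2 M (ident2 M (unit1 M (tgt M (dom2 M \<alpha>)))) [\<alpha>] = \<alpha>"
     "\<And>f. f \<in> Cell1 M \<Longrightarrow> gamma1 M f (map (unit1 M) (src M f)) = f"
     "\<And>\<alpha>. \<alpha> \<in> Cell2 M \<Longrightarrow>
      gamma2 M \<alpha> (map (\<lambda>a. ident2 M (unit1 M a)) (src M (dom2 M \<alpha>))) = \<alpha>"
     "\<And>f gs \<sigma>. \<lbrakk>composable1 M f gs; \<sigma> permutes {..<arity1 M f}\<rbrakk> \<Longrightarrow>
      gamma1 M (act1 M f \<sigma>) (permute_list \<sigma> gs) =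
      act1 M (gamma1 M f gs) (top_perm \<sigma> (map (arity1 M) gs))"
     "\<And>\<alpha> \<beta>s \<sigma>. \<lbrakk>composable2 M \<alpha> \<beta>s; \<sigma> permutes {..<arity2 M \<alpha>}\<rbrakk> \<Longrightarrow>
      gamma2 M (act2 M \<alpha> \<sigma>) (permute_list \<sigma> \<beta>s) =
      act2 M (gamma2 M \<alpha> \<beta>s) (top_perm \<sigma> (map (arity2 M) \<beta>s))"
     "\<And>f gs \<tau>s. \<lbrakk>composable1 M f gs; perms_of (map (arity1 M) gs) \<tau>s\<rbrakk> \<Longrightarrow>
      gamma1 M f (map2 (act1 M) gs \<tau>s) =
      act1 M (gamma1 M f gs) (bottom_perm (map (arity1 M) gs) \<tau>s)"
     "\<And>\<alpha> \<beta>s \<tau>s. \<lbrakk>composable2 M \<alpha> \<beta>s; perms_of (map (arity2 M) \<beta>s) \<tau>s\<rbrakk> \<Longrightarrow>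
      gamma2 M \<alpha> (map2 (act2 M) \<beta>s \<tau>s) =
      act2 M (gamma2 M \<alpha> \<beta>s) (bottom_perm (map (arity2 M) \<beta>s) \<tau>s)"
  shows "cat_multicategory M"
proof (unfold_locales, goal_cases)
  case (4 as b)
  show ?case
    using cell2_typed parallel
    by (auto simp: category_def ident vcomp vcomp_ident vcomp_assoc)
next
  case (5 \<sigma> as b)
  let ?C = "hom_cat M as b" and ?D = "hom_cat M (permute_list \<sigma> as) b"
  have \<sigma>': "inv \<sigma> permutes {..<length as}" using 5 by (rule permutes_inv)
  have "cat_functor ?C ?D (\<lambda>f. act1 M f \<sigma>) (\<lambda>\<alpha>. act2 M \<alpha> \<sigma>)"
    using 5 cell2_typed by (auto simp: cat_functor_def act1 act2 act2_ident act2_vcomp)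
  moreover have "bij_betw (\<lambda>f. act1 M f \<sigma>) (Obj ?C) (Obj ?D)"
    using 5 \<sigma>'
    by (intro bij_betwI[where g = "\<lambda>f. act1 M f (inv \<sigma>)"])
      (auto simp: act1 act1_act1 act1_id permutes_inv_o[OF 5] permute_list_inv_cancel)
  moreover have "bij_betw (\<lambda>\<alpha>. act2 M \<alpha> \<sigma>) (Arr ?C) (Arr ?D)"
    using 5 \<sigma>' cell2_typed
    by (intro bij_betwI[where g = "\<lambda>\<alpha>. act2 M \<alpha> (inv \<sigma>)"])
      (auto simp: act1 act2 act2_act2 act2_id permutes_inv_o[OF 5] permute_list_inv_cancel)
  ultimately show ?case by (simp add: cat_isomorphism_def)
next
  case (7 ass bs c)
  let ?P = "prod_list_cat (map2 (hom_cat M) ass bs)"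
  note prods = prod_list_hom_cat_simps[OF 7]
  have composable1: "composable1 M f gs"
    if "f \<in> Cell1 M" "src M f = bs" "gs \<in> Obj ?P" for f gs
    using that by (auto simp: composable1_def prods)
  have composable2: "composable2 M \<alpha> \<beta>s"
    if "\<alpha> \<in> Cell2 M" "src M (dom2 M \<alpha>) = bs" "\<beta>s \<in> Arr ?P" for \<alpha> \<beta>s
    using that by (auto simp: composable2_def prods)
  have composable1': "composable1 M (dom2 M \<alpha>) (map (dom2 M) \<beta>s)"
    if "composable2 M \<alpha> \<beta>s" for \<alpha> \<beta>s
    using that cell2_typed by (auto simp: composable1_def composable2_def)
  have len: "length gs = length bs" if "gs \<in> Obj ?P" for gs
    using that by (auto simp: prods)
  have len': "length \<beta>s = length bs" if "\<beta>s \<in> Arr ?P" for \<beta>s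
    using that by (auto simp: prods)
  have srcs: "map (src M) gs = ass" if "gs \<in> Obj ?P" for gs
    using that by (simp add: prods)
  have srcs': "map (src M) (map (dom2 M) \<beta>s) = ass" if "\<beta>s \<in> Arr ?P" for \<beta>s
    using that by (simp add: prods comp_def)
  show ?case
    unfolding cat_functor_def prod_cat_simps
  proof (safe, goal_cases)
    case (1 f gs)
    then show ?case using composable1 by (simp add: gamma1 srcs)
  next
    case (2 \<alpha> \<beta>s)
    then show ?case
      using gamma2[OF composable2] gamma1[OF composable1'[OF composable2]]
      by (simp add: srcs'[simplified])
  next
    case (3 \<alpha> \<beta>s)
    then show ?case using gamma2[OF composable2] by (simp add: prods len')
  next
    case (4 \<alpha> \<beta>s)
    then show ?case using gamma2[OF composable2] by (simp add: prods len')
  next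
    case (5 f gs)
    then show ?case using composable1 by (simp add: gamma2_ident prods len)
  next
    case (6 \<alpha> \<beta>s \<alpha>' \<beta>s')
    then show ?case
      using gamma2_vcomp[OF composable2 composable2] by (simp add: prods(3-6) len')
  qed
qed (use assms in simp_all)

lemma cat_functorD:
  assumes "cat_functor C D F F'"
  shows "x \<in> Obj C \<Longrightarrow> F' (Ident C x) = Ident D (F x)"
    "\<lbrakk>f \<in> Arr C; g \<in> Arr C; Dom C g = Cod C f\<rbrakk> \<Longrightarrow> F' (Comp C g f) = Comp D (F' g) (F' f)"
  using assms by (simp_all add: cat_functor_def)

context cat_multicategory
begin

lemma ident2:
  assumes "f \<in> Cell1 M"
  shows "ident2 M f \<in> Cell2 M" "dom2 M (ident2 M f) = f" "cod2 M (ident2 M f) = f"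
  using assms hom_category[of "src M f" "tgt M f"] by (auto simp: category_def)

lemma vcomp:
  assumes "\<alpha> \<in> Cell2 M" "\<beta> \<in> Cell2 M" "dom2 M \<beta> = cod2 M \<alpha>"
  shows "vcomp M \<beta> \<alpha> \<in> Cell2 M" "dom2 M (vcomp M \<beta> \<alpha>) = dom2 M \<alpha>"
    "cod2 M (vcomp M \<beta> \<alpha>) = cod2 M \<beta>"
  using assms parallel[of \<alpha>] hom_category[of "src M (dom2 M \<alpha>)" "tgt M (dom2 M \<alpha>)"]
  by (auto simp: category_def)

lemma vcomp_ident:
  assumes "\<alpha> \<in> Cell2 M"
  shows "vcomp M (ident2 M (cod2 M \<alpha>)) \<alpha> = \<alpha>" "vcomp M \<alpha> (ident2 M (dom2 M \<alpha>)) = \<alpha>"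
  using assms hom_category[of "src M (dom2 M \<alpha>)" "tgt M (dom2 M \<alpha>)"]
  by (auto simp: category_def)

lemma vcomp_ident2: "f \<in> Cell1 M \<Longrightarrow> vcomp M (ident2 M f) (ident2 M f) = ident2 M f"
  using vcomp_ident(1)[of "ident2 M f"] by (simp add: ident2)

lemma vcomp_assoc:
  assumes "\<alpha> \<in> Cell2 M" "\<beta> \<in> Cell2 M" "\<delta> \<in> Cell2 M"
    "dom2 M \<beta> = cod2 M \<alpha>" "dom2 M \<delta> = cod2 M \<beta>"
  shows "vcomp M (vcomp M \<delta> \<beta>) \<alpha> = vcomp M \<delta> (vcomp M \<beta> \<alpha>)"
  using assms parallel[of \<alpha>] parallel[of \<beta>]
    hom_category[of "src M (dom2 M \<alpha>)" "tgt M (dom2 M \<alpha>)"]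
  by (auto simp: category_def)

lemma act1:
  assumes "f \<in> Cell1 M" "\<sigma> permutes {..<arity1 M f}"
  shows "act1 M f \<sigma> \<in> Cell1 M" "src M (act1 M f \<sigma>) = permute_list \<sigma> (src M f)"
    "tgt M (act1 M f \<sigma>) = tgt M f"
  using assms act_isomorphism[of \<sigma> "src M f" "tgt M f"]
  by (auto simp: cat_isomorphism_def cat_functor_def)

lemma act2:
  assumes "\<alpha> \<in> Cell2 M" "\<sigma> permutes {..<arity2 M \<alpha>}"
  shows "act2 M \<alpha> \<sigma> \<in> Cell2 M" "dom2 M (act2 M \<alpha> \<sigma>) = act1 M (dom2 M \<alpha>) \<sigma>"
    "cod2 M (act2 M \<alpha> \<sigma>) = act1 M (cod2 M \<alpha>) \<sigma>"
  using assms act_isomorphism[of \<sigma> "src M (dom2 M \<alpha>)" "tgt M (dom2 M \<alpha>)"]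
  by (auto simp: cat_isomorphism_def cat_functor_def)

lemma act2_ident:
  assumes "f \<in> Cell1 M" "\<sigma> permutes {..<arity1 M f}"
  shows "act2 M (ident2 M f) \<sigma> = ident2 M (act1 M f \<sigma>)"
  using assms act_isomorphism[of \<sigma> "src M f" "tgt M f"]
  by (auto simp: cat_isomorphism_def cat_functor_def)

lemma act2_vcomp:
  assumes "\<alpha> \<in> Cell2 M" "\<beta> \<in> Cell2 M" "dom2 M \<beta> = cod2 M \<alpha>" "\<sigma> permutes {..<arity2 M \<alpha>}"
  shows "act2 M (vcomp M \<beta> \<alpha>) \<sigma> = vcomp M (act2 M \<beta> \<sigma>) (act2 M \<alpha> \<sigma>)"
  using assms act_isomorphism[of \<sigma> "src M (dom2 M \<alpha>)" "tgt M (dom2 M \<alpha>)"] parallel[of \<alpha>]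
  by (auto simp: cat_isomorphism_def cat_functor_def)

lemma unit1:
  assumes "a \<in> Ob M"
  shows "unit1 M a \<in> Cell1 M" "src M (unit1 M a) = [a]" "tgt M (unit1 M a) = a"
  using unit_typed[OF assms] by simp_all

lemma gamma1:
  assumes "composable1 M f gs"
  shows "gamma1 M f gs \<in> Cell1 M" "src M (gamma1 M f gs) = concat (map (src M) gs)"
    "tgt M (gamma1 M f gs) = tgt M f"
  using assms gamma_functor[of "map (src M) gs" "map (tgt M) gs" "tgt M f"]
  by (auto simp: cat_functor_def composable1_def prod_list_hom_cat_simps)

lemma gamma2:
  assumes "composable2 M \<alpha> \<beta>s"
  shows "gamma2 M \<alpha> \<beta>s \<in> Cell2 M"
    "dom2 M (gamma2 M \<alpha> \<beta>s) = gamma1 M (dom2 M \<alpha>) (map (dom2 M) \<beta>s)"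
    "cod2 M (gamma2 M \<alpha> \<beta>s) = gamma1 M (cod2 M \<alpha>) (map (cod2 M) \<beta>s)"
  using assms gamma_functor[of "map (\<lambda>\<beta>. src M (dom2 M \<beta>)) \<beta>s"
      "map (\<lambda>\<beta>. tgt M (dom2 M \<beta>)) \<beta>s" "tgt M (dom2 M \<alpha>)"]
  by (auto simp: cat_functor_def composable2_def prod_list_hom_cat_simps)

lemma composable_dom2: "composable2 M \<alpha> \<beta>s \<Longrightarrow> composable1 M (dom2 M \<alpha>) (map (dom2 M) \<beta>s)"
  using cell2_typed by (auto simp: composable1_def composable2_def)

lemma composable_cod2: "composable2 M \<alpha> \<beta>s \<Longrightarrow> composable1 M (cod2 M \<alpha>) (map (cod2 M) \<beta>s)"
  using cell2_typed parallel by (auto simp: composable1_def composable2_def)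

lemma composable_ident2: "composable1 M f gs \<Longrightarrow> composable2 M (ident2 M f) (map (ident2 M) gs)"
  by (auto simp: composable1_def composable2_def ident2)

lemma gamma2_ident:
  assumes "composable1 M f gs"
  shows "gamma2 M (ident2 M f) (map (ident2 M) gs) = ident2 M (gamma1 M f gs)"
  using assms cat_functorD(1)[OF gamma_functor[of "map (src M) gs" "map (tgt M) gs" "tgt M f"],
      of "(f, gs)"]
  by (simp add: composable1_def prod_list_hom_cat_simps)

text \<open>This interchange law is functoriality of gamma on composites. The work lies in the
  typing: 2-cells are parallel, so the second row of cells belongs to the same hom categories as the
  first.\<close>

lemma gamma2_vcomp:
  assumes \<alpha>: "composable2 M \<alpha> \<beta>s" "composable2 M \<alpha>' \<beta>s'"
    and dom: "dom2 M \<alpha>' = cod2 M \<alpha>" "map (dom2 M) \<beta>s' = map (cod2 M) \<beta>s"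
  shows "gamma2 M (vcomp M \<alpha>' \<alpha>) (map2 (vcomp M) \<beta>s' \<beta>s) =
    vcomp M (gamma2 M \<alpha>' \<beta>s') (gamma2 M \<alpha> \<beta>s)"
proof -
  have len: "length \<beta>s' = length \<beta>s" using dom(2) by (metis length_map)
  have "map (\<lambda>\<beta>. src M (dom2 M \<beta>)) \<beta>s' = map (src M) (map (dom2 M) \<beta>s')" by simp
  also have "\<dots> = map (\<lambda>\<beta>. src M (dom2 M \<beta>)) \<beta>s"
    unfolding dom(2) using \<alpha>(1) parallel by (auto simp: composable2_def)
  finally have srcs: "map (\<lambda>\<beta>. src M (dom2 M \<beta>)) \<beta>s' = map (\<lambda>\<beta>. src M (dom2 M \<beta>)) \<beta>s" .
  have "map (\<lambda>\<beta>. tgt M (dom2 M \<beta>)) \<beta>s' = map (tgt M) (map (dom2 M) \<beta>s')" by simp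
  also have "\<dots> = map (\<lambda>\<beta>. tgt M (dom2 M \<beta>)) \<beta>s"
    unfolding dom(2) using \<alpha>(1) parallel by (auto simp: composable2_def)
  finally have tgts: "map (\<lambda>\<beta>. tgt M (dom2 M \<beta>)) \<beta>s' = map (\<lambda>\<beta>. tgt M (dom2 M \<beta>)) \<beta>s" .
  show ?thesis
    using \<alpha> dom srcs tgts parallel[of \<alpha>] len
      cat_functorD(2)[OF gamma_functor[of "map (\<lambda>\<beta>. src M (dom2 M \<beta>)) \<beta>s"
        "map (\<lambda>\<beta>. tgt M (dom2 M \<beta>)) \<beta>s" "tgt M (dom2 M \<alpha>)"], of "(\<alpha>, \<beta>s)" "(\<alpha>', \<beta>s')"]
    by (simp add: composable2_def prod_list_hom_cat_simps)
qed

end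

section \<open>Products of multicategories\<close>

text \<open>Projections replace the pattern matches of the definition, so that simplification also
  works on cells that are variables rather than explicit pairs.\<close>

lemma multicat_prod_simps [simp]:
  "a \<in> Ob (multicat_prod M N) \<longleftrightarrow> fst a \<in> Ob M \<and> snd a \<in> Ob N"
  "x \<in> Cell1 (multicat_prod M N) \<longleftrightarrow>
    fst x \<in> Cell1 M \<and> snd x \<in> Cell1 N \<and> arity1 M (fst x) = arity1 N (snd x)"
  "src (multicat_prod M N) = (\<lambda>x. zip (src M (fst x)) (src N (snd x)))"
  "tgt (multicat_prod M N) = (\<lambda>x. (tgt M (fst x), tgt N (snd x)))"
  "y \<in> Cell2 (multicat_prod M N) \<longleftrightarrow>
    fst y \<in> Cell2 M \<and> snd y \<in> Cell2 N \<and> arity2 M (fst y) = arity2 N (snd y)"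
  "dom2 (multicat_prod M N) = (\<lambda>y. (dom2 M (fst y), dom2 N (snd y)))"
  "cod2 (multicat_prod M N) = (\<lambda>y. (cod2 M (fst y), cod2 N (snd y)))"
  "ident2 (multicat_prod M N) = (\<lambda>x. (ident2 M (fst x), ident2 N (snd x)))"
  "vcomp (multicat_prod M N) z y = (vcomp M (fst z) (fst y), vcomp N (snd z) (snd y))"
  "act1 (multicat_prod M N) x \<sigma> = (act1 M (fst x) \<sigma>, act1 N (snd x) \<sigma>)"
  "act2 (multicat_prod M N) y \<sigma> = (act2 M (fst y) \<sigma>, act2 N (snd y) \<sigma>)"
  "unit1 (multicat_prod M N) = (\<lambda>a. (unit1 M (fst a), unit1 N (snd a)))"
  "gamma1 (multicat_prod M N) x hs = (gamma1 M (fst x) (map fst hs), gamma1 N (snd x) (map snd hs))"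
  "gamma2 (multicat_prod M N) y ys = (gamma2 M (fst y) (map fst ys), gamma2 N (snd y) (map snd ys))"
  by (simp_all add: multicat_prod_def case_prod_beta' map_prod_def mem_Times_iff fun_eq_iff)

lemma zip_eq_map_Pair_iff:
  "length xs = length ys \<Longrightarrow>
    zip xs ys = map (\<lambda>z. (f z, g z)) zs \<longleftrightarrow> xs = map f zs \<and> ys = map g zs"
  by (auto simp: list_eq_iff_nth_eq)

text \<open>Both components of \<open>x\<close> have arity \<open>length hs\<close>, so their
  arities agree automatically; the factors are tied together only by the arities of the entries of
  \<open>hs\<close>.\<close>

lemma composable1_prod_iff:
  "composable1 (multicat_prod M N) x hs \<longleftrightarrow>
    composable1 M (fst x) (map fst hs) \<and> composable1 N (snd x) (map snd hs) \<and>
    map (arity1 M) (map fst hs) = map (arity1 N) (map snd hs)"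
  by (auto simp: composable1_def zip_eq_map_Pair_iff comp_def subset_eq dest: arg_cong[where f = length])

lemma composable2_prod_iff:
  "composable2 (multicat_prod M N) y hs \<longleftrightarrow>
    composable2 M (fst y) (map fst hs) \<and> composable2 N (snd y) (map snd hs) \<and>
    map (arity2 M) (map fst hs) = map (arity2 N) (map snd hs)"
  by (auto simp: composable2_def zip_eq_map_Pair_iff comp_def subset_eq dest: arg_cong[where f = length])

lemma zip_concat:
  "map length xss = map length yss \<Longrightarrow> zip (concat xss) (concat yss) = concat (map2 zip xss yss)"
proof (induction xss arbitrary: yss)
  case (Cons xs xss)
  then show ?case by (cases yss) auto
qed simp

lemma map_zip_proj:
  assumes "length xs = length ys"
  shows "map (\<lambda>z. h (fst z)) (zip xs ys) = map h xs" "map (\<lambda>z. k (snd z)) (zip xs ys) = map k ys"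
  using assms by (auto intro: nth_equalityI)

text \<open>The lists fed to gamma in an axiom are built by the action, by vertical composition or
  by gamma itself. This lemma and the two after it push projections through the three kinds of list,
  which splits an axiom of the product into one for each factor.\<close>

lemma unzip_map2:
  "map fst (map2 (\<lambda>x y. (f (fst x) y, g (snd x) y)) xs ys) = map2 f (map fst xs) ys"
  "map snd (map2 (\<lambda>x y. (f (fst x) y, g (snd x) y)) xs ys) = map2 g (map snd xs) ys"
  by (simp_all add: zip_map1 case_prod_beta comp_def)

lemma unzip_map2_unzip:
  "map fst (map2 (\<lambda>x y. (f (fst x) (fst y), g (snd x) (snd y))) xs ys) =
    map2 f (map fst xs) (map fst ys)"
  "map snd (map2 (\<lambda>x y. (f (fst x) (fst y), g (snd x) (snd y))) xs ys) =
    map2 g (map snd xs) (map snd ys)"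
  by (simp_all add: zip_map1 zip_map2 case_prod_beta comp_def)

lemma unzip_map2_unzips:
  "map fst (map2 (\<lambda>x y. (f (fst x) (map fst y), g (snd x) (map snd y))) xs ys) =
    map2 f (map fst xs) (map (map fst) ys)"
  "map snd (map2 (\<lambda>x y. (f (fst x) (map fst y), g (snd x) (map snd y))) xs ys) =
    map2 g (map snd xs) (map (map snd) ys)"
  by (simp_all add: zip_map1 zip_map2 case_prod_beta comp_def)

theorem cat_multicategory_prod:
  assumes "cat_multicategory M" "cat_multicategory N"
  shows "cat_multicategory (multicat_prod M N)"
proof -
  interpret M: cat_multicategory M by fact
  interpret N: cat_multicategory N by fact
  note composable = composable1_prod_iff composable2_prod_iff
  let ?P = "multicat_prod M N"
  \<comment> \<open>One list of block lengths serves both factors, so their equivariance laws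
    involve the same block permutation.\<close>
  have arity_list: "map (arity1 ?P) hs = map (arity1 M) (map fst hs)"
    "map (arity1 ?P) hs = map (arity1 N) (map snd hs)"
    if "composable1 ?P x hs" for x hs
    using that by (auto simp: composable)
  have arity_list2: "map (arity2 ?P) hs = map (arity2 M) (map fst hs)"
    "map (arity2 ?P) hs = map (arity2 N) (map snd hs)"
    if "composable2 ?P x hs" for x hs
    using that by (auto simp: composable)
  have len1: "length (src M f) = length hs" "length (src N g) = length hs"
    if "composable1 ?P (f, g) hs" for f g hs
    using that unfolding composable by (auto simp: composable1_def)
  have len2: "length (src M (dom2 M f)) = length hs" "length (src N (dom2 N g)) = length hs"
    if "composable2 ?P (f, g) hs" for f g hs
    using that unfolding composable by (auto simp: composable2_def)
  have gamma_arity: "arity1 M (gamma1 M f (map fst hs)) = arity1 N (gamma1 N g (map snd hs))"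
    if "composable1 ?P (f, g) hs" for f g hs
    using that
    by (auto simp: composable M.gamma1 N.gamma1 length_concat comp_def intro!: arg_cong[where f = sum_list])
  have list1: "list_all2 (composable1 M) (map fst gs) (map (map fst) hss)"
    "list_all2 (composable1 N) (map snd gs) (map (map snd) hss)"
    if "list_all2 (composable1 ?P) gs hss" for gs hss
    using that by (auto simp: list_all2_conv_all_nth composable)
  have list2: "list_all2 (composable2 M) (map fst gs) (map (map fst) hss)"
    "list_all2 (composable2 N) (map snd gs) (map (map snd) hss)"
    if "list_all2 (composable2 ?P) gs hss" for gs hss
    using that by (auto simp: list_all2_conv_all_nth composable)
  show ?thesis
  proof (rule cat_multicategoryI, goal_cases)
    case (1 f)
    then show ?case using M.cell1_typed[of "fst f"] N.cell1_typed[of "snd f"]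
      by (auto simp: subset_eq dest: set_zip_leftD set_zip_rightD)
  next
    case (2 \<alpha>)
    then show ?case by (cases \<alpha>) (simp add: M.cell2_typed N.cell2_typed M.parallel N.parallel)
  next
    case (3 \<alpha>)
    then show ?case by (cases \<alpha>) (simp add: M.parallel N.parallel)
  next
    case (4 f)
    then show ?case by (cases f) (simp add: M.ident2 N.ident2)
  next
    case (5 \<alpha> \<beta>)
    then show ?case by (cases \<alpha>) (simp add: M.vcomp N.vcomp)
  next
    case (6 \<alpha>)
    then show ?case by (cases \<alpha>) (simp add: M.vcomp_ident N.vcomp_ident)
  next
    case (7 \<alpha> \<beta> \<delta>)
    then show ?case by (cases \<alpha>) (simp add: M.vcomp_assoc N.vcomp_assoc)
  next
    case (8 f \<sigma>)
    then show ?case by (cases f) (simp add: M.act1 N.act1 permute_list_zip)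
  next
    case (9 \<alpha> \<sigma>)
    then show ?case by (cases \<alpha>) (simp add: M.act2 N.act2 M.cell2_typed N.cell2_typed M.act1 N.act1)
  next
    case (10 f \<sigma>)
    then show ?case by (cases f) (simp add: M.act2_ident N.act2_ident)
  next
    case (11 \<alpha> \<beta> \<sigma>)
    then show ?case by (cases \<alpha>) (simp add: M.act2_vcomp N.act2_vcomp)
  next
    case (12 \<alpha>)
    then show ?case by (cases \<alpha>) (simp add: M.unit1 N.unit1)
  next
    case (13 f gs)
    \<comment> \<open>Zipping two concatenations pairs the right inputs because corresponding blocks
      have equal length, which is the arity condition on \<open>gs\<close>.\<close>
    have *: "map length (map (src M) (map fst gs)) = map length (map (src N) (map snd gs))"
      using 13 by (simp add: composable comp_def)
    have "zip (concat (map (src M) (map fst gs))) (concat (map (src N) (map snd gs))) =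
        concat (map (src ?P) gs)"
      unfolding zip_concat[OF *] by (simp add: zip_map1 zip_map2 zip_same_conv_map comp_def case_prod_beta)
    then show ?case using 13 gamma_arity[of "fst f" "snd f" gs]
      by (simp add: composable M.gamma1 N.gamma1 del: map_map)
  next
    case (14 \<alpha> \<beta>s)
    then have "composable1 ?P (dom2 ?P \<alpha>) (map (dom2 ?P) \<beta>s)"
      using M.composable_dom2[of "fst \<alpha>" "map fst \<beta>s"] N.composable_dom2[of "snd \<alpha>" "map snd \<beta>s"]
      by (simp add: composable comp_def)
    then show ?case using 14 gamma_arity[of "dom2 M (fst \<alpha>)" "dom2 N (snd \<alpha>)" "map (dom2 ?P) \<beta>s"]
      by (simp add: composable M.gamma2 N.gamma2 comp_def)
  next
    case (15 f gs)
    then show ?case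
      using M.gamma2_ident[of "fst f" "map fst gs"] N.gamma2_ident[of "snd f" "map snd gs"]
      by (simp add: composable comp_def)
  next
    case (16 \<alpha> \<beta>s \<alpha>' \<beta>s')
    have "map fst (map (dom2 ?P) \<beta>s') = map fst (map (cod2 ?P) \<beta>s)"
      "map snd (map (dom2 ?P) \<beta>s') = map snd (map (cod2 ?P) \<beta>s)"
      using 16(4) by simp_all
    then show ?case
      using 16(1-3) M.gamma2_vcomp[of "fst \<alpha>" "map fst \<beta>s" "fst \<alpha>'" "map fst \<beta>s'"]
        N.gamma2_vcomp[of "snd \<alpha>" "map snd \<beta>s" "snd \<alpha>'" "map snd \<beta>s'"]
      by (simp only: composable multicat_prod_simps unzip_map2_unzip fst_conv snd_conv) (simp add: comp_def)
  next
    case (17 f \<sigma> \<tau>)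
    then show ?case by (cases f) (simp add: M.act1_act1 N.act1_act1)
  next
    case (18 \<alpha> \<sigma> \<tau>)
    then show ?case by (cases \<alpha>) (simp add: M.act2_act2 N.act2_act2)
  next
    case (19 f)
    then show ?case by (cases f) (simp add: M.act1_id N.act1_id)
  next
    case (20 \<alpha>)
    then show ?case by (cases \<alpha>) (simp add: M.act2_id N.act2_id)
  next
    case (21 f gs hss)
    then show ?case
      using M.gamma1_assoc[OF _ list1(1), of "fst f" gs hss]
        N.gamma1_assoc[OF _ list1(2), of "snd f" gs hss]
      by (simp only: composable multicat_prod_simps unzip_map2_unzips map_concat fst_conv snd_conv)
  next
    case (22 f gs hss)
    then show ?case
      using M.gamma2_assoc[OF _ list2(1), of "fst f" gs hss]
        N.gamma2_assoc[OF _ list2(2), of "snd f" gs hss]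
      by (simp only: composable multicat_prod_simps unzip_map2_unzips map_concat fst_conv snd_conv)
  next
    case (23 f)
    then show ?case by (cases f) (simp add: M.gamma1_unit_left N.gamma1_unit_left)
  next
    case (24 \<alpha>)
    then show ?case by (cases \<alpha>) (simp add: M.gamma2_unit_left N.gamma2_unit_left)
  next
    case (25 f)
    then show ?case
      using M.gamma1_unit_right[of "fst f"] N.gamma1_unit_right[of "snd f"]
      by (cases f) (simp add: comp_def map_zip_proj)
  next
    case (26 \<alpha>)
    then show ?case
      using M.gamma2_unit_right[of "fst \<alpha>"] N.gamma2_unit_right[of "snd \<alpha>"]
      by (cases \<alpha>) (simp add: comp_def
        map_zip_proj(1)[where h = "\<lambda>a. ident2 M (unit1 M a)"]
        map_zip_proj(2)[where k = "\<lambda>a. ident2 N (unit1 N a)"])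
  next
    case (27 f gs \<sigma>)
    have "\<sigma> permutes {..<length gs}"
      using 27 len1[of "fst f" "snd f" gs] by simp
    then show ?case
      using 27 len1[of "fst f" "snd f" gs]
        M.top_equivariance1[of "fst f" "map fst gs" \<sigma>]
        N.top_equivariance1[of "snd f" "map snd gs" \<sigma>]
        arity_list[OF 27(1)]
      by (simp add: composable permute_list_map del: map_map)
  next
    case (28 f gs \<sigma>)
    have "\<sigma> permutes {..<length gs}"
      using 28 len2[of "fst f" "snd f" gs] by simp
    then show ?case
      using 28 len2[of "fst f" "snd f" gs]
        M.top_equivariance2[of "fst f" "map fst gs" \<sigma>]
        N.top_equivariance2[of "snd f" "map snd gs" \<sigma>]
        arity_list2[OF 28(1)]
      by (simp add: composable permute_list_map del: map_map)
  next
    case (29 f gs \<tau>s)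
    then show ?case
      using M.bottom_equivariance1[of "fst f" "map fst gs" \<tau>s]
        N.bottom_equivariance1[of "snd f" "map snd gs" \<tau>s]
        arity_list[OF 29(1)]
      by (simp only: composable multicat_prod_simps(9-) unzip_map2 fst_conv snd_conv)
  next
    case (30 f gs \<tau>s)
    then show ?case
      using M.bottom_equivariance2[of "fst f" "map fst gs" \<tau>s]
        N.bottom_equivariance2[of "snd f" "map snd gs" \<tau>s]
        arity_list2[OF 30(1)]
      by (simp only: composable multicat_prod_simps(9-) unzip_map2 fst_conv snd_conv)
  qed
qed

section \<open>The Barratt--Eccles operad\<close>

lemma barratt_eccles_simps [simp]:
  "Ob barratt_eccles = {()}"
  "x \<in> Cell1 barratt_eccles \<longleftrightarrow> snd x permutes {..<fst x}"
  "src barratt_eccles = (\<lambda>x. replicate (fst x) ())"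
  "tgt barratt_eccles = (\<lambda>_. ())"
  "y \<in> Cell2 barratt_eccles \<longleftrightarrow>
    fst (fst y) = fst (snd y) \<and> snd (fst y) permutes {..<fst (fst y)} \<and> snd (snd y) permutes {..<fst (snd y)}"
  "dom2 barratt_eccles = fst"
  "cod2 barratt_eccles = snd"
  "ident2 barratt_eccles = (\<lambda>x. (x, x))"
  "vcomp barratt_eccles = (\<lambda>z y. (fst y, snd z))"
  "act1 barratt_eccles = be_act"
  "act2 barratt_eccles = (\<lambda>y \<tau>. (be_act (fst y) \<tau>, be_act (snd y) \<tau>))"
  "unit1 barratt_eccles = (\<lambda>_. (1, id))"
  "gamma1 barratt_eccles = be_gamma"
  "gamma2 barratt_eccles = (\<lambda>y zs. (be_gamma (fst y) (map fst zs), be_gamma (snd y) (map snd zs)))"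
  by (auto simp: barratt_eccles_def case_prod_beta')

text \<open>With a single object an input sequence carries no information beyond its length, so
  typing in the operad becomes arithmetic of arities.\<close>

lemma unit_list_eq_iff: "xs = (ys :: unit list) \<longleftrightarrow> length xs = length ys"
  by (auto intro: nth_equalityI)

lemma composable1_barratt_eccles_iff:
  "composable1 barratt_eccles x ys \<longleftrightarrow>
    fst x = length ys \<and> snd x permutes {..<length ys} \<and> perms_of (map fst ys) (map snd ys)"
  by (auto simp: composable1_def unit_list_eq_iff perms_of_def list_all2_conv_all_nth set_conv_nth)

text \<open>The last conjunct records that the two ends of each 2-cell have equal arity; hence the
  domain and codomain composites use the same block lengths.\<close>

lemma composable2_barratt_eccles_iff:
  "composable2 barratt_eccles y zs \<longleftrightarrow>
    composable1 barratt_eccles (fst y) (map fst zs) \<and>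
    composable1 barratt_eccles (snd y) (map snd zs) \<and> map fst (map fst zs) = map fst (map snd zs)"
  by (auto simp: composable1_def composable2_def unit_list_eq_iff subset_eq)

lemma block_perm_single:
  assumes "\<sigma> permutes {..<n}"
  shows "block_perm id [n] [\<sigma>] = \<sigma>"
  by (rule block_perm_eqI[symmetric])
    (use permutes_not_in[OF assms] in \<open>auto simp: block_pos_def\<close>)

text \<open>All blocks have length one, so address (i, 0) is the number i and permuting blocks is
  permuting points. This is the right unit law of the operad.\<close>

lemma block_perm_ones:
  assumes \<sigma>: "\<sigma> permutes {..<n}"
  shows "block_perm \<sigma> (replicate n 1) (replicate n id) = \<sigma>"
proof (rule block_perm_eqI[symmetric])
  have "permute_list (inv \<sigma>) (replicate n (1 :: nat)) = replicate n 1"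
    using permutes_nat_less[OF permutes_inv[OF \<sigma>]] by (intro nth_equalityI) (auto simp: permute_list_def)
  then show "\<sigma> (block_pos (replicate n 1) i p) =
      block_pos (permute_list (inv \<sigma>) (replicate n 1)) (\<sigma> i) ((replicate n id ! i) p)"
    if "i < length (replicate n (1 :: nat))" "p < replicate n (1 :: nat) ! i" for i p
    using that permutes_nat_less[OF \<sigma>, of i] by (simp add: block_pos_def sum_list_replicate)
qed (use permutes_not_in[OF \<sigma>] in \<open>simp add: sum_list_replicate\<close>)

lemma be_gamma_permutes:
  assumes "composable1 barratt_eccles x ys"
  shows "snd (be_gamma x ys) permutes {..<fst (be_gamma x ys)}"
  using assms by (auto simp: be_gamma_def composable1_barratt_eccles_iff intro: block_perm_permutes)

lemma fst_be_gamma: "fst (be_gamma x ys) = sum_list (map fst ys)"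
  by (simp add: be_gamma_def)

text \<open>\<open>block_perm_assoc\<close> for the arities and permutations in \<open>zss\<close>.
  Composability identifies the length of the i-th list in \<open>zss\<close> with the arity of the
  i-th entry of \<open>ys\<close>.\<close>

lemma be_gamma_assoc:
  assumes x: "composable1 barratt_eccles x ys"
    and ys: "list_all2 (composable1 barratt_eccles) ys zss"
  shows "be_gamma (be_gamma x ys) (concat zss) = be_gamma x (map2 be_gamma ys zss)"
proof -
  let ?lss = "map (map fst) zss" and ?\<rho>ss = "map (map snd) zss"
  have len: "length zss = length ys" using ys by (simp add: list_all2_lengthD)
  have lengths: "map length ?lss = map fst ys"
    using ys by (auto simp: list_all2_conv_all_nth composable1_barratt_eccles_iff intro: nth_equalityI)
  have sums: "map fst (map2 be_gamma ys zss) = map sum_list ?lss"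
    using len by (auto simp: be_gamma_def intro: nth_equalityI)
  have perms: "map snd (map2 be_gamma ys zss) =
      map2 (\<lambda>\<tau> (ls, \<rho>s). block_perm \<tau> ls \<rho>s) (map snd ys) (zip ?lss ?\<rho>ss)"
    using len by (auto simp: be_gamma_def intro: nth_equalityI)
  have "block_perm (block_perm (snd x) (map length ?lss) (map snd ys)) (concat ?lss) (concat ?\<rho>ss) =
    block_perm (snd x) (map sum_list ?lss)
      (map2 (\<lambda>\<tau> (ls, \<rho>s). block_perm \<tau> ls \<rho>s) (map snd ys) (zip ?lss ?\<rho>ss))"
  proof (rule block_perm_assoc)
    show "snd x permutes {..<length ?lss}" "perms_of (map length ?lss) (map snd ys)"
      using x len by (simp_all only: lengths) (simp_all add: composable1_barratt_eccles_iff)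
    show "list_all2 perms_of ?lss ?\<rho>ss"
      using ys by (auto simp: list_all2_conv_all_nth composable1_barratt_eccles_iff)
  qed
  then show ?thesis
    unfolding be_gamma_def[of "be_gamma x ys"] be_gamma_def[of x "map2 be_gamma ys zss"] sums perms
    by (simp only: be_gamma_def lengths map_concat snd_conv sum_list_concat)
qed

lemma be_gamma_unit_left: "snd x permutes {..<fst x} \<Longrightarrow> be_gamma (1, id) [x] = x"
  by (simp add: be_gamma_def block_perm_single)

lemma be_gamma_unit_right:
  "\<sigma> permutes {..<n} \<Longrightarrow> be_gamma (n, \<sigma>) (replicate n (1, id)) = (n, \<sigma>)"
  using block_perm_ones[of \<sigma> n] by (simp add: be_gamma_def sum_list_replicate)

text \<open>The list \<open>ys\<close> is already moved by \<sigma>, so the target-order lists that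
  \<open>block_perm_comp\<close> asks for are the original ones.\<close>

lemma be_gamma_top:
  assumes "composable1 barratt_eccles x ys" "\<sigma> permutes {..<fst x}"
  shows "be_gamma (be_act x \<sigma>) (permute_list \<sigma> ys) =
    be_act (be_gamma x ys) (top_perm \<sigma> (map fst ys))"
proof -
  have \<sigma>: "\<sigma> permutes {..<length ys}"
    using assms by (simp add: composable1_barratt_eccles_iff)
  let ?ks = "permute_list \<sigma> (map fst ys)" and ?\<tau>s = "permute_list \<sigma> (map snd ys)"
  have "block_perm (snd x) (permute_list (inv \<sigma>) ?ks) (permute_list (inv \<sigma>) ?\<tau>s) \<circ>
      block_perm \<sigma> ?ks (replicate (length ?ks) id) =
    block_perm (snd x \<circ> \<sigma>) ?ks (map2 (\<circ>) ?\<tau>s (replicate (length ?ks) id))"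
    using assms \<sigma> by (intro block_perm_comp perms_of_replicate_id) (auto simp: composable1_barratt_eccles_iff)
  moreover have "map2 (\<circ>) ?\<tau>s (replicate (length ?ks) id) = ?\<tau>s"
    by (auto intro: nth_equalityI)
  ultimately show ?thesis
    using \<sigma> by (simp add: be_gamma_def be_act_def top_perm_def permute_list_inv_cancel
        sum_list_permute_list permute_list_map[symmetric])
qed

lemma be_gamma_bottom:
  assumes "composable1 barratt_eccles x ys" "perms_of (map fst ys) \<tau>s"
  shows "be_gamma x (map2 be_act ys \<tau>s) = be_act (be_gamma x ys) (bottom_perm (map fst ys) \<tau>s)"
proof -
  have "map fst (map2 be_act ys \<tau>s) = map fst ys" "map snd (map2 be_act ys \<tau>s) = map2 (\<circ>) (map snd ys) \<tau>s"
    using perms_of_length[OF assms(2)] by (auto simp: be_act_def intro: nth_equalityI)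
  then show ?thesis
    using block_perm_comp[of "snd x" "map fst ys" id "map snd ys" \<tau>s] assms
    by (simp only: be_gamma_def be_act_def bottom_perm_def) (simp add: composable1_barratt_eccles_iff)
qed

text \<open>A 2-cell is a pair of 1-cells of the same arity, and the action and gamma treat the two
  ends separately. Equivariance and associativity for 2-cells are thus the laws for 1-cells, used
  once at the domain and once at the codomain.\<close>

theorem cat_multicategory_barratt_eccles: "cat_multicategory barratt_eccles"
proof -
  note composable2 = composable2_barratt_eccles_iff
  let ?E = barratt_eccles
  have list2: "list_all2 (composable1 ?E) (map fst zs) (map (map fst) wss)"
    "list_all2 (composable1 ?E) (map snd zs) (map (map snd) wss)"
    if "list_all2 (composable2 ?E) zs wss" for zs wss
    using that by (auto simp: list_all2_conv_all_nth composable2)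
  have arity_list: "map (arity2 ?E) zs = map fst (map fst zs)"
    "map (arity2 ?E) zs = map fst (map snd zs)"
    if "composable2 ?E y zs" for y zs
    using that by (auto simp: composable2)
  show ?thesis
  proof (rule cat_multicategoryI, goal_cases)
    case (13 f gs)
    then show ?case
      using be_gamma_permutes[of f gs] by (simp add: fst_be_gamma unit_list_eq_iff length_concat comp_def)
  next
    case (14 \<alpha> \<beta>s)
    then show ?case
      using be_gamma_permutes[of "fst \<alpha>" "map fst \<beta>s"] be_gamma_permutes[of "snd \<alpha>" "map snd \<beta>s"]
        arg_cong[OF arity_list(1)[OF 14], of sum_list] arg_cong[OF arity_list(2)[OF 14], of sum_list]
      by (simp add: composable2 fst_be_gamma)
  next
    case (15 f gs)
    then show ?case by (simp add: comp_def)
  next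
    case (16 \<alpha> \<beta>s \<alpha>' \<beta>s')
    have "length \<beta>s' = length \<beta>s" using map_eq_imp_length_eq[OF 16(4)] .
    then show ?case by (simp add: comp_def case_prod_beta map_zip_proj)
  next
    case (21 f gs hss)
    then show ?case by (simp add: be_gamma_assoc)
  next
    case (22 \<alpha> \<beta>s \<delta>ss)
    then show ?case
      using be_gamma_assoc[OF _ list2(1), of "fst \<alpha>" \<beta>s \<delta>ss]
        be_gamma_assoc[OF _ list2(2), of "snd \<alpha>" \<beta>s \<delta>ss]
      by (simp only: composable2 barratt_eccles_simps unzip_map2_unzips map_concat fst_conv snd_conv)
  next
    case (27 f gs \<sigma>)
    then show ?case by (simp add: be_gamma_top)
  next
    case (28 \<alpha> \<beta>s \<sigma>)
    have comp: "composable1 ?E (fst \<alpha>) (map fst \<beta>s)" "composable1 ?E (snd \<alpha>) (map snd \<beta>s)"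
      using 28(1) by (simp_all add: composable2)
    have \<sigma>: "\<sigma> permutes {..<fst (fst \<alpha>)}" "\<sigma> permutes {..<fst (snd \<alpha>)}" "\<sigma> permutes {..<length \<beta>s}"
      using 28(2) comp by (simp_all add: composable1_barratt_eccles_iff)
    show ?case
      using be_gamma_top[OF comp(1) \<sigma>(1)] be_gamma_top[OF comp(2) \<sigma>(2)] arity_list[OF 28(1)] \<sigma>(3)
      by (simp add: permute_list_map del: map_map)
  next
    case (29 f gs \<tau>s)
    then show ?case by (simp add: be_gamma_bottom)
  next
    case (30 \<alpha> \<beta>s \<tau>s)
    then show ?case
      using be_gamma_bottom[of "fst \<alpha>" "map fst \<beta>s" \<tau>s] be_gamma_bottom[of "snd \<alpha>" "map snd \<beta>s" \<tau>s]
        arity_list[OF 30(1)]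
      by (simp only: composable2 barratt_eccles_simps unzip_map2 fst_conv snd_conv)
  qed (auto simp: be_act_def permutes_compose unit_list_eq_iff comp_assoc be_gamma_unit_left
      be_gamma_unit_right map_replicate permutes_id simp del: One_nat_def)
qed

section \<open>Cells of the product with the Barratt--Eccles operad\<close>

lemma times_be_cell1D:
  assumes "x \<in> Cell1 (times_be M)"
  shows "fst x \<in> Cell1 M" "snd (snd x) permutes {..<arity1 M (fst x)}" "fst (snd x) = arity1 M (fst x)"
  using assms by (cases x; auto)+

lemma times_be_cell2D:
  assumes "y \<in> Cell2 (times_be M)"
  shows "fst y \<in> Cell2 M" "snd (fst (snd y)) permutes {..<arity2 M (fst y)}"
    "snd (snd (snd y)) permutes {..<arity2 M (fst y)}"
    "fst (fst (snd y)) = arity2 M (fst y)" "fst (snd (snd y)) = arity2 M (fst y)"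
  using assms by (cases y; auto)+

text \<open>The block lengths stored in the second components are re-read as arities in
  \<open>M\<close>, so that later computations refer to \<open>M\<close> alone.\<close>

lemma times_be_composable1D:
  assumes "composable1 (times_be M) x ys"
  defines "\<tau>s \<equiv> map (\<lambda>y. snd (snd y)) ys"
  shows "composable1 M (fst x) (map fst ys)"
    "snd (snd x) permutes {..<arity1 M (fst x)}"
    "perms_of (map (arity1 M) (map fst ys)) \<tau>s"
    "be_gamma (snd x) (map snd ys) = (sum_list (map (arity1 M) (map fst ys)),
      block_perm (snd (snd x)) (map (arity1 M) (map fst ys)) \<tau>s)"
proof -
  have comp: "composable1 barratt_eccles (snd x) (map snd ys)"
    and ks: "map (arity1 M) (map fst ys) = map fst (map snd ys)"
    using assms by (simp_all add: composable1_prod_iff)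
  show "composable1 M (fst x) (map fst ys)" using assms by (simp add: composable1_prod_iff)
  then have "length ys = arity1 M (fst x)" by (simp add: composable1_def)
  then show "snd (snd x) permutes {..<arity1 M (fst x)}"
    using comp by (simp add: composable1_barratt_eccles_iff)
  show "perms_of (map (arity1 M) (map fst ys)) \<tau>s"
    using comp unfolding ks by (simp add: composable1_barratt_eccles_iff \<tau>s_def comp_def)
  show "be_gamma (snd x) (map snd ys) = (sum_list (map (arity1 M) (map fst ys)),
      block_perm (snd (snd x)) (map (arity1 M) (map fst ys)) \<tau>s)"
    unfolding ks by (simp add: be_gamma_def \<tau>s_def comp_def)
qed

lemma times_be_composable2D:
  assumes "composable2 (times_be M) y zs"
  defines "\<sigma>s \<equiv> map (\<lambda>z. snd (fst (snd z))) zs" and "\<tau>s \<equiv> map (\<lambda>z. snd (snd (snd z))) zs"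
  shows "composable2 M (fst y) (map fst zs)"
    "snd (fst (snd y)) permutes {..<arity2 M (fst y)}"
    "snd (snd (snd y)) permutes {..<arity2 M (fst y)}"
    "perms_of (map (arity2 M) (map fst zs)) \<sigma>s"
    "perms_of (map (arity2 M) (map fst zs)) \<tau>s"
    "be_gamma (fst (snd y)) (map fst (map snd zs)) = (sum_list (map (arity2 M) (map fst zs)),
      block_perm (snd (fst (snd y))) (map (arity2 M) (map fst zs)) \<sigma>s)"
    "be_gamma (snd (snd y)) (map snd (map snd zs)) = (sum_list (map (arity2 M) (map fst zs)),
      block_perm (snd (snd (snd y))) (map (arity2 M) (map fst zs)) \<tau>s)"
proof -
  have comp: "composable2 barratt_eccles (snd y) (map snd zs)"
    and arity: "map (arity2 M) (map fst zs) = map (arity2 barratt_eccles) (map snd zs)"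
    using assms by (simp_all add: composable2_prod_iff)
  have ks: "map (arity2 M) (map fst zs) = map fst (map fst (map snd zs))"
    unfolding arity by simp
  moreover have "map fst (map fst (map snd zs)) = map fst (map snd (map snd zs))"
    using comp unfolding composable2_barratt_eccles_iff by blast
  ultimately have ks': "map (arity2 M) (map fst zs) = map fst (map snd (map snd zs))" by (rule trans)
  show "composable2 M (fst y) (map fst zs)" using assms by (simp add: composable2_prod_iff)
  then have "length zs = arity2 M (fst y)" by (simp add: composable2_def)
  then show "snd (fst (snd y)) permutes {..<arity2 M (fst y)}"
    "snd (snd (snd y)) permutes {..<arity2 M (fst y)}"
    using comp by (simp_all add: composable2_barratt_eccles_iff composable1_barratt_eccles_iff)
  show "perms_of (map (arity2 M) (map fst zs)) \<sigma>s"
    using comp unfolding ks composable2_barratt_eccles_iff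
    by (simp add: composable1_barratt_eccles_iff \<sigma>s_def comp_def)
  show "perms_of (map (arity2 M) (map fst zs)) \<tau>s"
    using comp unfolding ks' composable2_barratt_eccles_iff
    by (simp add: composable1_barratt_eccles_iff \<tau>s_def comp_def)
  show "be_gamma (fst (snd y)) (map fst (map snd zs)) = (sum_list (map (arity2 M) (map fst zs)),
      block_perm (snd (fst (snd y))) (map (arity2 M) (map fst zs)) \<sigma>s)"
    unfolding ks by (simp add: be_gamma_def \<sigma>s_def comp_def)
  show "be_gamma (snd (snd y)) (map snd (map snd zs)) = (sum_list (map (arity2 M) (map fst zs)),
      block_perm (snd (snd (snd y))) (map (arity2 M) (map fst zs)) \<tau>s)"
    unfolding ks' by (simp add: be_gamma_def \<tau>s_def comp_def)
qed

section \<open>Equivariance under block permutations\<close>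

context cat_multicategory
begin

lemma length_composable1: "composable1 M f gs \<Longrightarrow> length gs = arity1 M f"
  by (simp add: composable1_def)

lemma length_composable2: "composable2 M \<alpha> \<beta>s \<Longrightarrow> length \<beta>s = arity2 M \<alpha>"
  by (simp add: composable2_def)

lemma arity_gamma1: "composable1 M f gs \<Longrightarrow> arity1 M (gamma1 M f gs) = sum_list (map (arity1 M) gs)"
  by (simp add: gamma1 length_concat comp_def)

lemma arity_gamma2: "composable2 M \<alpha> \<beta>s \<Longrightarrow> arity2 M (gamma2 M \<alpha> \<beta>s) = sum_list (map (arity2 M) \<beta>s)"
  using arity_gamma1[OF composable_dom2] by (simp add: gamma2 comp_def)

lemma act1_inv:
  assumes "f \<in> Cell1 M" "\<sigma> permutes {..<arity1 M f}"
  shows "act1 M (act1 M f \<sigma>) (inv \<sigma>) = f" "act1 M (act1 M f (inv \<sigma>)) \<sigma> = f"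
  using assms by (simp_all add: act1_act1 permutes_inv permutes_inv_o act1_id)

lemma act2_inv:
  assumes "\<alpha> \<in> Cell2 M" "\<sigma> permutes {..<arity2 M \<alpha>}"
  shows "act2 M (act2 M \<alpha> \<sigma>) (inv \<sigma>) = \<alpha>" "act2 M (act2 M \<alpha> (inv \<sigma>)) \<sigma> = \<alpha>"
  using assms by (simp_all add: act2_act2 permutes_inv permutes_inv_o act2_id)

lemma composable1_permute:
  assumes "composable1 M f gs" "\<sigma> permutes {..<arity1 M f}"
  shows "composable1 M (act1 M f \<sigma>) (permute_list \<sigma> gs)"
  using assms by (simp add: composable1_def act1 permute_list_map)

lemma composable2_permute:
  assumes "composable2 M \<alpha> \<beta>s" "\<sigma> permutes {..<arity2 M \<alpha>}"
  shows "composable2 M (act2 M \<alpha> \<sigma>) (permute_list \<sigma> \<beta>s)"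
  using assms cell2_typed by (simp add: composable2_def act1 act2 permute_list_map)

lemma map_arity1_act1:
  assumes "set gs \<subseteq> Cell1 M" "perms_of (map (arity1 M) gs) \<tau>s"
  shows "map (arity1 M) (map2 (act1 M) gs \<tau>s) = map (arity1 M) gs"
proof (rule nth_equalityI)
  fix i assume "i < length (map (arity1 M) (map2 (act1 M) gs \<tau>s))"
  then show "map (arity1 M) (map2 (act1 M) gs \<tau>s) ! i = map (arity1 M) gs ! i"
    using assms perms_of_nth[OF assms(2), of i] by (simp add: act1 subset_code(1) perms_of_length)
qed (use perms_of_length[OF assms(2)] in simp)

lemma map_arity2_act2:
  assumes "set \<beta>s \<subseteq> Cell2 M" "perms_of (map (arity2 M) \<beta>s) \<tau>s"
  shows "map (arity2 M) (map2 (act2 M) \<beta>s \<tau>s) = map (arity2 M) \<beta>s"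
proof (rule nth_equalityI)
  fix i assume "i < length (map (arity2 M) (map2 (act2 M) \<beta>s \<tau>s))"
  then show "map (arity2 M) (map2 (act2 M) \<beta>s \<tau>s) ! i = map (arity2 M) \<beta>s ! i"
    using assms perms_of_nth[OF assms(2), of i] cell2_typed
    by (simp add: act1 act2 subset_code(1) perms_of_length)
qed (use perms_of_length[OF assms(2)] in simp)

lemma composable1_map2_act:
  assumes "composable1 M f gs" "perms_of (map (arity1 M) gs) \<tau>s"
  shows "composable1 M f (map2 (act1 M) gs \<tau>s)"
proof -
  have "act1 M (gs ! i) (\<tau>s ! i) \<in> Cell1 M \<and> tgt M (act1 M (gs ! i) (\<tau>s ! i)) = tgt M (gs ! i)"
    if "i < length gs" for i
    using that assms(1) perms_of_nth[OF assms(2), of i] by (simp add: act1 composable1_def subset_code(1))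
  then show ?thesis
    using assms(1) perms_of_length[OF assms(2)]
    by (auto simp: composable1_def in_set_conv_nth list_eq_iff_nth_eq)
qed

lemma composable2_map2_act:
  assumes "composable2 M \<alpha> \<beta>s" "perms_of (map (arity2 M) \<beta>s) \<tau>s"
  shows "composable2 M \<alpha> (map2 (act2 M) \<beta>s \<tau>s)"
proof -
  have "act2 M (\<beta>s ! i) (\<tau>s ! i) \<in> Cell2 M \<and>
      tgt M (dom2 M (act2 M (\<beta>s ! i) (\<tau>s ! i))) = tgt M (dom2 M (\<beta>s ! i))"
    if "i < length \<beta>s" for i
    using that assms(1) perms_of_nth[OF assms(2), of i] cell2_typed
    by (simp add: act1 act2 composable2_def subset_code(1))
  then show ?thesis
    using assms(1) perms_of_length[OF assms(2)]
    by (auto simp: composable2_def in_set_conv_nth list_eq_iff_nth_eq)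
qed

text \<open>The list \<open>gs\<close> is ordered as the inputs of \<open>act1 M f \<sigma>\<close>,
  so \<open>f\<close> composes with that list moved back by \<open>inv \<sigma>\<close>. Bottom
  equivariance is applied first, while \<open>act1 M f \<sigma>\<close> is still in front, and top
  equivariance second; in this order the accumulated permutation is top \<circ> bottom, the block
  permutation.\<close>

lemma equivariance1:
  assumes f: "composable1 M f (permute_list (inv \<sigma>) gs)" and \<sigma>: "\<sigma> permutes {..<arity1 M f}"
    and \<tau>s: "perms_of (map (arity1 M) gs) \<tau>s"
  shows "gamma1 M (act1 M f \<sigma>) (map2 (act1 M) gs \<tau>s) =
    act1 M (gamma1 M f (permute_list (inv \<sigma>) gs)) (block_perm \<sigma> (map (arity1 M) gs) \<tau>s)"
proof -
  let ?ks = "map (arity1 M) gs" and ?hs = "permute_list (inv \<sigma>) gs"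
  have "arity1 M f = length gs" using length_composable1[OF f] by simp
  note \<sigma>' = \<sigma>[unfolded this]
  note inv_\<sigma> = permutes_inv[OF \<sigma>']
  have gs: "permute_list \<sigma> ?hs = gs" using \<sigma>' by (rule permute_list_inv_cancel)
  have ks: "map (arity1 M) ?hs = permute_list (inv \<sigma>) ?ks"
    using inv_\<sigma> by (simp add: permute_list_map)
  have arity: "arity1 M (gamma1 M f ?hs) = sum_list ?ks"
    unfolding arity_gamma1[OF f] ks using inv_\<sigma> by (intro sum_list_permute_list) simp
  have "gamma1 M (act1 M f \<sigma>) (map2 (act1 M) gs \<tau>s) =
      act1 M (gamma1 M (act1 M f \<sigma>) gs) (bottom_perm ?ks \<tau>s)"
    using composable1_permute[OF f \<sigma>] \<tau>s by (intro bottom_equivariance1) (simp_all add: gs)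
  also have "gamma1 M (act1 M f \<sigma>) gs = act1 M (gamma1 M f ?hs) (top_perm \<sigma> (permute_list (inv \<sigma>) ?ks))"
    using top_equivariance1[OF f \<sigma>] by (simp only: gs ks)
  also have "act1 M \<dots> (bottom_perm ?ks \<tau>s) =
      act1 M (gamma1 M f ?hs) (top_perm \<sigma> (permute_list (inv \<sigma>) ?ks) \<circ> bottom_perm ?ks \<tau>s)"
    using gamma1(1)[OF f] top_perm_permutes[of \<sigma> "permute_list (inv \<sigma>) ?ks"] bottom_perm_permutes[OF \<tau>s]
      \<sigma>' sum_list_permute_list[of "inv \<sigma>" ?ks] inv_\<sigma>
    by (intro act1_act1) (simp_all only: arity length_map length_permute_list)
  also have "\<dots> = act1 M (gamma1 M f ?hs) (block_perm \<sigma> ?ks \<tau>s)"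
    using top_perm_comp_bottom_perm[of \<sigma> ?ks] \<sigma>' \<tau>s by simp
  finally show ?thesis .
qed

lemma equivariance2:
  assumes f: "composable2 M \<alpha> (permute_list (inv \<sigma>) \<beta>s)" and \<sigma>: "\<sigma> permutes {..<arity2 M \<alpha>}"
    and \<tau>s: "perms_of (map (arity2 M) \<beta>s) \<tau>s"
  shows "gamma2 M (act2 M \<alpha> \<sigma>) (map2 (act2 M) \<beta>s \<tau>s) =
    act2 M (gamma2 M \<alpha> (permute_list (inv \<sigma>) \<beta>s)) (block_perm \<sigma> (map (arity2 M) \<beta>s) \<tau>s)"
proof -
  let ?ks = "map (arity2 M) \<beta>s" and ?hs = "permute_list (inv \<sigma>) \<beta>s"
  have "arity2 M \<alpha> = length \<beta>s" using length_composable2[OF f] by simp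
  note \<sigma>' = \<sigma>[unfolded this]
  note inv_\<sigma> = permutes_inv[OF \<sigma>']
  have \<beta>s: "permute_list \<sigma> ?hs = \<beta>s" using \<sigma>' by (rule permute_list_inv_cancel)
  have ks: "map (arity2 M) ?hs = permute_list (inv \<sigma>) ?ks"
    using inv_\<sigma> by (simp add: permute_list_map)
  have arity: "arity2 M (gamma2 M \<alpha> ?hs) = sum_list ?ks"
    unfolding arity_gamma2[OF f] ks using inv_\<sigma> by (intro sum_list_permute_list) simp
  have "gamma2 M (act2 M \<alpha> \<sigma>) (map2 (act2 M) \<beta>s \<tau>s) =
      act2 M (gamma2 M (act2 M \<alpha> \<sigma>) \<beta>s) (bottom_perm ?ks \<tau>s)"
    using composable2_permute[OF f \<sigma>] \<tau>s by (intro bottom_equivariance2) (simp_all add: \<beta>s)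
  also have "gamma2 M (act2 M \<alpha> \<sigma>) \<beta>s = act2 M (gamma2 M \<alpha> ?hs) (top_perm \<sigma> (permute_list (inv \<sigma>) ?ks))"
    using top_equivariance2[OF f \<sigma>] by (simp only: \<beta>s ks)
  also have "act2 M \<dots> (bottom_perm ?ks \<tau>s) =
      act2 M (gamma2 M \<alpha> ?hs) (top_perm \<sigma> (permute_list (inv \<sigma>) ?ks) \<circ> bottom_perm ?ks \<tau>s)"
    using gamma2(1)[OF f] top_perm_permutes[of \<sigma> "permute_list (inv \<sigma>) ?ks"] bottom_perm_permutes[OF \<tau>s]
      \<sigma>' sum_list_permute_list[of "inv \<sigma>" ?ks] inv_\<sigma>
    by (intro act2_act2) (simp_all only: arity length_map length_permute_list)
  also have "\<dots> = act2 M (gamma2 M \<alpha> ?hs) (block_perm \<sigma> ?ks \<tau>s)"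
    using top_perm_comp_bottom_perm[of \<sigma> ?ks] \<sigma>' \<tau>s by simp
  finally show ?thesis .
qed

lemma map2_act1_inv:
  assumes "set gs \<subseteq> Cell1 M" "perms_of (map (arity1 M) gs) \<tau>s"
  shows "map2 (act1 M) (map2 (act1 M) gs (map inv \<tau>s)) \<tau>s = gs"
  using assms perms_of_length[OF assms(2)] perms_of_nth[OF assms(2)]
  by (auto simp: act1_inv subset_code(1) intro!: nth_equalityI)

lemma map2_act2_inv:
  assumes "set \<beta>s \<subseteq> Cell2 M" "perms_of (map (arity2 M) \<beta>s) \<tau>s"
  shows "map2 (act2 M) (map2 (act2 M) \<beta>s (map inv \<tau>s)) \<tau>s = \<beta>s"
  using assms perms_of_length[OF assms(2)] perms_of_nth[OF assms(2)]
  by (auto simp: act2_inv subset_code(1) intro!: nth_equalityI)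

text \<open>Writing \<open>f\<close> as \<open>act1 M f (inv \<sigma>)\<close> acted on by \<sigma>,
  and each input likewise, lets \<open>equivariance1\<close> collect all outer actions into one
  block permutation. What remains is a composite of the very cells at which \<phi>(F) evaluates F,
  and F passes inside because it preserves gamma.\<close>

lemma untwist1:
  assumes f: "composable1 M f gs" and \<sigma>: "\<sigma> permutes {..<arity1 M f}"
    and \<tau>s: "perms_of (map (arity1 M) gs) \<tau>s"
  defines "hs \<equiv> permute_list (inv \<sigma>) (map2 (act1 M) gs (map inv \<tau>s))"
  shows "composable1 M (act1 M f (inv \<sigma>)) hs"
    and "act1 M (gamma1 M f gs) (inv (block_perm \<sigma> (map (arity1 M) gs) \<tau>s)) =
      gamma1 M (act1 M f (inv \<sigma>)) hs"
proof -
  let ?hs = "map2 (act1 M) gs (map inv \<tau>s)" and ?B = "block_perm \<sigma> (map (arity1 M) gs) \<tau>s"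
  have fgs: "f \<in> Cell1 M" "set gs \<subseteq> Cell1 M" using f by (simp_all add: composable1_def)
  note inv_\<sigma> = permutes_inv[OF \<sigma>] and inv_\<tau>s = perms_of_inv[OF \<tau>s]
  show comp: "composable1 M (act1 M f (inv \<sigma>)) hs"
    unfolding hs_def by (intro composable1_permute composable1_map2_act f inv_\<tau>s inv_\<sigma>)
  have "gamma1 M f gs = gamma1 M (act1 M (act1 M f (inv \<sigma>)) \<sigma>) (map2 (act1 M) ?hs \<tau>s)"
    using fgs \<sigma> \<tau>s by (simp only: act1_inv map2_act1_inv)
  also have "\<dots> = act1 M (gamma1 M (act1 M f (inv \<sigma>)) hs) ?B"
    using equivariance1[OF comp[unfolded hs_def], of \<tau>s] fgs \<sigma> inv_\<sigma> \<tau>s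
      map_arity1_act1[OF fgs(2) inv_\<tau>s]
    by (simp only: hs_def act1 length_permute_list)
  finally have eq: "gamma1 M f gs = act1 M (gamma1 M (act1 M f (inv \<sigma>)) hs) ?B" .
  have "arity1 M (gamma1 M (act1 M f (inv \<sigma>)) hs) = sum_list (map (arity1 M) gs)"
    unfolding arity_gamma1[OF comp] unfolding hs_def
    using map_arity1_act1[OF fgs(2) inv_\<tau>s] inv_\<sigma> length_composable1[OF f]
      perms_of_length[OF \<tau>s] sum_list_permute_list[of "inv \<sigma>" "map (arity1 M) gs"]
    by (simp add: permute_list_map[symmetric] del: map_map)
  then show "act1 M (gamma1 M f gs) (inv ?B) = gamma1 M (act1 M f (inv \<sigma>)) hs"
    unfolding eq using \<sigma> \<tau>s length_composable1[OF f]
    by (intro act1_inv gamma1 comp) (simp add: block_perm_permutes)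
qed

lemma untwist2:
  assumes f: "composable2 M \<alpha> \<beta>s" and \<sigma>: "\<sigma> permutes {..<arity2 M \<alpha>}"
    and \<tau>s: "perms_of (map (arity2 M) \<beta>s) \<tau>s"
  defines "\<delta>s \<equiv> permute_list (inv \<sigma>) (map2 (act2 M) \<beta>s (map inv \<tau>s))"
  shows "composable2 M (act2 M \<alpha> (inv \<sigma>)) \<delta>s"
    and "act2 M (gamma2 M \<alpha> \<beta>s) (inv (block_perm \<sigma> (map (arity2 M) \<beta>s) \<tau>s)) =
      gamma2 M (act2 M \<alpha> (inv \<sigma>)) \<delta>s"
proof -
  let ?\<delta>s = "map2 (act2 M) \<beta>s (map inv \<tau>s)" and ?B = "block_perm \<sigma> (map (arity2 M) \<beta>s) \<tau>s"
  have fgs: "\<alpha> \<in> Cell2 M" "set \<beta>s \<subseteq> Cell2 M" using f by (simp_all add: composable2_def)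
  have dom: "dom2 M \<alpha> \<in> Cell1 M" using fgs cell2_typed by simp
  note inv_\<sigma> = permutes_inv[OF \<sigma>] and inv_\<tau>s = perms_of_inv[OF \<tau>s]
  show comp: "composable2 M (act2 M \<alpha> (inv \<sigma>)) \<delta>s"
    unfolding \<delta>s_def by (intro composable2_permute composable2_map2_act f inv_\<tau>s inv_\<sigma>)
  have "gamma2 M \<alpha> \<beta>s = gamma2 M (act2 M (act2 M \<alpha> (inv \<sigma>)) \<sigma>) (map2 (act2 M) ?\<delta>s \<tau>s)"
    using fgs \<sigma> \<tau>s by (simp only: act2_inv map2_act2_inv)
  also have "\<dots> = act2 M (gamma2 M (act2 M \<alpha> (inv \<sigma>)) \<delta>s) ?B"
    using equivariance2[OF comp[unfolded \<delta>s_def], of \<tau>s] fgs dom \<sigma> inv_\<sigma> \<tau>s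
      map_arity2_act2[OF fgs(2) inv_\<tau>s]
    by (simp only: \<delta>s_def act1 act2 length_permute_list)
  finally have eq: "gamma2 M \<alpha> \<beta>s = act2 M (gamma2 M (act2 M \<alpha> (inv \<sigma>)) \<delta>s) ?B" .
  have "arity2 M (gamma2 M (act2 M \<alpha> (inv \<sigma>)) \<delta>s) = sum_list (map (arity2 M) \<beta>s)"
    unfolding arity_gamma2[OF comp] unfolding \<delta>s_def
    using map_arity2_act2[OF fgs(2) inv_\<tau>s] inv_\<sigma> length_composable2[OF f]
      perms_of_length[OF \<tau>s] sum_list_permute_list[of "inv \<sigma>" "map (arity2 M) \<beta>s"]
    by (simp add: permute_list_map[symmetric] del: map_map)
  then show "act2 M (gamma2 M \<alpha> \<beta>s) (inv ?B) = gamma2 M (act2 M \<alpha> (inv \<sigma>)) \<delta>s"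
    unfolding eq using \<sigma> \<tau>s length_composable2[OF f]
    by (intro act2_inv gamma2 comp) (simp add: block_perm_permutes)
qed

end

section \<open>The multifunctor \<open>\<eta>\<close>\<close>

lemma cat_multifunctorI:
  assumes "cat_multicategory M" "cat_multicategory N"
    and fun0: "\<And>a. a \<in> Ob M \<Longrightarrow> fun0 F a \<in> Ob N"
    and fun1: "\<And>f. f \<in> Cell1 M \<Longrightarrow> fun1 F f \<in> Cell1 N \<and>
      src N (fun1 F f) = map (fun0 F) (src M f) \<and> tgt N (fun1 F f) = fun0 F (tgt M f)"
    and fun2: "\<And>\<alpha>. \<alpha> \<in> Cell2 M \<Longrightarrow> fun2 F \<alpha> \<in> Cell2 N \<and>
      dom2 N (fun2 F \<alpha>) = fun1 F (dom2 M \<alpha>) \<and> cod2 N (fun2 F \<alpha>) = fun1 F (cod2 M \<alpha>)"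
    and fun2_ident: "\<And>f. f \<in> Cell1 M \<Longrightarrow> fun2 F (ident2 M f) = ident2 N (fun1 F f)"
    and fun2_vcomp: "\<And>\<alpha> \<beta>. \<lbrakk>\<alpha> \<in> Cell2 M; \<beta> \<in> Cell2 M; dom2 M \<beta> = cod2 M \<alpha>\<rbrakk> \<Longrightarrow>
      fun2 F (vcomp M \<beta> \<alpha>) = vcomp N (fun2 F \<beta>) (fun2 F \<alpha>)"
    and unit: "\<And>a. a \<in> Ob M \<Longrightarrow> fun1 F (unit1 M a) = unit1 N (fun0 F a)"
    and gamma1: "\<And>f gs. composable1 M f gs \<Longrightarrow>
      fun1 F (gamma1 M f gs) = gamma1 N (fun1 F f) (map (fun1 F) gs)"
    and gamma2: "\<And>\<alpha> \<beta>s. composable2 M \<alpha> \<beta>s \<Longrightarrow>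
      fun2 F (gamma2 M \<alpha> \<beta>s) = gamma2 N (fun2 F \<alpha>) (map (fun2 F) \<beta>s)"
  shows "cat_multifunctor M N F"
proof -
  interpret M: cat_multicategory M by fact
  interpret N: cat_multicategory N by fact
  show ?thesis
  proof (unfold_locales, goal_cases)
    case (2 as b)
    then show ?case
      using M.cell2_typed by (auto simp: cat_functor_def fun1 fun2 fun2_ident fun2_vcomp)
  qed (simp_all add: fun0 unit gamma1 gamma2)
qed

context cat_multifunctor
begin

lemma fun1:
  assumes "f \<in> Cell1 M"
  shows "fun1 F f \<in> Cell1 N" "src N (fun1 F f) = map (fun0 F) (src M f)"
    "tgt N (fun1 F f) = fun0 F (tgt M f)"
  using assms hom_functor[of "src M f" "tgt M f"] by (auto simp: cat_functor_def)

lemma fun2: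
  assumes "\<alpha> \<in> Cell2 M"
  shows "fun2 F \<alpha> \<in> Cell2 N" "dom2 N (fun2 F \<alpha>) = fun1 F (dom2 M \<alpha>)"
    "cod2 N (fun2 F \<alpha>) = fun1 F (cod2 M \<alpha>)"
  using assms hom_functor[of "src M (dom2 M \<alpha>)" "tgt M (dom2 M \<alpha>)"]
  by (auto simp: cat_functor_def)

lemma fun2_ident: "f \<in> Cell1 M \<Longrightarrow> fun2 F (ident2 M f) = ident2 N (fun1 F f)"
  using hom_functor[of "src M f" "tgt M f"] by (auto simp: cat_functor_def)

lemma fun2_vcomp:
  "\<lbrakk>\<alpha> \<in> Cell2 M; \<beta> \<in> Cell2 M; dom2 M \<beta> = cod2 M \<alpha>\<rbrakk> \<Longrightarrow>
    fun2 F (vcomp M \<beta> \<alpha>) = vcomp N (fun2 F \<beta>) (fun2 F \<alpha>)"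
  using hom_functor[of "src M (dom2 M \<alpha>)" "tgt M (dom2 M \<alpha>)"] M.parallel[of \<alpha>]
  by (auto simp: cat_functor_def)

lemma arity_fun1: "f \<in> Cell1 M \<Longrightarrow> arity1 N (fun1 F f) = arity1 M f"
  by (simp add: fun1)

lemma arity_fun2: "\<alpha> \<in> Cell2 M \<Longrightarrow> arity2 N (fun2 F \<alpha>) = arity2 M \<alpha>"
  by (simp add: fun1 fun2 M.cell2_typed)

lemma composable1_map:
  assumes "composable1 M f gs"
  shows "composable1 N (fun1 F f) (map (fun1 F) gs)"
  using assms by (auto simp: composable1_def fun1 subset_eq)

lemma composable2_map:
  assumes "composable2 M \<alpha> \<beta>s"
  shows "composable2 N (fun2 F \<alpha>) (map (fun2 F) \<beta>s)"
  using assms M.cell2_typed by (auto simp: composable2_def fun1 fun2 subset_eq)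

end

lemma eta_simps [simp]:
  "fun0 (eta M) = (\<lambda>a. (a, ()))"
  "fun1 (eta M) = (\<lambda>f. (f, (arity1 M f, id)))"
  "fun2 (eta M) = (\<lambda>\<alpha>. (\<alpha>, ((arity2 M \<alpha>, id), (arity2 M \<alpha>, id))))"
  "sym_iso (eta M) = (\<lambda>\<sigma> f. (ident2 M (act1 M f \<sigma>), ((arity1 M f, id), (arity1 M f, \<sigma>))))"
  by (simp_all add: eta_def)

text \<open>This is the second component of the statement that \<eta> preserves gamma strictly.
  \<open>be_gamma_map_top\<close> and \<open>be_gamma_map_bottom\<close> similarly compute the
  codomain permutations in the axioms \<open>sym_top\<close> and \<open>sym_bottom\<close> for
  \<eta>.\<close>

lemma be_gamma_map_id:
  "be_gamma (n, id) (map (\<lambda>g. (k g, id)) gs) = (sum_list (map k gs), id)"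
  using block_perm_id[of "map k gs"] by (simp add: be_gamma_def comp_def map_replicate_const)

lemma be_gamma_map_top:
  assumes "\<sigma> permutes {..<length gs}"
  shows "be_gamma (n, \<sigma>) (permute_list \<sigma> (map (\<lambda>g. (k g, id :: nat \<Rightarrow> nat)) gs)) =
    (sum_list (map k gs), top_perm \<sigma> (map k gs))"
proof -
  have "map fst (permute_list \<sigma> (map (\<lambda>g. (k g, id :: nat \<Rightarrow> nat)) gs)) = permute_list \<sigma> (map k gs)"
    using assms by (simp add: permute_list_map[symmetric] comp_def)
  moreover have "map snd (permute_list \<sigma> (map (\<lambda>g. (k g, id :: nat \<Rightarrow> nat)) gs)) = replicate (length gs) id"
    using assms by (simp add: permute_list_map comp_def map_replicate_const)
  moreover have "sum_list (permute_list \<sigma> (map k gs)) = sum_list (map k gs)"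
    using assms by (simp add: sum_list_permute_list)
  ultimately show ?thesis by (simp add: be_gamma_def top_perm_def)
qed

lemma be_gamma_map_bottom:
  assumes "length \<tau>s = length gs"
  shows "be_gamma (n, id) (map2 (\<lambda>\<tau> g. (k g, \<tau>)) \<tau>s gs) =
    (sum_list (map k gs), bottom_perm (map k gs) \<tau>s)"
proof -
  have "map fst (map2 (\<lambda>\<tau> g. (k g, \<tau>)) \<tau>s gs) = map k gs" "map snd (map2 (\<lambda>\<tau> g. (k g, \<tau>)) \<tau>s gs) = \<tau>s"
    using assms by (auto intro: nth_equalityI)
  then show ?thesis by (simp only: be_gamma_def bottom_perm_def fst_conv snd_conv)
qed

context cat_multicategory
begin

lemma cat_multifunctor_eta: "cat_multifunctor M (times_be M) (eta M)"
proof (rule cat_multifunctorI, goal_cases)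
  case (8 a)
  then show ?case by (simp add: unit1)
next
  case (9 f gs)
  then show ?case by (simp add: comp_def be_gamma_map_id arity_gamma1)
next
  case (10 \<alpha> \<beta>s)
  then show ?case by (simp add: comp_def be_gamma_map_id arity_gamma2)
qed (use cell2_typed in \<open>auto simp: cat_multicategory_prod cat_multicategory_axioms
  cat_multicategory_barratt_eccles parallel ident2 vcomp permutes_id zip_replicate2\<close>)

text \<open>Each symmetry isomorphism of \<eta> pairs an identity of \<open>M\<close> with an arrow
  of E\<Sigma>. In the first component \<open>sym_top\<close> and \<open>sym_bottom\<close> follow
  from equivariance and preservation of identities by gamma. In the second, an arrow is determined
  by its ends, so only permutations are compared.\<close>

theorem pseudo_symmetric_eta: "pseudo_symmetric_multifunctor M (times_be M) (eta M)"
proof -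
  interpret eta: cat_multifunctor M "times_be M" "eta M" by (rule cat_multifunctor_eta)
  show ?thesis
  proof (unfold_locales, goal_cases)
    case (1 \<sigma> as b)
    \<comment> \<open>The inverse is the same identity of \<open>M\<close> paired with the reversed
      arrow, from \<sigma> back to \<open>id\<close>.\<close>
    have "iso_arr (hom_cat (times_be M) (permute_list \<sigma> (map (fun0 (eta M)) as)) (fun0 (eta M) b))
        (sym_iso (eta M) \<sigma> f)" if "f \<in> Cell1 M" "src M f = as" "tgt M f = b" for f
      unfolding iso_arr_def using that 1
      by (intro conjI bexI[where x = "(ident2 M (act1 M f \<sigma>), ((arity1 M f, \<sigma>), (arity1 M f, id)))"])
        (auto simp: ident2 act1 permutes_id permute_list_map zip_replicate2 vcomp_ident2)
    moreover have "vcomp M (act2 M \<alpha> \<sigma>) (ident2 M (act1 M (dom2 M \<alpha>) \<sigma>)) =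
        vcomp M (ident2 M (act1 M (cod2 M \<alpha>) \<sigma>)) (act2 M \<alpha> \<sigma>)"
      if "\<alpha> \<in> Cell2 M" "src M (dom2 M \<alpha>) = as" for \<alpha>
      using vcomp_ident[of "act2 M \<alpha> \<sigma>"] that 1 by (simp add: act2)
    ultimately show ?case
      using 1 cell2_typed parallel
      by (auto simp: natural_iso_def ident2 act1 act2 be_act_def)
  next
    case (2 f)
    then show ?case by (simp add: act1_id)
  next
    case (3 f \<sigma> \<tau>)
    then show ?case
      by (simp add: vcomp_ident2 act1 act2 act2_ident be_act_def act1_act1 ident2 permutes_compose)
  next
    case (4 f gs \<sigma>)
    have \<sigma>: "\<sigma> permutes {..<length gs}" using 4 length_composable1[OF 4(1)] by simp
    let ?zs = "permute_list \<sigma> (map (\<lambda>g. ident2 (times_be M) (fun1 (eta M) g)) gs)"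
    have "gamma2 M (ident2 M (act1 M f \<sigma>)) (map fst ?zs) =
        ident2 M (act1 M (gamma1 M f gs) (top_perm \<sigma> (map (arity1 M) gs)))"
      using \<sigma> gamma2_ident[OF composable1_permute[OF 4]] top_equivariance1[OF 4]
      by (simp add: permute_list_map[symmetric] comp_def)
    moreover have "map fst (map snd ?zs) =
        map (\<lambda>g. (arity1 M g, id)) (permute_list \<sigma> gs)"
      using \<sigma> by (simp add: permute_list_map comp_def)
    moreover have "map snd (map snd ?zs) =
        permute_list \<sigma> (map (\<lambda>g. (arity1 M g, id)) gs)"
      using \<sigma> by (simp add: permute_list_map comp_def)
    moreover have "sum_list (map (arity1 M) (permute_list \<sigma> gs)) = sum_list (map (arity1 M) gs)"
      using \<sigma> sum_list_permute_list[of \<sigma> "map (arity1 M) gs"] by (simp add: permute_list_map)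
    ultimately show ?case
      using \<sigma>
      by (simp only: eta_simps multicat_prod_simps barratt_eccles_simps fst_conv snd_conv
          be_gamma_map_id be_gamma_map_top arity_gamma1[OF 4(1)])
  next
    case (5 f gs \<tau>s)
    have len: "length \<tau>s = length gs" using perms_of_length[OF 5(2)] by simp
    let ?zs = "map2 (sym_iso (eta M)) \<tau>s gs"
    have "map fst ?zs = map (ident2 M) (map2 (act1 M) gs \<tau>s)"
      "map fst (map snd ?zs) = map (\<lambda>g. (arity1 M g, id)) gs"
      "map snd (map snd ?zs) = map2 (\<lambda>\<tau> g. (arity1 M g, \<tau>)) \<tau>s gs"
      using len by (auto intro: nth_equalityI)
    then show ?case
      using gamma2_ident[OF composable1_map2_act[OF 5]] bottom_equivariance1[OF 5] len
      by (simp only: eta_simps multicat_prod_simps barratt_eccles_simps fst_conv snd_conv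
          be_gamma_map_id be_gamma_map_bottom arity_gamma1[OF 5(1)])
  qed
qed

end

section \<open>The universal property\<close>

context pseudo_symmetric_multifunctor
begin

section \<open>Symmetry isomorphisms at block permutations\<close>

lemma sym_iso:
  assumes "f \<in> Cell1 M" "\<sigma> permutes {..<arity1 M f}"
  shows "sym_iso F \<sigma> f \<in> Cell2 N" "dom2 N (sym_iso F \<sigma> f) = fun1 F (act1 M f \<sigma>)"
    "cod2 N (sym_iso F \<sigma> f) = act1 N (fun1 F f) \<sigma>"
  using assms sym_natural_iso[of \<sigma> "src M f" "tgt M f"] by (auto simp: natural_iso_def iso_arr_def)

lemma sym_natural:
  assumes "\<alpha> \<in> Cell2 M" "\<sigma> permutes {..<arity2 M \<alpha>}"
  shows "vcomp N (act2 N (fun2 F \<alpha>) \<sigma>) (sym_iso F \<sigma> (dom2 M \<alpha>)) =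
    vcomp N (sym_iso F \<sigma> (cod2 M \<alpha>)) (fun2 F (act2 M \<alpha> \<sigma>))"
  using assms sym_natural_iso[of \<sigma> "src M (dom2 M \<alpha>)" "tgt M (dom2 M \<alpha>)"]
  by (auto simp: natural_iso_def)

text \<open>The inputs of the symmetry isomorphism at \<open>\<rho>\<close> and \<open>f\<close> are
  those of F applied to \<open>act1 M f \<rho>\<close>, in whose order \<open>gs\<close> is listed,
  and the isomorphism at an entry of \<open>gs\<close> keeps its output.\<close>

lemma composable2_sym_iso:
  assumes f: "composable1 M f (permute_list (inv \<rho>) gs)" and \<rho>: "\<rho> permutes {..<arity1 M f}"
    and \<rho>s: "perms_of (map (arity1 M) gs) \<rho>s"
  shows "composable2 N (sym_iso F \<rho> f) (map2 (sym_iso F) \<rho>s gs)"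
proof -
  have fc: "f \<in> Cell1 M" using f by (simp add: composable1_def)
  have \<rho>': "\<rho> permutes {..<length gs}" using \<rho> M.length_composable1[OF f] by simp
  have gs: "set gs \<subseteq> Cell1 M"
    using f permutes_inv[OF \<rho>'] by (simp add: composable1_def)
  have "permute_list \<rho> (src M f) = map (tgt M) (permute_list \<rho> (permute_list (inv \<rho>) gs))"
    using f \<rho>' by (simp add: composable1_def permute_list_map)
  then have src: "src N (dom2 N (sym_iso F \<rho> f)) = map (fun0 F) (map (tgt M) gs)"
    using fc \<rho> \<rho>' by (simp add: sym_iso M.act1 fun1 permute_list_inv_cancel)
  have cells: "sym_iso F (\<rho>s ! i) (gs ! i) \<in> Cell2 N \<and>
      tgt N (dom2 N (sym_iso F (\<rho>s ! i) (gs ! i))) = fun0 F (tgt M (gs ! i))" if "i < length gs" for i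
    using that gs perms_of_nth[OF \<rho>s, of i] by (simp add: sym_iso M.act1 fun1 subset_code(1))
  then show ?thesis
    using perms_of_length[OF \<rho>s] sym_iso(1)[OF fc \<rho>] src
    by (auto simp: composable2_def in_set_conv_nth list_eq_iff_nth_eq)
qed

text \<open>Factor the block permutation as T \<circ> B, top after bottom, and apply
  \<open>sym_comp\<close>. The T-part is gamma of the isomorphism at \<rho> with identities, by
  \<open>sym_top\<close>; the B-part is gamma of an identity with the isomorphisms at
  \<open>\<rho>s\<close>, by \<open>sym_bottom\<close>. Interchange multiplies the two entry by
  entry, and in every entry one factor is an identity.\<close>

lemma sym_block:
  assumes f: "composable1 M f (permute_list (inv \<rho>) gs)" and \<rho>: "\<rho> permutes {..<arity1 M f}"
    and \<rho>s: "perms_of (map (arity1 M) gs) \<rho>s"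
  shows "sym_iso F (block_perm \<rho> (map (arity1 M) gs) \<rho>s) (gamma1 M f (permute_list (inv \<rho>) gs)) =
    gamma2 N (sym_iso F \<rho> f) (map2 (sym_iso F) \<rho>s gs)"
proof -
  let ?ks = "map (arity1 M) gs" and ?hs = "permute_list (inv \<rho>) gs"
  let ?T = "top_perm \<rho> (permute_list (inv \<rho>) ?ks)" and ?B = "bottom_perm ?ks \<rho>s"
  let ?X = "gamma1 M f ?hs" and ?ids = "map (\<lambda>g. ident2 N (fun1 F g)) gs"
  have fc: "f \<in> Cell1 M" using f by (simp add: composable1_def)
  have \<rho>': "\<rho> permutes {..<length gs}" using \<rho> M.length_composable1[OF f] by simp
  note inv_\<rho> = permutes_inv[OF \<rho>']
  have gs: "set gs \<subseteq> Cell1 M" using f inv_\<rho> by (simp add: composable1_def)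
  have cancel: "permute_list \<rho> ?hs = gs" using \<rho>' by (rule permute_list_inv_cancel)
  have ks: "map (arity1 M) ?hs = permute_list (inv \<rho>) ?ks" using inv_\<rho> by (simp add: permute_list_map)
  have arity: "arity1 M ?X = sum_list ?ks"
    unfolding M.arity_gamma1[OF f] ks using inv_\<rho> by (intro sum_list_permute_list) simp
  have T: "?T permutes {..<arity1 M ?X}" and B: "?B permutes {..<arity1 M ?X}"
    using top_perm_permutes[of \<rho> "permute_list (inv \<rho>) ?ks"] bottom_perm_permutes[OF \<rho>s] \<rho>'
      sum_list_permute_list[of "inv \<rho>" ?ks] inv_\<rho>
    unfolding arity by (simp_all only: length_map length_permute_list)
  have comp: "composable1 M (act1 M f \<rho>) gs"
    using M.composable1_permute[OF f \<rho>] cancel by simp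
  have sym_T: "sym_iso F ?T ?X = gamma2 N (sym_iso F \<rho> f) ?ids"
    using sym_top[OF f \<rho>] inv_\<rho> cancel \<rho>' unfolding ks by (simp add: permute_list_map)
  have X_T: "act1 M ?X ?T = gamma1 M (act1 M f \<rho>) gs"
    using M.top_equivariance1[OF f \<rho>] cancel unfolding ks by simp
  have ids: "composable2 N (sym_iso F \<rho> f) ?ids"
    using N.composable_ident2[OF composable1_map[OF comp]] fc \<rho> gs sym_iso[OF fc \<rho>]
    by (auto simp: composable2_def N.ident2 M.act1 fun1 comp_def)
  have arity_list: "map (arity2 N) ?ids = ?ks"
    using gs by (auto simp: N.ident2 fun1)
  \<comment> \<open>By bottom equivariance the action of B on the T-part falls on its identity
    entries, where it gives identities of the permuted 1-cells.\<close>
  have act_ids: "map2 (act2 N) ?ids \<rho>s = map2 (\<lambda>g \<tau>. ident2 N (act1 N (fun1 F g) \<tau>)) gs \<rho>s"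
  proof (rule nth_equalityI)
    fix i assume i: "i < length (map2 (act2 N) ?ids \<rho>s)"
    then have "gs ! i \<in> Cell1 M" using gs by (simp add: subset_code(1))
    then show "map2 (act2 N) ?ids \<rho>s ! i = map2 (\<lambda>g \<tau>. ident2 N (act1 N (fun1 F g) \<tau>)) gs \<rho>s ! i"
      using i perms_of_nth[OF \<rho>s, of i] by (simp add: N.act2_ident fun1)
  qed simp
  let ?acts = "map2 (\<lambda>g \<tau>. ident2 N (act1 N (fun1 F g) \<tau>)) gs \<rho>s"
  have comp_acts: "composable2 N (sym_iso F \<rho> f) ?acts"
    using N.composable2_map2_act[OF ids, of \<rho>s] \<rho>s unfolding arity_list act_ids by simp
  have syms: "composable2 N (ident2 N (fun1 F (act1 M f \<rho>))) (map2 (sym_iso F) \<rho>s gs)"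
    using composable2_sym_iso[OF f \<rho> \<rho>s] fc \<rho>
    by (simp add: composable2_def N.ident2 M.act1 fun1 sym_iso)
  have nth: "gs ! i \<in> Cell1 M" "\<rho>s ! i permutes {..<arity1 M (gs ! i)}" if "i < length gs" for i
    using that gs perms_of_nth[OF \<rho>s, of i] by (simp_all add: subset_code(1))
  have len: "length \<rho>s = length gs" using perms_of_length[OF \<rho>s] by simp
  have "sym_iso F (block_perm \<rho> ?ks \<rho>s) ?X = sym_iso F (?T \<circ> ?B) ?X"
    using top_perm_comp_bottom_perm[of \<rho> ?ks \<rho>s] \<rho>' \<rho>s by simp
  also have "\<dots> = vcomp N (act2 N (sym_iso F ?T ?X) ?B) (sym_iso F ?B (act1 M ?X ?T))"
    using M.gamma1(1)[OF f] T B by (rule sym_comp)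
  also have "act2 N (sym_iso F ?T ?X) ?B = gamma2 N (sym_iso F \<rho> f) ?acts"
    unfolding sym_T act_ids[symmetric] using N.bottom_equivariance2[OF ids, of \<rho>s] \<rho>s
    unfolding arity_list by simp
  also have "sym_iso F ?B (act1 M ?X ?T) =
      gamma2 N (ident2 N (fun1 F (act1 M f \<rho>))) (map2 (sym_iso F) \<rho>s gs)"
    unfolding X_T using comp \<rho>s by (rule sym_bottom)
  \<comment> \<open>Interchange: the outer cells and the inner lists are composed
    separately.\<close>
  also have "vcomp N (gamma2 N (sym_iso F \<rho> f) ?acts) \<dots> =
      gamma2 N (vcomp N (sym_iso F \<rho> f) (ident2 N (fun1 F (act1 M f \<rho>))))
        (map2 (vcomp N) ?acts (map2 (sym_iso F) \<rho>s gs))"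
  proof (rule N.gamma2_vcomp[OF syms comp_acts, symmetric])
    show "dom2 N (sym_iso F \<rho> f) = cod2 N (ident2 N (fun1 F (act1 M f \<rho>)))"
      using fc \<rho> by (simp add: sym_iso N.ident2 M.act1 fun1)
    show "map (dom2 N) ?acts = map (cod2 N) (map2 (sym_iso F) \<rho>s gs)"
      using nth len by (auto simp: sym_iso N.ident2 N.act1 fun1 intro!: nth_equalityI)
  qed
  also have "vcomp N (sym_iso F \<rho> f) (ident2 N (fun1 F (act1 M f \<rho>))) = sym_iso F \<rho> f"
    using N.vcomp_ident(2)[OF sym_iso(1)[OF fc \<rho>]] by (simp add: sym_iso[OF fc \<rho>])
  also have "map2 (vcomp N) ?acts (map2 (sym_iso F) \<rho>s gs) = map2 (sym_iso F) \<rho>s gs"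
  proof (rule nth_equalityI)
    fix i assume "i < length (map2 (vcomp N) ?acts (map2 (sym_iso F) \<rho>s gs))"
    then have i: "i < length gs" by simp
    show "map2 (vcomp N) ?acts (map2 (sym_iso F) \<rho>s gs) ! i = map2 (sym_iso F) \<rho>s gs ! i"
      using i len N.vcomp_ident(1)[OF sym_iso(1)[OF nth[OF i]]] by (simp add: sym_iso[OF nth[OF i]])
  qed (use len in simp)
  finally show ?thesis .
qed

text \<open>This is \<open>F\<^bsub>\<kappa>;h\<^esub> \<circ> F(\<alpha>\<sigma>\<^sup>-\<^sup>1)\<close> with \<open>\<kappa> = \<tau>\<sigma>\<^sup>-\<^sup>1\<close> and \<open>h = g\<tau>\<^sup>-\<^sup>1\<close> for \<open>\<alpha>: f \<rightarrow> g\<close>: the value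
  of the induced multifunctor at \<open>(\<alpha>, \<sigma> \<rightarrow> \<tau>)\<close> before acting by \<open>\<sigma>\<close>.\<close>

definition twist :: "'d \<Rightarrow> (nat \<Rightarrow> nat) \<Rightarrow> (nat \<Rightarrow> nat) \<Rightarrow> 'g" where
  "twist \<alpha> \<sigma> \<tau> =
    vcomp N (sym_iso F (\<tau> \<circ> inv \<sigma>) (act1 M (cod2 M \<alpha>) (inv \<tau>))) (fun2 F (act2 M \<alpha> (inv \<sigma>)))"

text \<open>The factors are composable because \<open>(\<tau> \<circ> inv \<sigma>)\<close> acting
  after \<open>inv \<tau>\<close> amounts to \<open>inv \<sigma>\<close>: both meet at F of
  \<open>act1 M (cod2 M \<alpha>) (inv \<sigma>)\<close>.\<close>

lemma twist_factors:
  assumes "\<alpha> \<in> Cell2 M" "\<sigma> permutes {..<arity2 M \<alpha>}" "\<tau> permutes {..<arity2 M \<alpha>}"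
  shows "sym_iso F (\<tau> \<circ> inv \<sigma>) (act1 M (cod2 M \<alpha>) (inv \<tau>)) \<in> Cell2 N"
    "dom2 N (sym_iso F (\<tau> \<circ> inv \<sigma>) (act1 M (cod2 M \<alpha>) (inv \<tau>))) = fun1 F (act1 M (cod2 M \<alpha>) (inv \<sigma>))"
    "cod2 N (sym_iso F (\<tau> \<circ> inv \<sigma>) (act1 M (cod2 M \<alpha>) (inv \<tau>))) =
      act1 N (fun1 F (act1 M (cod2 M \<alpha>) (inv \<tau>))) (\<tau> \<circ> inv \<sigma>)"
    "fun2 F (act2 M \<alpha> (inv \<sigma>)) \<in> Cell2 N"
    "dom2 N (fun2 F (act2 M \<alpha> (inv \<sigma>))) = fun1 F (act1 M (dom2 M \<alpha>) (inv \<sigma>))"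
    "cod2 N (fun2 F (act2 M \<alpha> (inv \<sigma>))) = fun1 F (act1 M (cod2 M \<alpha>) (inv \<sigma>))"
  using assms M.cell2_typed M.parallel
  by (simp_all add: sym_iso fun1 fun2 M.act1 M.act2 M.act1_act1 permutes_inv permutes_compose permutes_cancel)

lemma twist:
  assumes "\<alpha> \<in> Cell2 M" "\<sigma> permutes {..<arity2 M \<alpha>}" "\<tau> permutes {..<arity2 M \<alpha>}"
  shows "twist \<alpha> \<sigma> \<tau> \<in> Cell2 N"
    "dom2 N (twist \<alpha> \<sigma> \<tau>) = fun1 F (act1 M (dom2 M \<alpha>) (inv \<sigma>))"
    "cod2 N (twist \<alpha> \<sigma> \<tau>) = act1 N (fun1 F (act1 M (cod2 M \<alpha>) (inv \<tau>))) (\<tau> \<circ> inv \<sigma>)"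
  unfolding twist_def using twist_factors[OF assms] by (simp_all add: N.vcomp)

lemma twist_ident:
  assumes "f \<in> Cell1 M" "\<sigma> permutes {..<arity1 M f}"
  shows "twist (ident2 M f) \<sigma> \<sigma> = ident2 N (fun1 F (act1 M f (inv \<sigma>)))"
  using assms permutes_inv_o[OF assms(2)]
  by (simp add: twist_def M.ident2 M.act2_ident M.act1 sym_id fun2_ident permutes_inv N.vcomp_ident2 fun1)

text \<open>With \<kappa> = \<open>\<tau> \<circ> inv \<sigma>\<close>, the left factor must be
  acted on by \<kappa> to start where \<open>twist \<alpha> \<sigma> \<tau>\<close> ends. Of the
  resulting four factors A, B, C, D, naturality of the isomorphism at \<kappa> exchanges the middle
  two into C' and B'. Then \<open>sym_comp\<close> merges A with C' into the isomorphism at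
  \<open>\<rho> \<circ> inv \<sigma>\<close>, and functoriality merges B' with D.\<close>

lemma twist_vcomp:
  assumes \<alpha>: "\<alpha> \<in> Cell2 M" and \<beta>: "\<beta> \<in> Cell2 M" and dom: "dom2 M \<beta> = cod2 M \<alpha>"
    and \<sigma>: "\<sigma> permutes {..<arity2 M \<alpha>}" and \<tau>: "\<tau> permutes {..<arity2 M \<alpha>}"
    and \<rho>: "\<rho> permutes {..<arity2 M \<alpha>}"
  shows "twist (vcomp M \<beta> \<alpha>) \<sigma> \<rho> = vcomp N (act2 N (twist \<beta> \<tau> \<rho>) (\<tau> \<circ> inv \<sigma>)) (twist \<alpha> \<sigma> \<tau>)"
proof -
  let ?\<kappa> = "\<tau> \<circ> inv \<sigma>" and ?h = "act1 M (cod2 M \<beta>) (inv \<rho>)" and ?\<beta> = "act2 M \<beta> (inv \<tau>)"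
  let ?A = "act2 N (sym_iso F (\<rho> \<circ> inv \<tau>) ?h) ?\<kappa>" and ?B = "act2 N (fun2 F ?\<beta>) ?\<kappa>"
  let ?C = "sym_iso F ?\<kappa> (act1 M (cod2 M \<alpha>) (inv \<tau>))" and ?D = "fun2 F (act2 M \<alpha> (inv \<sigma>))"
  let ?C' = "sym_iso F ?\<kappa> (act1 M (cod2 M \<beta>) (inv \<tau>))" and ?B' = "fun2 F (act2 M \<beta> (inv \<sigma>))"
  have arity: "arity2 M \<beta> = arity2 M \<alpha>" using \<alpha> dom M.parallel by simp
  note \<sigma>\<beta> = \<sigma>[folded arity] and \<tau>\<beta> = \<tau>[folded arity] and \<rho>\<beta> = \<rho>[folded arity]
  note invs = permutes_inv[OF \<sigma>] permutes_inv[OF \<tau>] permutes_inv[OF \<rho>]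
    permutes_inv[OF \<sigma>\<beta>] permutes_inv[OF \<tau>\<beta>] permutes_inv[OF \<rho>\<beta>]
  have \<kappa>: "?\<kappa> permutes {..<arity2 M \<alpha>}" using \<tau> invs by (intro permutes_compose)
  note \<kappa>\<beta> = \<kappa>[folded arity]
  have cells: "cod2 M \<beta> \<in> Cell1 M" "cod2 M \<alpha> \<in> Cell1 M" "dom2 M \<beta> \<in> Cell1 M"
    "arity1 M (cod2 M \<beta>) = arity2 M \<beta>" "arity1 M (cod2 M \<alpha>) = arity2 M \<alpha>"
    using \<alpha> \<beta> M.cell2_typed M.parallel by simp_all
  note facs = twist_factors[OF \<beta> \<tau>\<beta> \<rho>\<beta>] twist_factors[OF \<alpha> \<sigma> \<tau>] twist_factors[OF \<beta> \<sigma>\<beta> \<tau>\<beta>]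
  have ar: "arity2 N (sym_iso F (\<rho> \<circ> inv \<tau>) ?h) = arity2 M \<beta>" "arity2 N (fun2 F ?\<beta>) = arity2 M \<beta>"
    using facs cells \<beta> invs M.cell2_typed by (simp_all add: fun1 M.act1)
  have B_dom: "act1 N (fun1 F (act1 M (dom2 M \<beta>) (inv \<tau>))) ?\<kappa> = cod2 N ?C"
    using facs dom by simp
  have A: "?A \<in> Cell2 N" "dom2 N ?A = act1 N (fun1 F (act1 M (cod2 M \<beta>) (inv \<tau>))) ?\<kappa>"
    using facs \<kappa>\<beta> ar by (simp_all add: N.act2)
  have B: "?B \<in> Cell2 N" "dom2 N ?B = cod2 N ?C" "cod2 N ?B = dom2 N ?A"
    using facs \<kappa>\<beta> ar A B_dom by (simp_all add: N.act2)
  have act_\<beta>: "act2 M ?\<beta> ?\<kappa> = act2 M \<beta> (inv \<sigma>)"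
    using \<beta> \<tau>\<beta> \<kappa>\<beta> invs by (simp add: M.act2_act2 permutes_cancel)
  have "arity2 M ?\<beta> = arity2 M \<beta>" using \<beta> invs cells by (simp add: M.act2 M.act1)
  then have nat: "vcomp N ?B ?C = vcomp N ?C' ?B'"
    using sym_natural[of ?\<beta> ?\<kappa>] \<beta> \<kappa>\<beta> invs by (simp add: M.act2 act_\<beta> dom)
  have "act1 M ?h (\<rho> \<circ> inv \<tau>) = act1 M (cod2 M \<beta>) (inv \<tau>)"
    using cells \<rho>\<beta> \<tau>\<beta> invs by (simp add: M.act1_act1 permutes_cancel permutes_compose)
  moreover have "\<rho> \<circ> inv \<tau> \<circ> ?\<kappa> = \<rho> \<circ> inv \<sigma>"
    using \<tau> by (simp add: comp_assoc permutes_cancel)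
  moreover have "arity1 M ?h = arity2 M \<beta>" using cells invs by (simp add: M.act1)
  ultimately have comp: "sym_iso F (\<rho> \<circ> inv \<sigma>) ?h = vcomp N ?A ?C'"
    using sym_comp[of ?h "\<rho> \<circ> inv \<tau>" ?\<kappa>] cells \<rho>\<beta> \<kappa>\<beta> invs by (simp add: M.act1 permutes_compose)
  have "vcomp N (act2 N (twist \<beta> \<tau> \<rho>) ?\<kappa>) (twist \<alpha> \<sigma> \<tau>) = vcomp N (vcomp N ?A ?B) (vcomp N ?C ?D)"
    using facs \<kappa>\<beta> ar by (simp add: twist_def N.act2_vcomp)
  also have "\<dots> = vcomp N ?A (vcomp N (vcomp N ?B ?C) ?D)"
    using A B facs by (simp add: N.vcomp_assoc N.vcomp)
  also have "\<dots> = vcomp N (vcomp N ?A ?C') (vcomp N ?B' ?D)"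
    unfolding nat using A B facs dom by (simp add: N.vcomp_assoc N.vcomp)
  also have "vcomp N ?B' ?D = fun2 F (act2 M (vcomp M \<beta> \<alpha>) (inv \<sigma>))"
    using \<alpha> \<beta> dom invs \<sigma> by (simp add: M.act2_vcomp fun2_vcomp M.act2)
  also have "vcomp N (vcomp N ?A ?C') \<dots> = twist (vcomp M \<beta> \<alpha>) \<sigma> \<rho>"
    unfolding comp[symmetric] using \<alpha> \<beta> dom by (simp add: twist_def M.vcomp)
  finally show ?thesis by (rule sym)
qed

text \<open>The formula involves only \<open>\<tau> \<circ> inv \<sigma>\<close> and the cells acted
  on by \<open>inv \<sigma>\<close> and \<open>inv \<tau>\<close>, all unchanged under simultaneous
  translation by \<rho>. This makes \<phi>(F) strictly equivariant on 2-cells.\<close>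

lemma twist_act:
  assumes "\<alpha> \<in> Cell2 M" "\<sigma> permutes {..<arity2 M \<alpha>}" "\<tau> permutes {..<arity2 M \<alpha>}"
    "\<rho> permutes {..<arity2 M \<alpha>}"
  shows "twist (act2 M \<alpha> \<rho>) (\<sigma> \<circ> \<rho>) (\<tau> \<circ> \<rho>) = twist \<alpha> \<sigma> \<tau>"
proof -
  have inv: "inv (\<sigma> \<circ> \<rho>) = inv \<rho> \<circ> inv \<sigma>" "inv (\<tau> \<circ> \<rho>) = inv \<rho> \<circ> inv \<tau>"
    using assms by (simp_all add: o_inv_distrib permutes_bij)
  have "\<tau> \<circ> \<rho> \<circ> (inv \<rho> \<circ> inv \<sigma>) = \<tau> \<circ> inv \<sigma>"
    using assms(4) by (simp add: comp_assoc permutes_cancel)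
  then show ?thesis
    using assms M.cell2_typed M.parallel
    by (simp add: twist_def inv M.act2 M.act2_act2 M.act1_act1 permutes_inv permutes_compose permutes_cancel)
qed

text \<open>Before the outer action, the twist of a composite splits by \<open>sym_block\<close> and
  \<open>untwist2\<close> into gamma of symmetry isomorphisms after gamma of F-images. Interchange
  turns this into gamma of the separate twists, listed in the order moved by
  \<open>inv \<sigma>\<close>. The actions by \<sigma> and \<open>\<tau>s\<close> are then collected
  by \<open>equivariance2\<close>.\<close>

lemma twist_gamma:
  fixes \<alpha> \<beta>s \<sigma> \<sigma>' \<tau>s \<tau>s'
  defines "ks \<equiv> map (arity2 M) \<beta>s"
  defines "twists \<equiv> map2 (\<lambda>\<beta> (\<tau>, \<tau>'). twist \<beta> \<tau> \<tau>') \<beta>s (zip \<tau>s \<tau>s')"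
  assumes \<alpha>: "composable2 M \<alpha> \<beta>s"
    and \<sigma>: "\<sigma> permutes {..<arity2 M \<alpha>}" and \<sigma>': "\<sigma>' permutes {..<arity2 M \<alpha>}"
    and \<tau>s: "perms_of ks \<tau>s" and \<tau>s': "perms_of ks \<tau>s'"
  shows "gamma2 N (act2 N (twist \<alpha> \<sigma> \<sigma>') \<sigma>) (map2 (act2 N) twists \<tau>s) =
    act2 N (twist (gamma2 M \<alpha> \<beta>s) (block_perm \<sigma> ks \<tau>s) (block_perm \<sigma>' ks \<tau>s')) (block_perm \<sigma> ks \<tau>s)"
proof -
  let ?B = "block_perm \<sigma> ks \<tau>s" and ?B' = "block_perm \<sigma>' ks \<tau>s'"
  \<comment> \<open>The discrepancies between codomain and domain permutations, outside and in each
    block; they are the permutations at which the symmetry isomorphisms of the twists are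
    taken.\<close>
  let ?\<rho> = "\<sigma>' \<circ> inv \<sigma>" and ?\<rho>s = "map2 (\<circ>) \<tau>s' (map inv \<tau>s)"
  let ?f = "act1 M (cod2 M \<alpha>) (inv \<sigma>')" and ?gs = "map2 (act1 M) (map (cod2 M) \<beta>s) (map inv \<tau>s')"
  let ?\<alpha> = "act2 M \<alpha> (inv \<sigma>)" and ?\<beta>s = "map2 (act2 M) \<beta>s (map inv \<tau>s)"
  let ?P = "\<lambda>xs. permute_list (inv \<sigma>) xs"
  have cells: "\<alpha> \<in> Cell2 M" "set \<beta>s \<subseteq> Cell2 M" using \<alpha> by (simp_all add: composable2_def)
  have cod: "cod2 M \<alpha> \<in> Cell1 M" "arity1 M (cod2 M \<alpha>) = arity2 M \<alpha>"
    using cells M.cell2_typed M.parallel by simp_all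
  have n: "arity2 M \<alpha> = length \<beta>s" using M.length_composable2[OF \<alpha>] by simp
  have len: "length \<tau>s = length \<beta>s" "length \<tau>s' = length \<beta>s"
    using perms_of_length[OF \<tau>s] perms_of_length[OF \<tau>s'] by (simp_all add: ks_def)
  have nth: "\<beta>s ! i \<in> Cell2 M" "\<tau>s ! i permutes {..<arity2 M (\<beta>s ! i)}"
    "\<tau>s' ! i permutes {..<arity2 M (\<beta>s ! i)}" if "i < length \<beta>s" for i
    using that cells perms_of_nth[OF \<tau>s, of i] perms_of_nth[OF \<tau>s', of i]
    by (simp_all add: ks_def subset_code(1))
  note inv_\<sigma> = permutes_inv[OF \<sigma>] and inv_\<sigma>' = permutes_inv[OF \<sigma>']
  have inv_\<sigma>n: "inv \<sigma> permutes {..<length \<beta>s}" using inv_\<sigma> n by simp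
  have \<rho>: "?\<rho> permutes {..<arity2 M \<alpha>}" using \<sigma>' inv_\<sigma> by (intro permutes_compose)
  have \<rho>s: "perms_of ks ?\<rho>s" using \<tau>s \<tau>s' by (intro perms_of_comp perms_of_inv)
  have ks: "map (arity1 M) (map (cod2 M) \<beta>s) = ks"
    using cells M.parallel by (auto simp: ks_def)
  have ks_gs: "map (arity1 M) ?gs = ks"
    using M.map_arity1_act1[of "map (cod2 M) \<beta>s" "map inv \<tau>s'"] cells M.cell2_typed perms_of_inv[OF \<tau>s']
    unfolding ks by auto
  have B: "?B permutes {..<sum_list ks}"
    using \<sigma> \<tau>s n by (intro block_perm_permutes) (simp_all add: ks_def)
  have arity_nth: "arity2 N (twist (\<beta>s ! i) (\<tau>s ! i) (\<tau>s' ! i)) = arity2 M (\<beta>s ! i)"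
    if "i < length \<beta>s" for i
    using nth[OF that] M.cell2_typed by (simp add: twist fun1 M.act1 permutes_inv)
  have arity_list: "map (arity2 N) twists = ks"
    using len arity_nth by (auto simp: twists_def ks_def intro!: nth_equalityI)
  \<comment> \<open>\<open>untwist1\<close> lists codomain cells moved by
    \<open>inv \<sigma>'\<close>, while the domain side is moved by \<open>inv \<sigma>\<close>.
    Moving further by \<open>inv ?\<rho>\<close> reconciles the two orders.\<close>
  have inv_comp: "permute_list (inv ?\<rho>) (?P xs) = permute_list (inv \<sigma>') xs"
    if "length xs = length \<beta>s" for xs :: "'x list"
  proof -
    have "inv \<sigma> \<circ> inv ?\<rho> = inv \<sigma>'"
      using \<sigma> \<sigma>' inv_\<sigma> by (simp add: o_inv_distrib permutes_bij inv_inv_eq permutes_cancel)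
    then show ?thesis
      using \<rho> that n permute_list_compose[OF permutes_inv[of ?\<rho> "{..<length xs}"], of "inv \<sigma>"]
      by simp
  qed
  have untwist1: "composable1 M ?f (permute_list (inv \<sigma>') ?gs)"
    "act1 M (gamma1 M (cod2 M \<alpha>) (map (cod2 M) \<beta>s)) (inv ?B') = gamma1 M ?f (permute_list (inv \<sigma>') ?gs)"
    using M.untwist1[OF M.composable_cod2[OF \<alpha>], of \<sigma>' \<tau>s'] \<sigma>' \<tau>s' cod unfolding ks by simp_all
  have untwist2: "composable2 M ?\<alpha> (?P ?\<beta>s)"
    "act2 M (gamma2 M \<alpha> \<beta>s) (inv ?B) = gamma2 M ?\<alpha> (?P ?\<beta>s)"
    using M.untwist2[OF \<alpha> \<sigma>, of \<tau>s] \<tau>s by (simp_all add: ks_def)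
  have f: "composable1 M ?f (permute_list (inv ?\<rho>) (?P ?gs))"
    using untwist1(1) len by (simp add: inv_comp)
  have \<rho>f: "?\<rho> permutes {..<arity1 M ?f}" using \<rho> cod inv_\<sigma>' by (simp add: M.act1)
  have ks_P: "map (arity1 M) (?P ?gs) = ?P ks"
    using inv_\<sigma>n len ks_gs by (simp add: permute_list_map[symmetric] del: map_map)
  have P\<rho>s: "perms_of (map (arity1 M) (?P ?gs)) (?P ?\<rho>s)"
    unfolding ks_P using \<rho>s inv_\<sigma>n by (intro perms_of_permute) (simp_all add: ks_def)
  let ?S = "sym_iso F ?\<rho> ?f" and ?Ss = "map2 (sym_iso F) (?P ?\<rho>s) (?P ?gs)"
  have S: "composable2 N ?S ?Ss" using f \<rho>f P\<rho>s by (rule composable2_sym_iso)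
  have F: "composable2 N (fun2 F ?\<alpha>) (map (fun2 F) (?P ?\<beta>s))"
    using untwist2(1) by (rule composable2_map)
  have Ss: "?Ss = ?P (map2 (sym_iso F) ?\<rho>s ?gs)"
    using inv_\<sigma>n len by (simp add: permute_list_map2)
  have Fs: "map (fun2 F) (?P ?\<beta>s) = ?P (map (fun2 F) ?\<beta>s)"
    using inv_\<sigma>n len by (simp add: permute_list_map)
  have facs_nth: "dom2 N (sym_iso F (\<tau>s' ! i \<circ> inv (\<tau>s ! i)) (act1 M (cod2 M (\<beta>s ! i)) (inv (\<tau>s' ! i)))) =
      cod2 N (fun2 F (act2 M (\<beta>s ! i) (inv (\<tau>s ! i))))" if "i < length \<beta>s" for i
    using twist_factors[OF nth[OF that]] by simp
  have facs: "map (dom2 N) (map2 (sym_iso F) ?\<rho>s ?gs) = map (cod2 N) (map (fun2 F) ?\<beta>s)"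
    "twists = map2 (vcomp N) (map2 (sym_iso F) ?\<rho>s ?gs) (map (fun2 F) ?\<beta>s)"
    using len facs_nth by (auto simp: twists_def twist_def intro!: nth_equalityI)
  have twists: "?P twists = map2 (vcomp N) ?Ss (map (fun2 F) (?P ?\<beta>s))"
    unfolding facs(2) Ss Fs using inv_\<sigma>n len by (intro permute_list_map2) simp_all
  have doms: "map (dom2 N) ?Ss = map (cod2 N) (map (fun2 F) (?P ?\<beta>s))"
    unfolding Ss Fs using inv_\<sigma>n len facs(1) by (simp add: permute_list_map[symmetric] del: map_map)
  have "sym_iso F (block_perm ?\<rho> (?P ks) (?P ?\<rho>s)) (gamma1 M ?f (permute_list (inv ?\<rho>) (?P ?gs))) =
      gamma2 N ?S ?Ss"
    using sym_block[OF f \<rho>f P\<rho>s] unfolding ks_P .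
  \<comment> \<open>The blockwise discrepancy is the discrepancy of the block permutations: composed
    with \<open>?B\<close> on the right it gives \<open>?B'\<close>, since
    \<open>?\<rho> \<circ> \<sigma>\<close> is \<open>\<sigma>'\<close> and likewise in each
    block.\<close>
  moreover have "block_perm ?\<rho> (?P ks) (?P ?\<rho>s) = ?B' \<circ> inv ?B"
  proof -
    have "map2 (\<circ>) ?\<rho>s \<tau>s = \<tau>s'"
      using len permutes_cancel(1)[OF nth(2)] by (auto intro!: nth_equalityI)
    moreover have "block_perm ?\<rho> (?P ks) (?P ?\<rho>s) \<circ> ?B = block_perm (?\<rho> \<circ> \<sigma>) ks (map2 (\<circ>) ?\<rho>s \<tau>s)"
      using \<rho> \<sigma> n \<tau>s len by (intro block_perm_comp) (simp_all add: ks_def)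
    ultimately have "block_perm ?\<rho> (?P ks) (?P ?\<rho>s) \<circ> ?B = ?B'"
      using \<sigma> by (simp add: permutes_cancel)
    then show ?thesis using permutes_cancel(2)[OF B] by metis
  qed
  moreover have "permute_list (inv ?\<rho>) (?P ?gs) = permute_list (inv \<sigma>') ?gs"
    using len by (simp add: inv_comp)
  ultimately have syms: "gamma2 N ?S ?Ss =
      sym_iso F (?B' \<circ> inv ?B) (act1 M (cod2 M (gamma2 M \<alpha> \<beta>s)) (inv ?B'))"
    by (simp only: untwist1(2) M.gamma2(3)[OF \<alpha>])
  have A: "twist \<alpha> \<sigma> \<sigma>' = vcomp N ?S (fun2 F ?\<alpha>)" by (simp add: twist_def)
  have gamma: "gamma2 N (twist \<alpha> \<sigma> \<sigma>') (?P twists) = twist (gamma2 M \<alpha> \<beta>s) ?B ?B'"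
  proof -
    have "gamma2 N (twist \<alpha> \<sigma> \<sigma>') (?P twists) =
        vcomp N (gamma2 N ?S ?Ss) (gamma2 N (fun2 F ?\<alpha>) (map (fun2 F) (?P ?\<beta>s)))"
      unfolding A twists using twist_factors[OF cells(1) \<sigma> \<sigma>'] doms by (intro N.gamma2_vcomp F S) simp_all
    also have "gamma2 N (fun2 F ?\<alpha>) (map (fun2 F) (?P ?\<beta>s)) = fun2 F (act2 M (gamma2 M \<alpha> \<beta>s) (inv ?B))"
      unfolding untwist2(2) using untwist2(1) by (rule preserves_gamma2[symmetric])
    finally show ?thesis unfolding syms by (simp only: twist_def)
  qed
  have "set twists \<subseteq> Cell2 N"
    using nth len by (auto simp: twists_def set_conv_nth twist)
  moreover have "map (\<lambda>\<beta>. tgt N (dom2 N \<beta>)) twists = map (fun0 F) (map (\<lambda>\<beta>. tgt M (dom2 M \<beta>)) \<beta>s)"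
    using nth len M.cell2_typed
    by (auto simp: twists_def twist fun1 M.act1 permutes_inv intro!: nth_equalityI)
  moreover have "src N (dom2 N (twist \<alpha> \<sigma> \<sigma>')) = ?P (map (fun0 F) (src M (dom2 M \<alpha>)))"
    using cells M.cell2_typed inv_\<sigma> \<sigma> \<sigma>' by (simp add: twist fun1 M.act1 permute_list_map)
  moreover have "length twists = length \<beta>s" using len by (simp add: twists_def)
  ultimately have comp: "composable2 N (twist \<alpha> \<sigma> \<sigma>') (?P twists)"
    using \<alpha> inv_\<sigma>n twist(1)[OF cells(1) \<sigma> \<sigma>']
    by (simp add: composable2_def permute_list_map[symmetric] del: map_map)
  have "\<sigma> permutes {..<arity2 N (twist \<alpha> \<sigma> \<sigma>')}"
    using cells M.cell2_typed inv_\<sigma> \<sigma> \<sigma>' by (simp add: twist fun1 M.act1)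
  from N.equivariance2[OF comp this, of \<tau>s] \<tau>s show ?thesis
    unfolding arity_list gamma by simp
qed

section \<open>The induced symmetric multifunctor\<close>

definition phi :: "('o \<times> unit, 'c \<times> be_cell, 'd \<times> (be_cell \<times> be_cell), 'p, 'e, 'g) multifunctor" where
  "phi = \<lparr>
     fun0 = (\<lambda>a. fun0 F (fst a)),
     fun1 = (\<lambda>x. act1 N (fun1 F (act1 M (fst x) (inv (snd (snd x))))) (snd (snd x))),
     fun2 = (\<lambda>y. act2 N (twist (fst y) (snd (fst (snd y))) (snd (snd (snd y)))) (snd (fst (snd y))))\<rparr>"

lemma phi_simps [simp]:
  "fun0 phi = (\<lambda>a. fun0 F (fst a))"
  "fun1 phi = (\<lambda>x. act1 N (fun1 F (act1 M (fst x) (inv (snd (snd x))))) (snd (snd x)))"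
  "fun2 phi = (\<lambda>y. act2 N (twist (fst y) (snd (fst (snd y))) (snd (snd (snd y)))) (snd (fst (snd y))))"
  by (simp_all add: phi_def)

lemma arity_twist:
  assumes "\<alpha> \<in> Cell2 M" "\<sigma> permutes {..<arity2 M \<alpha>}" "\<tau> permutes {..<arity2 M \<alpha>}"
  shows "arity2 N (twist \<alpha> \<sigma> \<tau>) = arity2 M \<alpha>"
  using assms M.cell2_typed by (simp add: twist fun1 M.act1 permutes_inv)

text \<open>Equivariance is used on both sides: in \<open>N\<close> it gathers the separate actions
  into one block permutation, and in \<open>M\<close>, through \<open>untwist1\<close>, it
  recognises the remaining composite as the argument at which F is evaluated for the composite
  cell.\<close>

lemma phi_gamma1:
  assumes "composable1 (times_be M) x ys"
  shows "fun1 phi (gamma1 (times_be M) x ys) = gamma1 N (fun1 phi x) (map (fun1 phi) ys)"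
proof -
  let ?f = "fst x" and ?\<sigma> = "snd (snd x)" and ?gs = "map fst ys" and ?\<tau>s = "map (\<lambda>y. snd (snd y)) ys"
  let ?ks = "map (arity1 M) ?gs"
  let ?hs = "map2 (act1 M) ?gs (map inv ?\<tau>s)"
  note D = times_be_composable1D[OF assms]
  have cells: "?f \<in> Cell1 M" "set ?gs \<subseteq> Cell1 M" using D(1) by (simp_all add: composable1_def)
  have hs: "map (arity1 M) ?hs = ?ks"
    using cells(2) perms_of_inv[OF D(3)] by (rule M.map_arity1_act1)
  have "composable1 M ?f ?hs"
    using D(1) perms_of_inv[OF D(3)] by (rule M.composable1_map2_act)
  then have "set ?hs \<subseteq> Cell1 M" by (simp add: composable1_def)
  then have "map (arity1 N) (map (fun1 F) ?hs) = map (arity1 M) ?hs"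
    by (auto simp: fun1 subset_eq)
  then have ks: "map (arity1 N) (map (fun1 F) ?hs) = ?ks" unfolding hs .
  have "inv ?\<sigma> permutes {..<length ?hs}"
    using permutes_inv[OF D(2)] M.length_composable1[OF D(1)] by simp
  then have P: "permute_list (inv ?\<sigma>) (map (fun1 F) ?hs) = map (fun1 F) (permute_list (inv ?\<sigma>) ?hs)"
    by (rule permute_list_map)
  have map_phi: "map (fun1 phi) ys = map2 (act1 N) (map (fun1 F) ?hs) ?\<tau>s"
    by (auto intro!: nth_equalityI)
  note U = M.untwist1[OF D(1-3)]
  have f: "act1 M ?f (inv ?\<sigma>) \<in> Cell1 M" "arity1 M (act1 M ?f (inv ?\<sigma>)) = arity1 M ?f"
    using cells(1) permutes_inv[OF D(2)] by (simp_all add: M.act1)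
  have "gamma1 N (fun1 phi x) (map (fun1 phi) ys) =
      act1 N (gamma1 N (fun1 F (act1 M ?f (inv ?\<sigma>))) (map (fun1 F) (permute_list (inv ?\<sigma>) ?hs)))
        (block_perm ?\<sigma> ?ks ?\<tau>s)"
    unfolding map_phi
    using N.equivariance1[of "fun1 F (act1 M ?f (inv ?\<sigma>))" ?\<sigma> "map (fun1 F) ?hs" ?\<tau>s]
      composable1_map[OF U(1)] D(2,3) f arity_fun1
    unfolding P ks by simp
  also have "gamma1 N (fun1 F (act1 M ?f (inv ?\<sigma>))) (map (fun1 F) (permute_list (inv ?\<sigma>) ?hs)) =
      fun1 F (act1 M (gamma1 M ?f ?gs) (inv (block_perm ?\<sigma> ?ks ?\<tau>s)))"
    unfolding U(2) using U(1) by (rule preserves_gamma1[symmetric])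
  finally show ?thesis by (simp add: D(4))
qed

lemma phi_gamma2:
  assumes "composable2 (times_be M) y zs"
  shows "fun2 phi (gamma2 (times_be M) y zs) = gamma2 N (fun2 phi y) (map (fun2 phi) zs)"
proof -
  note D = times_be_composable2D[OF assms]
  let ?\<tau>s = "map (\<lambda>z. snd (fst (snd z))) zs" and ?\<tau>s' = "map (\<lambda>z. snd (snd (snd z))) zs"
  have "map (fun2 phi) zs =
      map2 (act2 N) (map2 (\<lambda>\<beta> (\<tau>, \<tau>'). twist \<beta> \<tau> \<tau>') (map fst zs) (zip ?\<tau>s ?\<tau>s')) ?\<tau>s"
    by (auto intro!: nth_equalityI)
  then show ?thesis
    using twist_gamma[OF D(1-5)] D(6,7) by simp
qed

lemma symmetric_phi: "symmetric_multifunctor (times_be M) N phi"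
proof -
  have typed: "fun1 phi x \<in> Cell1 N \<and> src N (fun1 phi x) = map (fun0 phi) (src (times_be M) x) \<and>
      tgt N (fun1 phi x) = fun0 phi (tgt (times_be M) x)"
    if "x \<in> Cell1 (times_be M)" for x
  proof -
    obtain f n \<sigma> where x: "x = (f, n, \<sigma>)" by (cases x)
    have f: "f \<in> Cell1 M" "\<sigma> permutes {..<arity1 M f}" "n = arity1 M f" using that x by auto
    then have "permute_list \<sigma> (map (fun0 F) (permute_list (inv \<sigma>) (src M f))) = map (fun0 F) (src M f)"
      by (simp add: permute_list_map[symmetric] permute_list_inv_cancel permutes_inv)
    then show ?thesis
      using f x by (simp add: fun1 M.act1 N.act1 permutes_inv zip_replicate2)
  qed
  interpret prod: cat_multicategory "times_be M"
    by (intro cat_multicategory_prod M.cat_multicategory_axioms cat_multicategory_barratt_eccles)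
  interpret phi: cat_multifunctor "times_be M" N phi
  proof (rule cat_multifunctorI, goal_cases)
    case (3 a)
    then show ?case by (simp add: fun0_typed)
  next
    case (4 x)
    then show ?case by (rule typed)
  next
    case (5 y)
    note D = times_be_cell2D[OF 5]
    \<comment> \<open>At the codomain the actions by \<open>\<tau> \<circ> inv \<sigma>\<close> and
      then by \<sigma> combine to \<tau>, as required of the value at the codomain 1-cell.\<close>
    show ?case
      using arity_twist[OF D(1-3)] permutes_cancel(1)[OF D(2)] D(1-3)
        M.cell2_typed[OF D(1)] M.parallel[OF D(1)]
      by (simp add: twist N.act2 N.act1_act1 permutes_compose permutes_inv fun1 M.act1)
  next
    case (6 x)
    then show ?case
      by (simp add: twist_ident N.act2_ident fun1 M.act1 permutes_inv)
  next
    case (7 y z)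
    let ?\<alpha> = "fst y" and ?\<beta> = "fst z" and ?\<sigma> = "snd (fst (snd y))" and ?\<tau> = "snd (snd (snd y))"
      and ?\<rho> = "snd (snd (snd z))"
    have \<alpha>: "?\<alpha> \<in> Cell2 M" "?\<beta> \<in> Cell2 M" "dom2 M ?\<beta> = cod2 M ?\<alpha>" "fst (snd z) = snd (snd y)"
      using 7 by simp_all
    have arity: "arity2 M ?\<beta> = arity2 M ?\<alpha>" using \<alpha> M.parallel by simp
    have perms: "?\<sigma> permutes {..<arity2 M ?\<alpha>}" "?\<tau> permutes {..<arity2 M ?\<alpha>}"
      "?\<rho> permutes {..<arity2 M ?\<alpha>}"
      using times_be_cell2D(2,3)[OF 7(1)] times_be_cell2D(3)[OF 7(2)] arity by simp_all
    note perms_\<beta> = perms(2,3)[folded arity]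
    have \<kappa>: "?\<tau> \<circ> inv ?\<sigma> permutes {..<arity2 M ?\<alpha>}"
      using perms by (intro permutes_compose permutes_inv)
    have ar: "arity2 N (twist ?\<beta> ?\<tau> ?\<rho>) = arity2 M ?\<alpha>" "arity2 N (twist ?\<alpha> ?\<sigma> ?\<tau>) = arity2 M ?\<alpha>"
      using arity_twist[OF \<alpha>(2) perms_\<beta>] arity_twist[OF \<alpha>(1) perms(1,2)] by (simp_all only: arity)
    have tw: "twist ?\<beta> ?\<tau> ?\<rho> \<in> Cell2 N" "twist ?\<alpha> ?\<sigma> ?\<tau> \<in> Cell2 N"
      "act1 N (dom2 N (twist ?\<beta> ?\<tau> ?\<rho>)) (?\<tau> \<circ> inv ?\<sigma>) = cod2 N (twist ?\<alpha> ?\<sigma> ?\<tau>)"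
      using twist[OF \<alpha>(2) perms_\<beta>] twist[OF \<alpha>(1) perms(1,2)] by (simp_all only: \<alpha>(3))
    \<comment> \<open>Acting by \<sigma> turns the correction
      \<open>?\<tau> \<circ> inv ?\<sigma>\<close> of \<open>twist_vcomp\<close> into
      \<open>?\<tau>\<close>, the domain permutation of the second cell and hence its outer action
      under \<open>phi\<close>.\<close>
    have "act2 N (vcomp N (act2 N (twist ?\<beta> ?\<tau> ?\<rho>) (?\<tau> \<circ> inv ?\<sigma>)) (twist ?\<alpha> ?\<sigma> ?\<tau>)) ?\<sigma> =
        vcomp N (act2 N (act2 N (twist ?\<beta> ?\<tau> ?\<rho>) (?\<tau> \<circ> inv ?\<sigma>)) ?\<sigma>) (act2 N (twist ?\<alpha> ?\<sigma> ?\<tau>) ?\<sigma>)"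
      using tw ar \<kappa> perms by (intro N.act2_vcomp) (simp_all add: N.act2)
    also have "act2 N (act2 N (twist ?\<beta> ?\<tau> ?\<rho>) (?\<tau> \<circ> inv ?\<sigma>)) ?\<sigma> = act2 N (twist ?\<beta> ?\<tau> ?\<rho>) ?\<tau>"
      using tw ar \<kappa> perms by (simp add: N.act2_act2 permutes_cancel)
    finally show ?case
      unfolding phi_simps multicat_prod_simps barratt_eccles_simps fst_conv snd_conv \<alpha>(4)
        twist_vcomp[OF \<alpha>(1-3) perms] .
  next
    case (8 a)
    then show ?case
      using M.unit1[of "fst a"] by (simp add: M.act1_id N.act1_id preserves_unit N.unit1 fun0_typed)
  next
    case (9 x ys)
    then show ?case by (rule phi_gamma1)
  next
    case (10 y zs)
    then show ?case by (rule phi_gamma2)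
  qed (simp_all add: prod.cat_multicategory_axioms N.cat_multicategory_axioms)
  show ?thesis
  proof (unfold_locales, goal_cases)
    case (1 x \<tau>)
    obtain f n \<sigma> where x: "x = (f, n, \<sigma>)" by (cases x)
    have f: "f \<in> Cell1 M" "\<sigma> permutes {..<arity1 M f}" "\<tau> permutes {..<arity1 M f}" "n = arity1 M f"
      using 1 x by auto
    \<comment> \<open>F is evaluated at the same 1-cell before and after acting by \<tau>, so only
      the outer action changes, from \<sigma> to \<open>\<sigma> \<circ> \<tau>\<close>.\<close>
    have "act1 M (act1 M f \<tau>) (inv (\<sigma> \<circ> \<tau>)) = act1 M f (inv \<sigma>)"
      using f by (simp add: o_inv_distrib permutes_bij M.act1_act1 permutes_inv permutes_compose permutes_cancel)
    then show ?case
      using f x by (simp add: be_act_def N.act1_act1 fun1 M.act1 permutes_inv)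
  next
    case (2 y \<rho>)
    then show ?case
      using times_be_cell2D[OF 2(1)] arity_twist[of "fst y" "snd (fst (snd y))" "snd (snd (snd y))"]
      by (simp add: be_act_def twist_act twist N.act2_act2)
  qed
qed

text \<open>All 2-cells involved have domain permutation \<open>id\<close>, so the outer action is
  trivial. The symmetry isomorphism of \<eta> at \<sigma> lies over
  \<open>act1 M f \<sigma>\<close>; undoing \<sigma> at its codomain recovers \<open>f\<close>,
  which leaves the isomorphism of F at \<sigma> and \<open>f\<close> composed with an
  identity.\<close>

lemma phi_eta:
  "pseudo_multifunctor_eq M F (pseudo_comp N (symmetric_as_pseudo (times_be M) N phi) (eta M))"
proof -
  have "fun1 phi (fun1 (eta M) f) = fun1 F f" if "f \<in> Cell1 M" for f
    using that by (simp add: inv_id M.act1_id N.act1_id fun1)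
  moreover have "fun2 phi (fun2 (eta M) \<alpha>) = fun2 F \<alpha>" if "\<alpha> \<in> Cell2 M" for \<alpha>
    using that M.cell2_typed N.vcomp_ident(1)[of "fun2 F \<alpha>"]
    by (simp add: twist_def inv_id M.act1_id M.act2_id N.act2_id sym_id fun2)
  moreover have "vcomp N (ident2 N (fun1 phi (act1 (times_be M) (fun1 (eta M) f) \<sigma>)))
      (fun2 phi (sym_iso (eta M) \<sigma> f)) = sym_iso F \<sigma> f"
    if f: "f \<in> Cell1 M" and \<sigma>: "\<sigma> permutes {..<arity1 M f}" for f \<sigma>
  proof -
    have "fun2 phi (sym_iso (eta M) \<sigma> f) = vcomp N (sym_iso F \<sigma> f) (ident2 N (fun1 F (act1 M f \<sigma>)))"
      using f \<sigma> by (simp add: twist_def inv_id M.act1_inv M.ident2 M.act1 M.act2_id fun2_ident N.act2_id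
          N.vcomp sym_iso N.ident2 fun1)
    also have "\<dots> = sym_iso F \<sigma> f"
      using N.vcomp_ident(2)[OF sym_iso(1)[OF f \<sigma>]] by (simp add: sym_iso[OF f \<sigma>])
    finally show ?thesis
      using N.vcomp_ident(1)[OF sym_iso(1)[OF f \<sigma>]] f \<sigma>
      by (simp add: sym_iso[OF f \<sigma>] be_act_def M.act1_inv)
  qed
  ultimately show ?thesis
    by (simp add: pseudo_multifunctor_eq_def multifunctor_eq_def pseudo_comp_def symmetric_as_pseudo_def
        del: eta_simps(2-) phi_simps(2-))
qed

lemma phi_unique:
  assumes sym: "symmetric_multifunctor (times_be M) N \<psi>"
    and eq: "pseudo_multifunctor_eq M F (pseudo_comp N (symmetric_as_pseudo (times_be M) N \<psi>) (eta M))"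
  shows "multifunctor_eq (times_be M) \<psi> phi"
proof -
  interpret \<psi>: symmetric_multifunctor "times_be M" N \<psi> by (rule sym)
  interpret eta: pseudo_symmetric_multifunctor M "times_be M" "eta M" by (rule M.pseudo_symmetric_eta)
  let ?P = "times_be M"
  have \<psi>0: "fun0 \<psi> (a, ()) = fun0 F a" if "a \<in> Ob M" for a
    using eq that by (simp add: pseudo_multifunctor_eq_def multifunctor_eq_def pseudo_comp_def
        symmetric_as_pseudo_def)
  have \<psi>1: "fun1 \<psi> (fun1 (eta M) f) = fun1 F f" if "f \<in> Cell1 M" for f
    using eq that by (simp add: pseudo_multifunctor_eq_def multifunctor_eq_def pseudo_comp_def
        symmetric_as_pseudo_def)
  have \<psi>2: "fun2 \<psi> (fun2 (eta M) \<alpha>) = fun2 F \<alpha>" if "\<alpha> \<in> Cell2 M" for \<alpha>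
    using eq that by (simp add: pseudo_multifunctor_eq_def multifunctor_eq_def pseudo_comp_def
        symmetric_as_pseudo_def)
  \<comment> \<open>Here the equality of symmetry isomorphisms enters: that of \<psi> is an
    identity, so the one of the composite is just the image under \<psi> of the one of
    \<eta>.\<close>
  have \<psi>_sym: "fun2 \<psi> (sym_iso (eta M) \<sigma> f) = sym_iso F \<sigma> f"
    if f: "f \<in> Cell1 M" and \<sigma>: "\<sigma> permutes {..<arity1 M f}" for f \<sigma>
  proof -
    note s = eta.sym_iso[OF f \<sigma>]
    have "sym_iso F \<sigma> f =
        vcomp N (ident2 N (fun1 \<psi> (act1 ?P (fun1 (eta M) f) \<sigma>))) (fun2 \<psi> (sym_iso (eta M) \<sigma> f))"
      using eq f \<sigma> by (simp add: pseudo_multifunctor_eq_def pseudo_comp_def symmetric_as_pseudo_def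
          del: eta_simps multicat_prod_simps)
    also have "fun1 \<psi> (act1 ?P (fun1 (eta M) f) \<sigma>) = cod2 N (fun2 \<psi> (sym_iso (eta M) \<sigma> f))"
      using \<psi>.fun2(3)[OF s(1)] unfolding s(3) by simp
    finally show ?thesis using N.vcomp_ident(1)[OF \<psi>.fun2(1)[OF s(1)]] by simp
  qed
  have "fun1 \<psi> x = fun1 phi x" if x: "x \<in> Cell1 ?P" for x
  proof -
    let ?f = "fst x" and ?\<sigma> = "snd (snd x)"
    note f = times_be_cell1D[OF x]
    let ?f' = "act1 M ?f (inv ?\<sigma>)"
    have f0: "?f' \<in> Cell1 M" "arity1 M ?f' = arity1 M ?f" using f by (simp_all add: M.act1 permutes_inv)
    have x_eq: "act1 ?P (fun1 (eta M) ?f') ?\<sigma> = x"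
      using f(3) by (simp add: be_act_def M.act1_inv(2)[OF f(1,2)] f0(2) prod_eq_iff)
    have "fun1 \<psi> (act1 ?P (fun1 (eta M) ?f') ?\<sigma>) = act1 N (fun1 \<psi> (fun1 (eta M) ?f')) ?\<sigma>"
      using eta.fun1(1)[OF f0(1)] f(2)[folded f0(2), folded eta.arity_fun1[OF f0(1)]]
      by (rule \<psi>.preserves_act1)
    then show ?thesis unfolding x_eq \<psi>1[OF f0(1)] by simp
  qed
  moreover have "fun2 \<psi> y = fun2 phi y" if y: "y \<in> Cell2 ?P" for y
  proof -
    let ?\<alpha> = "fst y" and ?\<sigma> = "snd (fst (snd y))" and ?\<tau> = "snd (snd (snd y))"
    note \<alpha> = times_be_cell2D[OF y]
    have cod: "cod2 M ?\<alpha> \<in> Cell1 M" "arity1 M (cod2 M ?\<alpha>) = arity2 M ?\<alpha>" "dom2 M ?\<alpha> \<in> Cell1 M"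
      using \<alpha> M.cell2_typed M.parallel by simp_all
    note invs = permutes_inv[OF \<alpha>(2)] permutes_inv[OF \<alpha>(3)]
    let ?h = "act1 M (cod2 M ?\<alpha>) (inv ?\<tau>)" and ?\<kappa> = "?\<tau> \<circ> inv ?\<sigma>" and ?\<alpha>' = "act2 M ?\<alpha> (inv ?\<sigma>)"
    let ?S = "sym_iso (eta M) ?\<kappa> ?h" and ?A = "fun2 (eta M) ?\<alpha>'"
    have \<kappa>: "?\<kappa> permutes {..<arity2 M ?\<alpha>}" using \<alpha> invs by (intro permutes_compose)
    have h: "?h \<in> Cell1 M" "arity1 M ?h = arity2 M ?\<alpha>" using cod invs by (simp_all add: M.act1)
    note \<kappa>h = \<kappa>[folded h(2)]
    have \<alpha>0: "?\<alpha>' \<in> Cell2 M" "arity2 M ?\<alpha>' = arity2 M ?\<alpha>"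
      using \<alpha> invs cod by (simp_all add: M.act2 M.act1)
    have h\<kappa>: "act1 M ?h ?\<kappa> = act1 M (cod2 M ?\<alpha>) (inv ?\<sigma>)"
      using cod \<kappa> invs \<alpha>(3) by (simp add: M.act1_act1 permutes_cancel)
    then have "vcomp M (ident2 M (act1 M ?h ?\<kappa>)) ?\<alpha>' = ?\<alpha>'"
      using M.vcomp_ident(1)[OF \<alpha>0(1)] \<alpha> invs by (simp add: M.act2)
    \<comment> \<open>The first component is \<open>?\<alpha>'\<close> followed by an identity, and
      acting by \<open>?\<sigma>\<close> restores \<open>?\<alpha>\<close>. In the second, the arrow
      from \<open>id\<close> to \<open>?\<kappa>\<close> is translated to one from
      \<open>?\<sigma>\<close> to \<open>?\<tau>\<close>.\<close>
    then have y_eq: "y = act2 ?P (vcomp ?P ?S ?A) ?\<sigma>"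
      using \<alpha> \<alpha>0 h by (simp add: be_act_def M.act2_inv prod_eq_iff permutes_cancel)
    note S = eta.sym_iso[OF h(1) \<kappa>h] and A = eta.fun2[OF \<alpha>0(1)]
    have dom: "dom2 ?P ?S = cod2 ?P ?A"
      unfolding S(2) A(3) using h\<kappa> \<alpha> invs by (simp add: M.act2)
    have "fun2 \<psi> y = act2 N (fun2 \<psi> (vcomp ?P ?S ?A)) ?\<sigma>"
    proof (subst y_eq, rule \<psi>.preserves_act2)
      show "vcomp ?P ?S ?A \<in> Cell2 ?P" using A(1) S(1) dom by (rule \<psi>.M.vcomp)
      show "?\<sigma> permutes {..<arity2 ?P (vcomp ?P ?S ?A)}"
        unfolding \<psi>.M.vcomp(2)[OF A(1) S(1) dom] eta.arity_fun2[OF \<alpha>0(1)] \<alpha>0(2) by (rule \<alpha>(2))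
    qed
    also have "fun2 \<psi> (vcomp ?P ?S ?A) = vcomp N (fun2 \<psi> ?S) (fun2 \<psi> ?A)"
      using A(1) S(1) dom by (rule \<psi>.fun2_vcomp)
    also have "fun2 \<psi> ?S = sym_iso F ?\<kappa> ?h" using h(1) \<kappa>h by (rule \<psi>_sym)
    also have "fun2 \<psi> ?A = fun2 F ?\<alpha>'" using \<alpha>0(1) by (rule \<psi>2)
    finally show ?thesis by (simp only: phi_simps twist_def comp_def)
  qed
  ultimately show ?thesis
    using \<psi>0 by (auto simp: multifunctor_eq_def simp del: phi_simps(2-))
qed

end

theorem theorem1p1:
  fixes M :: "('o, 'c, 'd) multicat"
  assumes "cat_multicategory M"
  shows "pseudo_symmetric_multifunctor M (times_be M) (eta M) \<and>
    (\<forall>(N :: ('p, 'e, 'g) multicat) F.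
      cat_multicategory N \<longrightarrow> pseudo_symmetric_multifunctor M N F \<longrightarrow>
      (\<exists>\<phi>. (symmetric_multifunctor (times_be M) N \<phi> \<and>
             pseudo_multifunctor_eq M F
               (pseudo_comp N (symmetric_as_pseudo (times_be M) N \<phi>) (eta M))) \<and>
           (\<forall>\<psi>. symmetric_multifunctor (times_be M) N \<psi> \<and>
             pseudo_multifunctor_eq M F
               (pseudo_comp N (symmetric_as_pseudo (times_be M) N \<psi>) (eta M)) \<longrightarrow>
             multifunctor_eq (times_be M) \<psi> \<phi>)))"
proof -
  interpret cat_multicategory M by fact
  have "\<exists>\<phi>. (symmetric_multifunctor (times_be M) N \<phi> \<and>
           pseudo_multifunctor_eq M F
             (pseudo_comp N (symmetric_as_pseudo (times_be M) N \<phi>) (eta M))) \<and>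
         (\<forall>\<psi>. symmetric_multifunctor (times_be M) N \<psi> \<and>
           pseudo_multifunctor_eq M F
             (pseudo_comp N (symmetric_as_pseudo (times_be M) N \<psi>) (eta M)) \<longrightarrow>
           multifunctor_eq (times_be M) \<psi> \<phi>)"
    if "pseudo_symmetric_multifunctor M N F" for N :: "('p, 'e, 'g) multicat" and F
  proof -
    interpret pseudo_symmetric_multifunctor M N F by (rule that)
    show ?thesis using symmetric_phi phi_eta phi_unique by blast
  qed
  with pseudo_symmetric_eta show ?thesis by blast
qed

end
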